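(* For any real $s\ge1$ which is not an even integer, there exist constants $c_s>0$ and $c_s'>0$ such that for all positive integers $q\le p$, $$\inf_{\widehat T}\ \sup_{\mathbf A\in\mathbb R^{p\times q}:\ \|\mathbf A\|_\infty\le0.125(pq)^{1/4}}\mathbb E\big[\,|\widehat T-\|\mathbf A\|_s^s|\,\big]\ \ge\ c_s\,\frac{q}{\log^s(q)\vee1}\,(pq)^{s/4},$$ $$\inf_{\widehat T}\ \sup_{\mathbf A\in\mathbb R^{p\times q}:\ \|\mathbf A\|_\infty\le0.125(pq)^{1/4}}\mathbb E\big[\,|\widehat T-\|\mathbf A\|_s|\,\big]\ \ge\ c_s'\,\frac{q^{1/s}}{\log^s(q)\vee1}\,(pq)^{1/4}.$$
   Context: $\mathbf Y=\mathbf A+\mathbf E$, where $\mathbf A$ is a deterministic real $p\times q$ matrix and $\mathbf E$ is a $p\times q$ random matrix with independent standard normal entries. The infima are over all estimators $\widehat T$, i.e. real-valued measurable functions of $\mathbf Y$, and expectations are under the law of $\mathbf Y$ with parameter $\mathbf A$. $\sigma_1(\mathbf A)\ge\dots\ge\sigma_q(\mathbf A)\ge0$ are the singular values, $\|\mathbf A\|_\infty=\sigma_1(\mathbf A)$, and $\|\mathbf A\|_s^s=\sum_{i=1}^q\sigma_i^s(\mathbf A)$. $x\vee y=\max(x,y)$. *)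

theory Defs
  imports
    "HOL-Probability.Probability"
    "HOL-Computational_Algebra.Polynomial"
    "Jordan_Normal_Form.Char_Poly"
begin

text \<open>
  Square roots of the eigenvalues of the Gram matrix, with multiplicity, in decreasing order;
  the list is indexed from 0. The Gram matrix is symmetric and positive semidefinite, so all
  its eigenvalues are real and the list has one entry per column. For a matrix with at least
  as many rows as columns this is the usual list of singular values (for a wide matrix it
  would be padded with zeros).
\<close>

definition singular_values :: "real mat \<Rightarrow> real list" where
  "singular_values A =
     rev (sorted_list_of_multiset (image_mset sqrt (proots (char_poly (transpose_mat A * A)))))"

definition spectral_norm :: "real mat \<Rightarrow> real" where
  "spectral_norm A = singular_values A ! 0"

definition schatten_power :: "real \<Rightarrow> real mat \<Rightarrow> real" where
  "schatten_power s A = (\<Sum>\<sigma>\<leftarrow>singular_values A. \<sigma> powr s)"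

definition schatten_norm :: "real \<Rightarrow> real mat \<Rightarrow> real" where
  "schatten_norm s A = schatten_power s A powr (1 / s)"

definition gaussian_entries :: "nat \<Rightarrow> nat \<Rightarrow> (nat \<times> nat \<Rightarrow> real) measure" where
  "gaussian_entries p q = (\<Pi>\<^sub>M ij\<in>{..<p} \<times> {..<q}. std_normal_distribution)"

text \<open>
  Measurability refers to the Borel sets of the space of \<open>p \<times> q\<close> matrices, parametrized by
  their entries. The values of an estimator on matrices of other dimensions play no role.
\<close>

definition estimators :: "nat \<Rightarrow> nat \<Rightarrow> (real mat \<Rightarrow> real) set" where
  "estimators p q =
     {T. (\<lambda>Y. T (Matrix.mat p q Y)) \<in> borel_measurable (\<Pi>\<^sub>M ij\<in>{..<p} \<times> {..<q}. borel)}"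

text \<open>
  The expected absolute error of \<open>T\<close> for the target \<open>\<phi> A\<close> when the observation is \<open>Y = A + E\<close>.
  It is extended-valued, since an estimator need not be integrable.
\<close>

definition risk :: "nat \<Rightarrow> nat \<Rightarrow> (real mat \<Rightarrow> real) \<Rightarrow> (real mat \<Rightarrow> real) \<Rightarrow> real mat \<Rightarrow> ennreal" where
  "risk p q \<phi> T A =
     (\<integral>\<^sup>+ E. ennreal \<bar>T (A + Matrix.mat p q E) - \<phi> A\<bar> \<partial>gaussian_entries p q)"

end

theory Submission
  imports Defs
begin

text \<open>Write \<open>M = 0.125 (pq)\<^bsup>1/4\<^esup>\<close>. The bound compares two random signals of rank at most \<open>r\<close>, about \<open>q / 2\<close>,
  \<open>A = \<Sum>\<^sub>k M x(a\<^sub>k) u\<^sub>k v\<^sub>k\<^sup>T\<close>, with orthonormal systems \<open>u\<close>, \<open>v\<close> and independent labels \<open>a\<^sub>k\<close> drawn from a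
  finite prior \<open>\<nu>0\<close> or \<open>\<nu>1\<close>. The singular values are \<open>M x(a\<^sub>k)\<close>, so the Schatten power is a sum of \<open>r\<close>
  independent terms: it concentrates, within \<open>M\<^sup>s \<surd>r\<close>, around a mean that differs between the
  priors by \<open>M\<^sup>s r \<kappa>\<close>, where \<open>\<kappa>\<close> is the difference of the means of \<open>x\<^sup>s\<close>. If the two observations
  are statistically close, an estimator must err by the order of \<open>M\<^sup>s r \<kappa>\<close> on one of them
  (lemma \<open>risk_lower_bound\<close>).

  The priors have equal moments of order \<open>2l\<close> for all \<open>l < L\<close>, and still
  \<open>\<kappa> \<ge> c L\<^bsup>-s\<^esup>\<close> (lemma \<open>moment_matched_priors_exist\<close>). They are the two signs of an explicit signed
  measure on the points \<open>cos (2 \<pi> j / 4L)\<close>: an alternating sign times a Fejer kernel. Fourier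
  analysis on the roots of unity shows that this measure annihilates polynomials of degree
  below \<open>L\<close>, that all its power moments are nonnegative, and that those of order beyond a multiple of \<open>L\<^sup>2\<close>
  are at least \<open>1/8\<close>. Since \<open>s / 2\<close> is no integer, the binomial series of
  \<open>(1 - y)\<^bsup>s/2\<^esup>\<close> does not terminate, its coefficients are eventually of one sign up to \<open>(-1)\<^sup>m\<close>
  and of order \<open>m\<^bsup>-s/2-1\<^esup>\<close>, and the terms with \<open>m\<close> of order \<open>L\<^sup>2\<close> add up to the claimed \<open>L\<^bsup>-s\<^esup>\<close>.

  Closeness is shown by changing the prior of one singular value at a time. Given all other
  spikes, the \<open>j\<close>-th one still has a random direction in the space left over by the others, which
  has at least half of the full dimension on both sides. The chi-square distance of the two
  mixtures is then a power series in the scalar product of two random directions;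
  matched moments remove its first \<open>2L\<close> terms, and the scale \<open>M\<close> makes the rest at most
  \<open>18 \<cdot> 100\<^bsup>-L\<^esup>\<close> (lemma \<open>spiked_chi_square_le\<close>). With \<open>L\<close> of order \<open>log q\<close> the \<open>r\<close> exchanges
  together cost at most one half.

  Making all these directions random at once asks for a random pair of orthonormal frames
  whose law is invariant under reflections. Instead of constructing Haar measure, a finite
  separated set of frames of maximal cardinality is used: averages of slowly varying functions over it
  change little under any isometry (lemma \<open>almost_invariant_average\<close>), and Gaussian noise makes all
  functions in question slowly varying.

  For bounded \<open>q\<close> a single spike of size \<open>0\<close> or \<open>M\<close> suffices. The bound for the norm follows from
  the one for the power, because \<open>t \<mapsto> t\<^sup>s\<close> is Lipschitz on the range of possible norms.\<close>

section \<open>Gaussian shifts\<close>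

lemma nn_integral_std_normal_shift:
  fixes b :: real and f :: "real \<Rightarrow> ennreal"
  assumes [measurable]: "f \<in> borel_measurable borel"
  shows "(\<integral>\<^sup>+ x. f (b + x) \<partial>std_normal_distribution)
    = (\<integral>\<^sup>+ x. ennreal (exp (b * x - b\<^sup>2 / 2)) * f x \<partial>std_normal_distribution)"
proof -
  have "(\<integral>\<^sup>+ x. f (b + x) \<partial>std_normal_distribution)
      = (\<integral>\<^sup>+ x. ennreal (std_normal_density ((b + 1 * x) - b)) * f (b + 1 * x) \<partial>lborel)"
    by (subst nn_integral_density) auto
  also have "\<dots> = (\<integral>\<^sup>+ x. ennreal (std_normal_density (x - b)) * f x \<partial>lborel)"
    using nn_integral_real_affine[of "\<lambda>x. ennreal (std_normal_density (x - b)) * f x" 1 b] by simp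
  also have "\<dots> = (\<integral>\<^sup>+ x. ennreal (std_normal_density x) * (ennreal (exp (b * x - b\<^sup>2 / 2)) * f x) \<partial>lborel)"
  proof (rule nn_integral_cong)
    fix x :: real
    have "std_normal_density (x - b) = std_normal_density x * exp (b * x - b\<^sup>2 / 2)"
      by (simp add: std_normal_density_def exp_add[symmetric] power2_diff algebra_simps add_divide_distrib diff_divide_distrib)
    thus "ennreal (std_normal_density (x - b)) * f x
        = ennreal (std_normal_density x) * (ennreal (exp (b * x - b\<^sup>2 / 2)) * f x)"
      by (simp add: ennreal_mult mult.assoc)
  qed
  also have "\<dots> = (\<integral>\<^sup>+ x. ennreal (exp (b * x - b\<^sup>2 / 2)) * f x \<partial>std_normal_distribution)"
    by (subst nn_integral_density) auto
  finally show ?thesis .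
qed

definition gauss :: "'i set \<Rightarrow> ('i \<Rightarrow> real) measure" where
  "gauss I = (\<Pi>\<^sub>M i\<in>I. std_normal_distribution)"

definition gauss_shift :: "'i set \<Rightarrow> ('i \<Rightarrow> real) \<Rightarrow> ('i \<Rightarrow> real) \<Rightarrow> 'i \<Rightarrow> real" where
  "gauss_shift I b x = (\<lambda>i\<in>I. b i + x i)"

definition shift_density :: "'i set \<Rightarrow> ('i \<Rightarrow> real) \<Rightarrow> ('i \<Rightarrow> real) \<Rightarrow> real" where
  "shift_density I b x = (\<Prod>i\<in>I. exp (b i * x i - (b i)\<^sup>2 / 2))"

lemma sets_gauss: "sets (gauss I) = sets (\<Pi>\<^sub>M i\<in>I. borel)"
  unfolding gauss_def by (intro sets_PiM_cong) auto

lemma prob_space_gauss: "prob_space (gauss I)"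
  unfolding gauss_def by (intro prob_space_PiM prob_space_normal_density) auto

lemma gauss_shift_measurable [measurable]:
  "gauss_shift I b \<in> measurable (gauss I) (\<Pi>\<^sub>M i\<in>I. borel)"
  unfolding gauss_def gauss_shift_def by measurable

lemma shift_density_measurable [measurable]:
  assumes "finite I"
  shows "shift_density I b \<in> borel_measurable (gauss I)"
  unfolding gauss_def shift_density_def by measurable

lemma shift_density_nonneg: "0 \<le> shift_density I b x"
  unfolding shift_density_def by (intro prod_nonneg) auto

text \<open>The Cameron-Martin formula. Both sides are products over the coordinates, so it suffices to
  compare them on boxes, where the one-dimensional substitution applies.\<close>
lemma distr_gauss_shift:
  assumes [simp]: "finite I"
  shows "distr (gauss I) (\<Pi>\<^sub>M i\<in>I. borel) (gauss_shift I b)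
    = density (gauss I) (\<lambda>x. ennreal (shift_density I b x))"
proof -
  define N where "N = (\<lambda>i. distr std_normal_distribution borel (\<lambda>x. b i + x))"
  have pN: "prob_space (N i)" for i
    unfolding N_def by (intro prob_space.prob_space_distr prob_space_normal_density) auto
  have sN: "sets (N i) = sets borel" for i unfolding N_def by simp
  interpret N: product_sigma_finite N
    using pN by (auto simp: product_sigma_finite_def prob_space_imp_sigma_finite)
  interpret S: product_sigma_finite "\<lambda>i. std_normal_distribution"
    by (auto simp: product_sigma_finite_def prob_space_imp_sigma_finite prob_space_normal_density)
  have sets1: "sets (\<Pi>\<^sub>M i\<in>I. borel) = sets (PiM I N)"
    by (intro sets_PiM_cong) (auto simp: sN)
  have "distr (gauss I) (\<Pi>\<^sub>M i\<in>I. borel) (gauss_shift I b) = PiM I N"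
  proof (rule N.PiM_eqI)
    fix A assume A: "\<And>i. i \<in> I \<Longrightarrow> A i \<in> sets (N i)"
    hence A' [measurable]: "\<And>i. i \<in> I \<Longrightarrow> A i \<in> sets borel" by (simp add: sN)
    have "emeasure (distr (gauss I) (\<Pi>\<^sub>M i\<in>I. borel) (gauss_shift I b)) (Pi\<^sub>E I A)
        = emeasure (gauss I) (gauss_shift I b -` Pi\<^sub>E I A \<inter> space (gauss I))"
      by (intro emeasure_distr sets_PiM_I_finite gauss_shift_measurable) (auto simp: A')
    also have "gauss_shift I b -` Pi\<^sub>E I A \<inter> space (gauss I) = Pi\<^sub>E I (\<lambda>i. {x. b i + x \<in> A i})"
      by (auto simp: gauss_shift_def gauss_def space_PiM PiE_iff)
    also have "emeasure (gauss I) \<dots> = (\<Prod>i\<in>I. emeasure std_normal_distribution {x. b i + x \<in> A i})"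
      unfolding gauss_def
    proof (intro S.emeasure_PiM)
      fix i assume "i \<in> I"
      note A'[OF this, measurable]
      show "{x. b i + x \<in> A i} \<in> sets std_normal_distribution" by simp
    qed simp
    also have "\<dots> = (\<Prod>i\<in>I. emeasure (N i) (A i))"
      unfolding N_def by (intro prod.cong refl, subst emeasure_distr) (auto simp: A' vimage_def)
    finally show "emeasure (distr (gauss I) (\<Pi>\<^sub>M i\<in>I. borel) (gauss_shift I b)) (Pi\<^sub>E I A)
       = (\<Prod>i\<in>I. emeasure (N i) (A i))" .
  qed (use sets1 in auto)
  moreover have "density (gauss I) (\<lambda>x. ennreal (shift_density I b x)) = PiM I N"
  proof (rule N.PiM_eqI)
    fix A assume A: "\<And>i. i \<in> I \<Longrightarrow> A i \<in> sets (N i)"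
    hence A' [measurable]: "\<And>i. i \<in> I \<Longrightarrow> A i \<in> sets borel" by (simp add: sN)
    have "emeasure (density (gauss I) (\<lambda>x. ennreal (shift_density I b x))) (Pi\<^sub>E I A)
       = (\<integral>\<^sup>+x. ennreal (shift_density I b x) * indicator (Pi\<^sub>E I A) x \<partial>gauss I)"
      by (intro emeasure_density) (auto simp: sets_gauss intro!: sets_PiM_I_finite A')
    also have "\<dots> = (\<integral>\<^sup>+x. (\<Prod>i\<in>I. ennreal (exp (b i * x i - (b i)\<^sup>2 / 2)) * indicator (A i) (x i)) \<partial>gauss I)"
    proof (rule nn_integral_cong)
      fix x assume "x \<in> space (gauss I)"
      hence x: "x \<in> extensional I" by (auto simp: gauss_def space_PiM PiE_def)
      have "indicator (Pi\<^sub>E I A) x = (\<Prod>i\<in>I. indicator (A i) (x i) :: ennreal)"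
        using x by (auto simp: indicator_def PiE_iff)
      thus "ennreal (shift_density I b x) * indicator (Pi\<^sub>E I A) x
         = (\<Prod>i\<in>I. ennreal (exp (b i * x i - (b i)\<^sup>2 / 2)) * indicator (A i) (x i))"
        by (simp add: shift_density_def prod.distrib prod_ennreal)
    qed
    also have "\<dots> = (\<Prod>i\<in>I. \<integral>\<^sup>+x. ennreal (exp (b i * x - (b i)\<^sup>2 / 2)) * indicator (A i) x \<partial>std_normal_distribution)"
      unfolding gauss_def by (intro S.product_nn_integral_prod) auto
    also have "\<dots> = (\<Prod>i\<in>I. emeasure (N i) (A i))"
    proof (intro prod.cong refl)
      fix i assume "i \<in> I"
      note [measurable] = A'[OF this]
      have "emeasure (N i) (A i) = emeasure std_normal_distribution {x. b i + x \<in> A i}"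
        unfolding N_def by (subst emeasure_distr) (auto simp: vimage_def)
      also have "\<dots> = (\<integral>\<^sup>+x. indicator (A i) (b i + x) \<partial>std_normal_distribution)"
      proof -
        have "(\<lambda>x. indicator (A i) (b i + x)) = (indicator {x. b i + x \<in> A i} :: real \<Rightarrow> ennreal)"
          by (auto split: split_indicator)
        thus ?thesis by simp
      qed
      also have "\<dots> = (\<integral>\<^sup>+x. ennreal (exp (b i * x - (b i)\<^sup>2 / 2)) * indicator (A i) x \<partial>std_normal_distribution)"
        by (rule nn_integral_std_normal_shift) auto
      finally show "(\<integral>\<^sup>+x. ennreal (exp (b i * x - (b i)\<^sup>2 / 2)) * indicator (A i) x \<partial>std_normal_distribution)
         = emeasure (N i) (A i)" ..
    qed
    finally show "emeasure (density (gauss I) (\<lambda>x. ennreal (shift_density I b x))) (Pi\<^sub>E I A)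
        = (\<Prod>i\<in>I. emeasure (N i) (A i))" .
  qed (use sets1 in \<open>auto simp: sets_gauss\<close>)
  ultimately show ?thesis by simp
qed

text \<open>Completing the square turns a product of two shift densities into a multiple of a third.\<close>
lemma shift_density_mult:
  assumes "finite I"
  shows "shift_density I b x * shift_density I c x
    = exp (\<Sum>i\<in>I. b i * c i) * shift_density I (\<lambda>i. b i + c i) x"
  unfolding shift_density_def exp_sum[OF assms] prod.distrib[symmetric]
  by (intro prod.cong refl) (simp add: exp_add[symmetric] power2_sum algebra_simps add_divide_distrib)

lemma shift_density_has_integral:
  assumes "finite I"
  shows "has_bochner_integral (gauss I) (shift_density I b) 1"
proof -
  interpret D: prob_space "distr (gauss I) (\<Pi>\<^sub>M i\<in>I. borel) (gauss_shift I b)"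
    by (intro prob_space.prob_space_distr prob_space_gauss gauss_shift_measurable)
  have "(\<integral>\<^sup>+x. ennreal (shift_density I b x) \<partial>gauss I)
     = emeasure (density (gauss I) (\<lambda>x. ennreal (shift_density I b x))) (space (gauss I))"
    using assms by (subst emeasure_density) (auto intro!: nn_integral_cong)
  also have "\<dots> = 1"
    using D.emeasure_space_1 unfolding distr_gauss_shift[OF assms] by simp
  finally show ?thesis
    using assms by (intro has_bochner_integral_nn_integral) (auto simp: shift_density_nonneg)
qed

lemma integral_gauss_shift:
  fixes \<psi> :: "('i \<Rightarrow> real) \<Rightarrow> real"
  assumes "finite I" "\<psi> \<in> borel_measurable (\<Pi>\<^sub>M i\<in>I. borel)"
  shows "(\<integral>x. \<psi> (gauss_shift I b x) \<partial>gauss I) = (\<integral>x. shift_density I b x * \<psi> x \<partial>gauss I)"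
proof -
  have m: "\<psi> \<in> borel_measurable (gauss I)"
    using assms(2) measurable_cong_sets[OF sets_gauss refl] by blast
  have "(\<integral>x. \<psi> (gauss_shift I b x) \<partial>gauss I)
      = (\<integral>x. \<psi> x \<partial>distr (gauss I) (\<Pi>\<^sub>M i\<in>I. borel) (gauss_shift I b))"
    by (rule integral_distr[symmetric]) (use assms in auto)
  also have "\<dots> = (\<integral>x. shift_density I b x * \<psi> x \<partial>gauss I)"
    unfolding distr_gauss_shift[OF assms(1)] using assms(1) m
    by (subst integral_density) (auto simp: shift_density_nonneg)
  finally show ?thesis .
qed

text \<open>Relative to the law of the noise shifted by \<open>B0\<close>, the signed mixture has the density
  \<open>\<Sum>\<^sub>k w\<^sub>k exp (B\<^sub>k \<bullet> x - \<bar>B\<^sub>k\<bar>\<^sup>2 / 2)\<close>. Its second moment is the double sum on the right, and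
  Cauchy-Schwarz bounds the integral of \<open>\<psi>\<close> against it. Measuring both mixtures against a pure
  Gaussian law, and not against one of them, keeps this second moment explicit.\<close>
lemma gauss_mixture_bound:
  fixes \<psi> :: "('i \<Rightarrow> real) \<Rightarrow> real" and w :: "'k \<Rightarrow> real" and B :: "'k \<Rightarrow> 'i \<Rightarrow> real"
  assumes I: "finite I" and K: "finite K" and \<psi>: "\<psi> \<in> borel_measurable (\<Pi>\<^sub>M i\<in>I. borel)"
    and b: "\<And>x. \<bar>\<psi> x\<bar> \<le> 1"
  shows "(\<Sum>k\<in>K. w k * (\<integral>x. \<psi> (gauss_shift I (\<lambda>i. B0 i + B k i) x) \<partial>gauss I))\<^sup>2
      \<le> (\<Sum>k\<in>K. \<Sum>l\<in>K. w k * w l * exp (\<Sum>i\<in>I. B k i * B l i))"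
proof -
  interpret G: prob_space "gauss I" by (rule prob_space_gauss)
  note [measurable] = \<psi>
  define \<phi> where "\<phi> = (\<lambda>x. \<psi> (gauss_shift I B0 x))"
  have \<phi>m [measurable]: "\<phi> \<in> borel_measurable (\<Pi>\<^sub>M i\<in>I. borel)"
    unfolding \<phi>_def gauss_shift_def by measurable
  have \<phi>m' [measurable]: "\<phi> \<in> borel_measurable (gauss I)"
    using \<phi>m measurable_cong_sets[OF sets_gauss refl] by blast
  have [measurable]: "shift_density I b \<in> borel_measurable (gauss I)" for b
    using I by measurable
  have \<phi>b: "\<bar>\<phi> x\<bar> \<le> 1" for x unfolding \<phi>_def by (rule b)
  define L where "L = (\<lambda>x. \<Sum>k\<in>K. w k * shift_density I (B k) x)"
  have Lm [measurable]: "L \<in> borel_measurable (gauss I)" unfolding L_def using I by measurable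
  have eq1: "(\<integral>x. \<psi> (gauss_shift I (\<lambda>i. B0 i + B k i) x) \<partial>gauss I)
       = (\<integral>x. shift_density I (B k) x * \<phi> x \<partial>gauss I)" for k
  proof -
    have "gauss_shift I (\<lambda>i. B0 i + B k i) x = gauss_shift I B0 (gauss_shift I (B k) x)" for x
      by (auto simp: gauss_shift_def)
    hence "(\<integral>x. \<psi> (gauss_shift I (\<lambda>i. B0 i + B k i) x) \<partial>gauss I)
        = (\<integral>x. \<phi> (gauss_shift I (B k) x) \<partial>gauss I)" by (simp add: \<phi>_def)
    also have "\<dots> = (\<integral>x. shift_density I (B k) x * \<phi> x \<partial>gauss I)"
      by (rule integral_gauss_shift[OF I \<phi>m])
    finally show ?thesis .
  qed
  have int1: "integrable (gauss I) (shift_density I b)" for b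
    using shift_density_has_integral[OF I] by (auto simp: has_bochner_integral_iff)
  have int2: "integrable (gauss I) (\<lambda>x. shift_density I b x * \<phi> x)" for b
    by (rule Bochner_Integration.integrable_bound[OF int1[of b]])
       (use \<phi>b in \<open>auto simp: abs_mult shift_density_nonneg intro!: mult_left_le\<close>)
  have int3: "integrable (gauss I) (\<lambda>x. shift_density I b x * shift_density I c x)" for b c
    unfolding shift_density_mult[OF I] using int1 by auto
  have val3: "(\<integral>x. shift_density I b x * shift_density I c x \<partial>gauss I) = exp (\<Sum>i\<in>I. b i * c i)" for b c
    unfolding shift_density_mult[OF I] using shift_density_has_integral[OF I]
    by (auto simp: has_bochner_integral_iff)
  have L2: "(L x)\<^sup>2 = (\<Sum>k\<in>K. \<Sum>l\<in>K. w k * w l * (shift_density I (B k) x * shift_density I (B l) x))" for x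
    unfolding L_def power2_eq_square sum_product by (simp add: algebra_simps)
  have intL2: "integrable (gauss I) (\<lambda>x. (L x)\<^sup>2)"
    unfolding L2 by (intro Bochner_Integration.integrable_sum integrable_mult_right int3)
  have valL2: "(\<integral>x. (L x)\<^sup>2 \<partial>gauss I) = (\<Sum>k\<in>K. \<Sum>l\<in>K. w k * w l * exp (\<Sum>i\<in>I. B k i * B l i))"
    unfolding L2 by (simp add: Bochner_Integration.integral_sum int3 val3)
  have Lphi: "L x * \<phi> x = (\<Sum>k\<in>K. w k * (shift_density I (B k) x * \<phi> x))" for x
    unfolding L_def by (simp add: sum_distrib_right mult.assoc)
  have sum_eq: "(\<Sum>k\<in>K. w k * (\<integral>x. \<psi> (gauss_shift I (\<lambda>i. B0 i + B k i) x) \<partial>gauss I)) = (\<integral>x. L x * \<phi> x \<partial>gauss I)"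
    unfolding Lphi eq1 by (simp add: int2)
  have intLphi: "integrable (gauss I) (\<lambda>x. L x * \<phi> x)"
    unfolding Lphi by (intro Bochner_Integration.integrable_sum integrable_mult_right int2)
  have sq_le: "(L x * \<phi> x)\<^sup>2 \<le> (L x)\<^sup>2" for x
  proof -
    have "(\<phi> x)\<^sup>2 \<le> 1" using \<phi>b[of x] by (simp add: abs_square_le_1)
    thus ?thesis by (simp add: power_mult_distrib mult_left_le)
  qed
  have intsq: "integrable (gauss I) (\<lambda>x. (L x * \<phi> x)\<^sup>2)"
    by (rule Bochner_Integration.integrable_bound[OF intL2]) (use sq_le in auto)
  have "(\<integral>x. L x * \<phi> x \<partial>gauss I)\<^sup>2 \<le> (\<integral>x. (L x * \<phi> x)\<^sup>2 \<partial>gauss I)"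
    using G.variance_positive[of "\<lambda>x. L x * \<phi> x"] G.variance_eq[OF intLphi intsq] by simp
  also have "\<dots> \<le> (\<integral>x. (L x)\<^sup>2 \<partial>gauss I)"
    by (intro integral_mono intsq intL2 sq_le)
  finally show ?thesis unfolding sum_eq valL2 .
qed

section \<open>Almost invariant averages\<close>

text \<open>Layer cake: a sum of nonnegative numbers is the integral over \<open>t \<ge> 0\<close> of the number of terms above \<open>t\<close>.\<close>
lemma sum_le_of_level_sets:
  fixes f :: "'a \<Rightarrow> real" and g :: "'b \<Rightarrow> real"
  assumes "finite A" "finite B" "\<And>x. x \<in> A \<Longrightarrow> 0 \<le> f x" "\<And>y. y \<in> B \<Longrightarrow> 0 \<le> g y"
    and levels: "\<And>t. 0 \<le> t \<Longrightarrow> card {x \<in> A. t < f x} \<le> card {y \<in> B. t < g y}"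
  shows "sum f A \<le> sum g B"
proof -
  have layer: "(\<integral>t. (\<Sum>x\<in>C. indicator {0..<h x} t) \<partial>lborel) = sum h C"
    "integrable lborel (\<lambda>t. \<Sum>x\<in>C. indicator {0..<h x} t :: real)"
    if "\<And>x. x \<in> C \<Longrightarrow> 0 \<le> h x" for C :: "'c set" and h :: "'c \<Rightarrow> real"
  proof -
    show "integrable lborel (\<lambda>t. \<Sum>x\<in>C. indicator {0..<h x} t :: real)"
      by (intro Bochner_Integration.integrable_sum) (auto intro!: integrable_real_indicator simp: that)
    have "(\<integral>t. (\<Sum>x\<in>C. indicator {0..<h x} t) \<partial>lborel) = (\<Sum>x\<in>C. \<integral>t. indicator {0..<h x} t \<partial>lborel :: real)"
      by (intro Bochner_Integration.integral_sum) (auto intro!: integrable_real_indicator simp: that)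
    also have "\<dots> = sum h C" by (intro sum.cong) (auto simp: that)
    finally show "(\<integral>t. (\<Sum>x\<in>C. indicator {0..<h x} t) \<partial>lborel) = sum h C" .
  qed
  have count: "(\<Sum>x\<in>C. indicator {0..<h x} t) = (if 0 \<le> t then real (card {x \<in> C. t < h x}) else 0)"
    if "finite C" for C :: "'c set" and h :: "'c \<Rightarrow> real" and t :: real
  proof -
    have "(\<Sum>x\<in>C. indicator {0..<h x} t) = (\<Sum>x\<in>C. if 0 \<le> t \<and> t < h x then 1 else 0 :: real)"
      by (intro sum.cong) (auto simp: indicator_def)
    also have "\<dots> = (if 0 \<le> t then real (card {x \<in> C. t < h x}) else 0)"
      using that by (simp add: sum.If_cases Int_def)
    finally show ?thesis .
  qed
  have "sum f A = (\<integral>t. (\<Sum>x\<in>A. indicator {0..<f x} t) \<partial>lborel)"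
    by (rule layer(1)[symmetric]) (use assms in auto)
  also have "\<dots> \<le> (\<integral>t. (\<Sum>y\<in>B. indicator {0..<g y} t) \<partial>lborel)"
  proof (rule integral_mono)
    show "(\<Sum>x\<in>A. indicator {0..<f x} t :: real) \<le> (\<Sum>y\<in>B. indicator {0..<g y} t)" for t
      unfolding count[OF assms(1)] count[OF assms(2)] using levels[of t] by simp
  qed (auto intro!: layer(2) assms)
  also have "\<dots> = sum g B" by (rule layer(1)) (use assms in auto)
  finally show ?thesis .
qed

definition separated :: "('x \<Rightarrow> 'x \<Rightarrow> real) \<Rightarrow> real \<Rightarrow> 'x set \<Rightarrow> bool" where
  "separated d \<epsilon> N \<longleftrightarrow> (\<forall>x\<in>N. \<forall>y\<in>N. x \<noteq> y \<longrightarrow> \<epsilon> \<le> d x y)"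

text \<open>Suppose a level set of \<open>f\<close> in \<open>N\<close> had more elements than there are points of \<open>N'\<close> near it.
  Replacing these points of \<open>N'\<close> by the level set would give a larger separated set. Hence level sets
  in \<open>N\<close> are at most as large as the slightly lower level sets in \<open>N'\<close>.\<close>
lemma maximal_separated_sum_le:
  fixes d :: "'x \<Rightarrow> 'x \<Rightarrow> real" and f :: "'x \<Rightarrow> real" and \<omega> :: real
  assumes eps: "0 < \<epsilon>" and sym: "\<And>x y. d x y = d y x" and refl: "\<And>x. d x x = 0"
    and N: "finite N" "N \<subseteq> X" "separated d \<epsilon> N"
    and N': "finite N'" "N' \<subseteq> X" "separated d \<epsilon> N'" "card N' = card N"
    and maxi: "\<And>P. finite P \<Longrightarrow> P \<subseteq> X \<Longrightarrow> separated d \<epsilon> P \<Longrightarrow> card P \<le> card N"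
    and f: "\<And>x. x \<in> X \<Longrightarrow> 0 \<le> f x"
    and mod: "\<And>x y. x \<in> X \<Longrightarrow> y \<in> X \<Longrightarrow> d x y < \<epsilon> \<Longrightarrow> f x \<le> f y + \<omega>"
    and om: "0 \<le> \<omega>"
  shows "sum f N \<le> sum f N' + card N * \<omega>"
proof -
  have "sum f N \<le> (\<Sum>y\<in>N'. f y + \<omega>)"
  proof (rule sum_le_of_level_sets)
    fix t :: real assume t: "0 \<le> t"
    define S where "S = {x \<in> N. t < f x}"
    define R where "R = {y \<in> N'. \<exists>x\<in>S. d x y < \<epsilon>}"
    have fin: "finite S" "finite R" using N N' by (auto simp: S_def R_def)
    have disj: "S \<inter> (N' - R) = {}" 
    proof (rule ccontr)
      assume "S \<inter> (N' - R) \<noteq> {}"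
      then obtain x where "x \<in> S" "x \<in> N'" "x \<notin> R" by blast
      moreover have "d x x < \<epsilon>" using refl eps by simp
      ultimately show False by (auto simp: R_def)
    qed
    have sep: "separated d \<epsilon> (S \<union> (N' - R))"
      unfolding separated_def
    proof (intro ballI impI)
      fix x y assume xy: "x \<in> S \<union> (N' - R)" "y \<in> S \<union> (N' - R)" "x \<noteq> y"
      consider "x \<in> S" "y \<in> S" | "x \<in> N' - R" "y \<in> N' - R" | "x \<in> S" "y \<in> N' - R" | "x \<in> N' - R" "y \<in> S"
        using xy by blast
      thus "\<epsilon> \<le> d x y"
      proof cases
        case 1 thus ?thesis using N(3) xy(3) by (auto simp: S_def separated_def)
      next
        case 2 thus ?thesis using N'(3) xy(3) by (auto simp: separated_def)
      next
        case 3 thus ?thesis by (auto simp: R_def not_less)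
      next
        case 4 thus ?thesis using sym[of x y] by (auto simp: R_def not_less)
      qed
    qed
    have "card S + card (N' - R) = card (S \<union> (N' - R))"
      using fin N' disj by (subst card_Un_disjoint) auto
    also have "\<dots> \<le> card N"
      using fin N N' sep by (intro maxi) (auto simp: S_def)
    also have "\<dots> = card R + card (N' - R)"
    proof -
      have "R \<union> (N' - R) = N'" by (auto simp: R_def)
      thus ?thesis using N' fin card_Un_disjoint[of R "N' - R"] by simp
    qed
    finally have "card S \<le> card R" by simp
    also have "\<dots> \<le> card {y \<in> N'. t < f y + \<omega>}"
    proof (rule card_mono)
      show "R \<subseteq> {y \<in> N'. t < f y + \<omega>}"
      proof
        fix y assume "y \<in> R"
        then obtain x where "y \<in> N'" "x \<in> N" "t < f x" "d x y < \<epsilon>" by (auto simp: R_def S_def)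
        thus "y \<in> {y \<in> N'. t < f y + \<omega>}" using mod[of x y] N N' by force
      qed
    qed (use N' in auto)
    finally show "card {x \<in> N. t < f x} \<le> card {y \<in> N'. t < f y + \<omega>}" by (simp add: S_def)
  qed (use N N' f om in \<open>auto intro!: add_nonneg_nonneg\<close>)
  thus ?thesis using N' by (simp add: sum.distrib)
qed

text \<open>A finite substitute for Haar measure. An isometry maps a separated set of maximal cardinality to
  another one, and by the exchange argument all these sets have nearly the same averages. The set \<open>N\<close>
  serves all isometries and all functions at once.\<close>
lemma almost_invariant_average:
  fixes d :: "'x \<Rightarrow> 'x \<Rightarrow> real"
  assumes eps: "0 < \<epsilon>" and sym: "\<And>x y. d x y = d y x" and refl: "\<And>x. d x x = 0"
    and "X \<noteq> {}" and bd: "\<And>P. finite P \<Longrightarrow> P \<subseteq> X \<Longrightarrow> separated d \<epsilon> P \<Longrightarrow> card P \<le> b"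
  obtains N where "finite N" "N \<noteq> {}" "N \<subseteq> X"
    "\<And>g (f :: 'x \<Rightarrow> real) (\<omega> :: real). \<lbrakk>g ` X \<subseteq> X; \<And>x y. x \<in> X \<Longrightarrow> y \<in> X \<Longrightarrow> d (g x) (g y) = d x y;
       \<And>x. x \<in> X \<Longrightarrow> 0 \<le> f x; 0 \<le> \<omega>;
       \<And>x y. x \<in> X \<Longrightarrow> y \<in> X \<Longrightarrow> d x y < \<epsilon> \<Longrightarrow> f x \<le> f y + \<omega>\<rbrakk>
      \<Longrightarrow> \<bar>(\<Sum>x\<in>N. f (g x)) - sum f N\<bar> \<le> card N * \<omega>"
proof -
  define Q where "Q = (\<lambda>P. finite P \<and> P \<subseteq> X \<and> separated d \<epsilon> P)"
  have "Q {}" by (auto simp: Q_def separated_def)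
  moreover have "\<forall>P. Q P \<longrightarrow> card P < Suc b" using bd by (auto simp: Q_def less_Suc_eq_le)
  ultimately obtain N where N: "Q N" "\<And>P. Q P \<Longrightarrow> card P \<le> card N"
    using ex_has_greatest_nat[of Q "{}" card "Suc b"] by auto
  obtain x0 where "x0 \<in> X" using \<open>X \<noteq> {}\<close> by blast
  hence "Q {x0}" by (auto simp: Q_def separated_def)
  hence "card N \<noteq> 0" using N(2)[of "{x0}"] by simp
  hence ne: "N \<noteq> {}" by auto
  show ?thesis
  proof (rule that[of N])
    fix g :: "'x \<Rightarrow> 'x" and f :: "'x \<Rightarrow> real" and \<omega> :: real
    assume g: "g ` X \<subseteq> X" "\<And>x y. x \<in> X \<Longrightarrow> y \<in> X \<Longrightarrow> d (g x) (g y) = d x y"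
      and f: "\<And>x. x \<in> X \<Longrightarrow> 0 \<le> f x" and om: "0 \<le> \<omega>"
      and mod: "\<And>x y. x \<in> X \<Longrightarrow> y \<in> X \<Longrightarrow> d x y < \<epsilon> \<Longrightarrow> f x \<le> f y + \<omega>"
    have NX: "finite N" "N \<subseteq> X" "separated d \<epsilon> N" using N(1) by (auto simp: Q_def)
    have inj: "inj_on g N"
    proof (rule inj_onI, rule ccontr)
      fix x y assume xy: "x \<in> N" "y \<in> N" "g x = g y" "x \<noteq> y"
      hence "\<epsilon> \<le> d x y" "x \<in> X" "y \<in> X" using NX by (auto simp: separated_def)
      hence "\<epsilon> \<le> d (g x) (g y)" using g(2)[of x y] by simp
      thus False using xy refl eps by simp
    qed
    have gN: "finite (g ` N)" "g ` N \<subseteq> X" "separated d \<epsilon> (g ` N)" "card (g ` N) = card N"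
      using NX g inj by (auto simp: separated_def card_image subset_iff)
    have maxi: "card P \<le> card N" if "finite P" "P \<subseteq> X" "separated d \<epsilon> P" for P
      using N(2) that by (auto simp: Q_def)
    have s: "(\<Sum>x\<in>N. f (g x)) = sum f (g ` N)" by (simp add: sum.reindex[OF inj])
    have "sum f N \<le> sum f (g ` N) + card N * \<omega>"
      using maximal_separated_sum_le[where d = d and \<epsilon> = \<epsilon> and X = X and N = N and N' = "g ` N" and f = f and \<omega> = \<omega>, OF eps sym refl NX gN maxi f mod om] .
    moreover have "sum f (g ` N) \<le> sum f N + card (g ` N) * \<omega>"
      by (rule maximal_separated_sum_le[where d = d and \<epsilon> = \<epsilon> and X = X and N = "g ` N" and N' = N and f = f and \<omega> = \<omega>, OF eps sym refl gN(1-3) NX])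
         (use gN maxi f mod om in auto)
    ultimately show "\<bar>(\<Sum>x\<in>N. f (g x)) - sum f N\<bar> \<le> card N * \<omega>"
      unfolding s gN(4) by linarith
  qed (use N ne in \<open>auto simp: Q_def\<close>)
qed

text \<open>Rounding the coordinates to a sufficiently fine grid is injective on a separated set.\<close>
lemma card_separated_cube_le:
  fixes c :: "'x \<Rightarrow> 'i \<Rightarrow> real"
  assumes I: "finite I" and eps: "0 < \<epsilon>"
    and c: "\<And>x i. x \<in> X \<Longrightarrow> i \<in> I \<Longrightarrow> \<bar>c x i\<bar> \<le> 1"
  obtains b where "\<And>P. finite P \<Longrightarrow> P \<subseteq> X \<Longrightarrow> separated (\<lambda>x y. \<Sum>i\<in>I. (c x i - c y i)\<^sup>2) \<epsilon> P \<Longrightarrow> card P \<le> b"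
proof -
  obtain n :: nat where n: "real (card I) / \<epsilon> < real n" using reals_Archimedean2 by blast
  have n0: "0 < n" using n eps by (cases n) (auto simp: field_simps intro: order_le_less_trans)
  define rnd where "rnd = (\<lambda>x. \<lambda>i\<in>I. \<lfloor>real n * c x i\<rfloor>)"
  define T where "T = (I \<rightarrow>\<^sub>E {-int n..int n})"
  have fT: "finite T" unfolding T_def by (intro finite_PiE I) auto
  show ?thesis
  proof (rule that[of "card T"])
    fix P assume P: "finite P" "P \<subseteq> X" "separated (\<lambda>x y. \<Sum>i\<in>I. (c x i - c y i)\<^sup>2) \<epsilon> P"
    have "rnd ` P \<subseteq> T"
    proof (clarsimp simp: T_def rnd_def)
      fix x i assume "x \<in> P" "i \<in> I"
      hence "\<bar>c x i\<bar> \<le> 1" using c P by auto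
      hence a: "real n * c x i \<le> real n * 1" "real n * (-1) \<le> real n * c x i"
        by (intro mult_left_mono; linarith)+
      show "- int n \<le> \<lfloor>real n * c x i\<rfloor> \<and> \<lfloor>real n * c x i\<rfloor> \<le> int n"
        using a by (auto simp: le_floor_iff floor_le_iff)
    qed
    moreover have "inj_on rnd P"
    proof (rule inj_onI, rule ccontr)
      fix x y assume xy: "x \<in> P" "y \<in> P" "rnd x = rnd y" "x \<noteq> y"
      have close: "(c x i - c y i)\<^sup>2 \<le> 1 / real n" if i: "i \<in> I" for i
      proof -
        have "\<lfloor>real n * c x i\<rfloor> = \<lfloor>real n * c y i\<rfloor>" using fun_cong[OF xy(3), of i] i by (simp add: rnd_def)
        hence "\<bar>real n * c x i - real n * c y i\<bar> \<le> 1" by linarith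
        hence "real n * \<bar>c x i - c y i\<bar> \<le> 1" by (simp add: abs_mult right_diff_distrib[symmetric])
        hence a: "\<bar>c x i - c y i\<bar> \<le> 1 / real n" using n0 by (simp add: field_simps)
        have "1 / real n \<le> 1" using n0 by simp
        hence "\<bar>c x i - c y i\<bar> * \<bar>c x i - c y i\<bar> \<le> (1 / real n) * 1" by (intro mult_mono) (use a in auto)
        thus ?thesis by (simp add: power2_eq_square)
      qed
      have "\<epsilon> \<le> (\<Sum>i\<in>I. (c x i - c y i)\<^sup>2)" using P(3) xy by (auto simp: separated_def)
      also have "\<dots> \<le> (\<Sum>i\<in>I. 1 / real n)" by (intro sum_mono close)
      also have "\<dots> < \<epsilon>" using n n0 eps by (simp add: field_simps)
      finally show False by simp
    qed
    ultimately show "card P \<le> card T" using fT by (metis card_image card_mono)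
  qed
qed

section \<open>Orthonormal frames and reflections\<close>

definition frame :: "nat \<Rightarrow> (nat \<Rightarrow> nat \<Rightarrow> real) \<Rightarrow> bool" where
  "frame n u \<longleftrightarrow> (\<forall>k<n. \<forall>l<n. (\<Sum>i<n. u k i * u l i) = of_bool (k = l))"

definition frame_dist :: "nat \<Rightarrow> (nat \<Rightarrow> nat \<Rightarrow> real) \<Rightarrow> (nat \<Rightarrow> nat \<Rightarrow> real) \<Rightarrow> real" where
  "frame_dist n u v = (\<Sum>(k, i)\<in>{..<n} \<times> {..<n}. (u k i - v k i)\<^sup>2)"

text \<open>The frame multiplied from the right by the reflection in the hyperplane orthogonal to \<open>w\<close>.
  For \<open>w = 0\<close> the factor \<open>2 / 0 = 0\<close> makes it the identity.\<close>
definition reflect :: "nat \<Rightarrow> (nat \<Rightarrow> real) \<Rightarrow> (nat \<Rightarrow> nat \<Rightarrow> real) \<Rightarrow> nat \<Rightarrow> nat \<Rightarrow> real" where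
  "reflect n w u = (\<lambda>k i. u k i - 2 / (\<Sum>l<n. (w l)\<^sup>2) * w k * (\<Sum>l<n. w l * u l i))"

lemma frame_identity: "frame n (\<lambda>k i. of_bool (k = i))"
proof -
  have "(\<Sum>i<n. of_bool (k = i) * of_bool (l = i)) = (of_bool (k = l) :: real)" if "k < n" for k l
  proof -
    have "(\<Sum>i<n. of_bool (k = i) * of_bool (l = i)) = (\<Sum>i<n. if k = i then of_bool (l = k) else (0 :: real))"
      by (intro sum.cong) auto
    thus ?thesis using that by (simp add: sum.delta)
  qed
  thus ?thesis by (auto simp: frame_def)
qed

lemma frame_entry_le_1:
  assumes "frame n u" "k < n" "i < n"
  shows "\<bar>u k i\<bar> \<le> 1"
proof -
  have "(u k i)\<^sup>2 \<le> (\<Sum>i<n. (u k i)\<^sup>2)"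
    using assms by (intro member_le_sum) auto
  also have "\<dots> = 1" using assms by (auto simp: frame_def power2_eq_square)
  finally show ?thesis by (simp add: abs_square_le_1)
qed

lemma frame_inner_product:
  assumes u: "frame n u"
  shows "(\<Sum>i<n. (\<Sum>k<n. x k * u k i) * (\<Sum>l<n. y l * u l i)) = (\<Sum>k<n. x k * y k)"
proof -
  have "(\<Sum>i<n. (\<Sum>k<n. x k * u k i) * (\<Sum>l<n. y l * u l i))
      = (\<Sum>i<n. \<Sum>k<n. \<Sum>l<n. x k * y l * (u k i * u l i))"
    by (simp add: sum_product algebra_simps)
  also have "\<dots> = (\<Sum>k<n. \<Sum>i<n. \<Sum>l<n. x k * y l * (u k i * u l i))" by (rule sum.swap)
  also have "\<dots> = (\<Sum>k<n. \<Sum>l<n. \<Sum>i<n. x k * y l * (u k i * u l i))"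
    by (intro sum.cong refl sum.swap)
  also have "\<dots> = (\<Sum>k<n. \<Sum>l<n. x k * y l * of_bool (k = l))"
    using u by (intro sum.cong refl) (simp add: sum_distrib_left[symmetric] frame_def)
  also have "\<dots> = (\<Sum>k<n. \<Sum>l<n. if k = l then x k * y k else 0)"
    by (intro sum.cong refl) auto
  also have "\<dots> = (\<Sum>k<n. x k * y k)" by (intro sum.cong refl) (simp add: sum.delta)
  finally show ?thesis .
qed

lemma frame_reflect:
  assumes u: "frame n u"
  shows "frame n (reflect n w u)"
  unfolding frame_def
proof (intro allI impI)
  fix k l assume kl: "k < n" "l < n"
  define W where "W = (\<Sum>l<n. (w l)\<^sup>2)"
  define a where "a = (\<lambda>k m. of_bool (m = k) - 2 / W * w k * w m)"
  have expand: "reflect n w u k i = (\<Sum>m<n. a k m * u m i)" if "k < n" for k i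
  proof -
    have "(\<Sum>m<n. a k m * u m i) = (\<Sum>m<n. (if m = k then u m i else 0) - 2 / W * w k * (w m * u m i))"
      by (intro sum.cong refl) (auto simp: a_def algebra_simps)
    also have "\<dots> = reflect n w u k i"
      using that unfolding sum_subtractf sum_distrib_left[symmetric] by (simp add: reflect_def W_def)
    finally show ?thesis ..
  qed
  have "(\<Sum>i<n. reflect n w u k i * reflect n w u l i) = (\<Sum>m<n. a k m * a l m)"
    using kl by (simp add: expand frame_inner_product[OF u])
  also have "\<dots> = (\<Sum>m<n. (if m = k then of_bool (k = l) else 0) - 2 / W * w l * (if m = k then w k else 0)
       - 2 / W * w k * (if m = l then w l else 0) + (2 / W)\<^sup>2 * w k * w l * (w m)\<^sup>2)"
    by (intro sum.cong refl) (auto simp: a_def algebra_simps power2_eq_square)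
  also have "\<dots> = of_bool (k = l) - 2 / W * w l * w k - 2 / W * w k * w l + (2 / W)\<^sup>2 * w k * w l * W"
  proof -
    have "(\<Sum>m<n. if m = k then of_bool (k = l) else 0) = (of_bool (k = l) :: real)"
      "(\<Sum>m<n. if m = k then w k else 0) = w k" "(\<Sum>m<n. if m = l then w l else 0) = w l"
      using kl by simp_all
    thus ?thesis by (simp only: sum.distrib sum_subtractf sum_distrib_left[symmetric] W_def[symmetric])
  qed
  also have "\<dots> = of_bool (k = l)" by (simp add: power2_eq_square field_simps)
  finally show "(\<Sum>i<n. reflect n w u k i * reflect n w u l i) = of_bool (k = l)" .
qed

text \<open>Reflecting a frame from the right acts on each of its coordinate columns by one and the same
  reflection, which preserves Euclidean distances.\<close>
lemma frame_dist_reflect: "frame_dist n (reflect n w u) (reflect n w v) = frame_dist n u v"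
proof -
  define W where "W = (\<Sum>l<n. (w l)\<^sup>2)"
  have col: "(\<Sum>k<n. (reflect n w u k i - reflect n w v k i)\<^sup>2) = (\<Sum>k<n. (u k i - v k i)\<^sup>2)" for i
  proof -
    define x where "x = (\<lambda>k. u k i - v k i)"
    define S where "S = (\<Sum>l<n. w l * x l)"
    have "reflect n w u k i - reflect n w v k i = x k - 2 / W * w k * S" for k
      by (simp add: reflect_def x_def S_def W_def right_diff_distrib sum_subtractf)
    hence "(\<Sum>k<n. (reflect n w u k i - reflect n w v k i)\<^sup>2)
        = (\<Sum>k<n. (x k)\<^sup>2 - 4 / W * S * (w k * x k) + (2 / W * S)\<^sup>2 * (w k)\<^sup>2)"
      by (simp only:) (simp add: power2_eq_square algebra_simps)
    also have "\<dots> = (\<Sum>k<n. (x k)\<^sup>2) - 4 / W * S * S + (2 / W * S)\<^sup>2 * W"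
      by (simp only: sum.distrib sum_subtractf sum_distrib_left[symmetric] W_def[symmetric] S_def[symmetric])
    also have "\<dots> = (\<Sum>k<n. (x k)\<^sup>2)" by (simp add: power2_eq_square field_simps)
    finally show ?thesis by (simp add: x_def)
  qed
  have "frame_dist n a b = (\<Sum>i<n. \<Sum>k<n. (a k i - b k i)\<^sup>2)" for a b
    unfolding frame_dist_def sum.cartesian_product[symmetric] by (rule sum.swap)
  thus ?thesis by (simp add: col)
qed

text \<open>The reflection in the direction \<open>e\<^sub>j - z\<close> exchanges the unit vectors \<open>e\<^sub>j\<close> and \<open>z\<close>.\<close>
definition steer :: "nat \<Rightarrow> nat \<Rightarrow> (nat \<Rightarrow> real) \<Rightarrow> (nat \<Rightarrow> nat \<Rightarrow> real) \<Rightarrow> nat \<Rightarrow> nat \<Rightarrow> real" where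
  "steer n j z = reflect n (\<lambda>k. of_bool (k = j) - z k)"

lemma steer_fixes:
  assumes "k \<noteq> j" "z k = 0"
  shows "steer n j z u k = u k"
  using assms by (auto simp: steer_def reflect_def)

lemma steer_moves:
  assumes j: "j < n" and z: "(\<Sum>k<n. (z k)\<^sup>2) = 1"
  shows "steer n j z u j i = (\<Sum>k<n. z k * u k i)"
proof -
  define w where "w = (\<lambda>k. of_bool (k = j) - z k)"
  have "(\<Sum>k<n. (w k)\<^sup>2) = (\<Sum>k<n. (z k)\<^sup>2 + (if k = j then 1 - 2 * z j else 0))"
    by (intro sum.cong) (auto simp: w_def power2_eq_square algebra_simps)
  also have "\<dots> = 2 * (1 - z j)" using j by (simp add: sum.distrib z)
  finally have W: "(\<Sum>k<n. (w k)\<^sup>2) = 2 * (1 - z j)" .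
  have "(\<Sum>k<n. w k * u k i) = (\<Sum>k<n. (if k = j then u j i else 0) - z k * u k i)"
    by (intro sum.cong) (auto simp: w_def algebra_simps)
  also have "\<dots> = u j i - (\<Sum>k<n. z k * u k i)" using j by (simp add: sum_subtractf)
  finally have S: "(\<Sum>k<n. w k * u k i) = u j i - (\<Sum>k<n. z k * u k i)" .
  show ?thesis
  proof (cases "z j = 1")
    case True
    hence "(\<Sum>k<n. (w k)\<^sup>2) = 0" using W by simp
    hence "\<forall>k<n. w k = 0" by (simp add: sum_nonneg_eq_0_iff)
    hence "(\<Sum>k<n. w k * u k i) = 0" by simp
    thus ?thesis using S \<open>\<forall>k<n. w k = 0\<close> j by (simp add: steer_def reflect_def w_def)
  next
    case False
    have "steer n j z u j i = u j i - 2 / (2 * (1 - z j)) * w j * (u j i - (\<Sum>k<n. z k * u k i))"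
      unfolding steer_def reflect_def using W S by (simp add: w_def)
    also have "2 / (2 * (1 - z j)) * w j = 1" using False by (simp add: w_def)
    finally show ?thesis by simp
  qed
qed

lemma frame_steer: "frame n u \<Longrightarrow> frame n (steer n j z u)"
  unfolding steer_def by (rule frame_reflect)

lemma frame_dist_steer: "frame_dist n (steer n j z u) (steer n j z v) = frame_dist n u v"
  unfolding steer_def by (rule frame_dist_reflect)

section \<open>Moments of random signs\<close>

definition signs :: "nat set \<Rightarrow> (nat \<Rightarrow> real) set" where
  "signs J = J \<rightarrow>\<^sub>E {-1, 1}"

lemma finite_signs: "finite J \<Longrightarrow> finite (signs J)"
  unfolding signs_def by (intro finite_PiE) auto

lemma card_signs: "finite J \<Longrightarrow> card (signs J) = 2 ^ card J"
  unfolding signs_def by (simp add: card_PiE numeral_2_eq_2)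

text \<open>The power series compare term by term, since \<open>2\<^sup>l l! \<le> (2l)!\<close>.\<close>
lemma cosh_le_exp_half_square: "cosh (t :: real) \<le> exp (t\<^sup>2 / 2)"
proof -
  have f: "2 ^ l * fact l \<le> (fact (2 * l) :: real)" for l
  proof (induction l)
    case (Suc l)
    have "2 ^ Suc l * fact (Suc l) = (2 * real (Suc l)) * (2 ^ l * fact l)" by simp
    also have "\<dots> \<le> (2 * real (Suc l)) * fact (2 * l)" by (intro mult_left_mono Suc.IH) auto
    also have "\<dots> \<le> (2 * real (Suc l) * real (2 * l + 1)) * fact (2 * l)"
      by (intro mult_right_mono) (auto simp: algebra_simps)
    also have "\<dots> = fact (2 * Suc l)" by (simp add: algebra_simps)
    finally show ?case .
  qed simp
  have e: "(\<lambda>l. (t\<^sup>2 / 2) ^ l /\<^sub>R fact l) sums exp (t\<^sup>2 / 2)" by (rule exp_converges)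
  have s1: "(\<lambda>n. if even n then (t\<^sup>2 / 2) ^ (n div 2) /\<^sub>R fact (n div 2) else 0) sums (0 + exp (t\<^sup>2 / 2))"
    by (rule sums_if[OF sums_zero e])
  have s2: "(\<lambda>n. if even n then t ^ n /\<^sub>R fact n else 0) sums cosh t" by (rule cosh_converges)
  have le: "(if even n then t ^ n /\<^sub>R fact n else 0)
      \<le> (if even n then (t\<^sup>2 / 2) ^ (n div 2) /\<^sub>R fact (n div 2) else 0)" for n
  proof (cases "even n")
    case True
    then obtain l where n: "n = 2 * l" by blast
    have tn: "t ^ n = (t\<^sup>2) ^ l" unfolding n by (rule power_mult)
    have "t ^ n /\<^sub>R fact n = t ^ n / fact n" by (simp add: field_simps)
    also have "\<dots> = (t\<^sup>2) ^ l / fact (2 * l)" by (simp only: tn) (simp only: n)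
    also have "(t\<^sup>2) ^ l / fact (2 * l) \<le> (t\<^sup>2) ^ l / (2 ^ l * fact l)" by (intro divide_left_mono f) auto
    also have "\<dots> = (t\<^sup>2 / 2) ^ (n div 2) /\<^sub>R fact (n div 2)"
    proof -
      have "n div 2 = l" by (simp add: n)
      thus ?thesis by (simp add: power_divide field_simps)
    qed
    finally show ?thesis using True by (simp only: if_True)
  next
    case False thus ?thesis by (simp only: if_False order_refl)
  qed
  have "cosh t \<le> 0 + exp (t\<^sup>2 / 2)" by (rule sums_le[OF le s2 s1])
  thus ?thesis by simp
qed

lemma sum_signs_exp:
  assumes J: "finite J" and e: "\<epsilon> \<in> signs J"
  shows "(\<Sum>\<eta>\<in>signs J. exp (t * (\<Sum>k\<in>J. \<epsilon> k * \<eta> k))) = (2 * cosh t) ^ card J"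
proof -
  have "(\<Sum>\<eta>\<in>signs J. exp (t * (\<Sum>k\<in>J. \<epsilon> k * \<eta> k))) = (\<Sum>\<eta>\<in>signs J. \<Prod>k\<in>J. exp (t * (\<epsilon> k * \<eta> k)))"
    using J by (simp add: sum_distrib_left exp_sum)
  also have "\<dots> = (\<Prod>k\<in>J. \<Sum>b\<in>{-1, 1}. exp (t * (\<epsilon> k * b)))"
    unfolding signs_def using J by (subst prod_sum_PiE) auto
  also have "\<dots> = (\<Prod>k\<in>J. 2 * cosh t)"
  proof (intro prod.cong refl)
    fix k assume "k \<in> J"
    hence "\<epsilon> k = -1 \<or> \<epsilon> k = 1" using e by (auto simp: signs_def)
    thus "(\<Sum>b\<in>{-1, 1}. exp (t * (\<epsilon> k * b))) = 2 * cosh t"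
      by (auto simp: cosh_field_def)
  qed
  finally show ?thesis by simp
qed

lemma sum_signs_minus:
  fixes F :: "(nat \<Rightarrow> real) \<Rightarrow> real"
  assumes "\<And>\<eta> \<eta>'. (\<And>k. k \<in> J \<Longrightarrow> \<eta> k = \<eta>' k) \<Longrightarrow> F \<eta> = F \<eta>'"
  shows "(\<Sum>\<eta>\<in>signs J. F (\<lambda>k. - \<eta> k)) = (\<Sum>\<eta>\<in>signs J. F \<eta>)"
proof -
  define m where "m = (\<lambda>\<eta>. \<lambda>k\<in>J. - \<eta> k :: real)"
  have "bij_betw m (signs J) (signs J)"
    by (rule bij_betw_byWitness[where f' = m]) (auto simp: m_def signs_def PiE_iff extensional_def fun_eq_iff)
  hence "(\<Sum>\<eta>\<in>signs J. F \<eta>) = (\<Sum>\<eta>\<in>signs J. F (m \<eta>))" by (metis sum.reindex_bij_betw)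
  also have "\<dots> = (\<Sum>\<eta>\<in>signs J. F (\<lambda>k. - \<eta> k))" by (intro sum.cong refl assms) (auto simp: m_def)
  finally show ?thesis ..
qed

abbreviation (input) sign_corr :: "nat set \<Rightarrow> (nat \<Rightarrow> real) \<Rightarrow> (nat \<Rightarrow> real) \<Rightarrow> real" where
  "sign_corr J \<epsilon> \<eta> \<equiv> (\<Sum>k\<in>J. \<epsilon> k * \<eta> k) / card J"

definition sign_moment :: "nat set \<Rightarrow> nat \<Rightarrow> (nat \<Rightarrow> real) \<Rightarrow> real" where
  "sign_moment J n \<epsilon> = (\<Sum>\<eta>\<in>signs J. sign_corr J \<epsilon> \<eta> ^ n) / 2 ^ card J"

lemma sign_moment_odd:
  assumes "odd n"
  shows "sign_moment J n \<epsilon> = 0"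
proof -
  define F where "F = (\<lambda>\<eta>. sign_corr J \<epsilon> \<eta> ^ n)"
  have "(\<Sum>\<eta>\<in>signs J. F (\<lambda>k. - \<eta> k)) = (\<Sum>\<eta>\<in>signs J. F \<eta>)"
    by (rule sum_signs_minus) (simp add: F_def)
  moreover have "F (\<lambda>k. - \<eta> k) = - F \<eta>" for \<eta>
    using assms by (simp add: F_def sum_negf)
  ultimately have "(\<Sum>\<eta>\<in>signs J. F \<eta>) = 0" by (simp add: sum_negf)
  thus ?thesis by (simp add: sign_moment_def F_def)
qed

text \<open>A Chernoff bound: \<open>\<bar>y\<bar>\<^sup>n / n! \<le> e\<^sup>y + e\<^bsup>-y\<^esup>\<close> at \<open>y = t S\<close>, where the exponential moments of the sign
  sum \<open>S\<close> are powers of \<open>cosh t\<close>. The choice \<open>t\<^sup>2 = n / card J\<close> minimises the result.\<close>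
lemma sign_moment_le:
  assumes J: "finite J" "J \<noteq> {}" and e: "\<epsilon> \<in> signs J" and n: "0 < n"
  shows "\<bar>sign_moment J n \<epsilon>\<bar> \<le> 2 * fact n * sqrt (exp 1 / (real n * card J)) ^ n"
proof -
  define m where "m = card J"
  have m: "0 < m" using J by (simp add: m_def card_gt_0_iff)
  define t where "t = sqrt (real n / m)"
  have t: "0 < t" using n m by (simp add: t_def)
  define S where "S = (\<lambda>\<eta>. \<Sum>k\<in>J. \<epsilon> k * \<eta> k)"
  have termwise: "\<bar>(S \<eta> / m) ^ n\<bar> \<le> fact n / (t * m) ^ n * (exp (t * S \<eta>) + exp ((-t) * S \<eta>))" for \<eta>
  proof -
    have "\<bar>t * S \<eta>\<bar> ^ n / fact n \<le> exp \<bar>t * S \<eta>\<bar>"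
    proof -
      have "(\<lambda>k. \<bar>t * S \<eta>\<bar> ^ k /\<^sub>R fact k) sums exp \<bar>t * S \<eta>\<bar>" by (rule exp_converges)
      from sum_le_suminf[OF sums_summable[OF this], of "{n}"] sums_unique[OF this]
      show ?thesis by (simp add: field_simps)
    qed
    also have "\<dots> \<le> exp (t * S \<eta>) + exp ((-t) * S \<eta>)"
      by (cases "0 \<le> t * S \<eta>") (auto simp: abs_if)
    finally have "\<bar>t * S \<eta>\<bar> ^ n \<le> fact n * (exp (t * S \<eta>) + exp ((-t) * S \<eta>))"
      by (simp add: field_simps)
    hence "\<bar>t * S \<eta>\<bar> ^ n / (t * m) ^ n \<le> fact n * (exp (t * S \<eta>) + exp ((-t) * S \<eta>)) / (t * m) ^ n"
      using t m by (intro divide_right_mono) auto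
    moreover have "\<bar>t * S \<eta>\<bar> ^ n / (t * m) ^ n = \<bar>(S \<eta> / m) ^ n\<bar>"
      using t m by (simp add: power_divide power_abs abs_mult power_mult_distrib)
    ultimately show ?thesis by simp
  qed
  have "\<bar>\<Sum>\<eta>\<in>signs J. (S \<eta> / m) ^ n\<bar> \<le> (\<Sum>\<eta>\<in>signs J. \<bar>(S \<eta> / m) ^ n\<bar>)" by (rule sum_abs)
  also have "\<dots> \<le> (\<Sum>\<eta>\<in>signs J. fact n / (t * m) ^ n * (exp (t * S \<eta>) + exp ((-t) * S \<eta>)))"
    by (intro sum_mono termwise)
  also have "\<dots> = fact n / (t * m) ^ n * ((2 * cosh t) ^ m + (2 * cosh (-t)) ^ m)"
    unfolding sum_distrib_left[symmetric] sum.distrib S_def sum_signs_exp[OF J(1) e] m_def ..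
  also have "\<dots> = fact n / (t * m) ^ n * (2 * (2 ^ m * cosh t ^ m))" by (simp add: power_mult_distrib)
  also have "\<dots> \<le> fact n / (t * m) ^ n * (2 * (2 ^ m * exp (t\<^sup>2 / 2) ^ m))"
    using t m by (intro mult_left_mono power_mono cosh_le_exp_half_square) auto
  finally have "\<bar>sign_moment J n \<epsilon>\<bar> \<le> 2 * fact n * (exp (t\<^sup>2 / 2) ^ m / (t * m) ^ n)"
    by (simp add: sign_moment_def S_def m_def field_simps)
  also have "exp (t\<^sup>2 / 2) ^ m / (t * m) ^ n = (sqrt (exp 1) / (t * m)) ^ n"
  proof -
    have "exp (t\<^sup>2 / 2) ^ m = exp (real n / 2)"
      using m by (simp add: exp_of_nat_mult[symmetric] t_def field_simps)
    also have "\<dots> = (exp (1/2)) ^ n" by (simp add: exp_of_nat_mult[symmetric])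
    also have "exp (1/2) = sqrt (exp (1 :: real))"
      by (rule real_sqrt_unique[symmetric]) (simp_all add: power2_eq_square exp_add[symmetric])
    finally show ?thesis by (simp add: power_divide)
  qed
  also have "sqrt (exp 1) / (t * m) = sqrt (exp 1 / (real n * card J))"
  proof -
    have tt: "t\<^sup>2 = real n / m" by (simp add: t_def)
    have "(t * m)\<^sup>2 = real n / m * (real m * real m)"
      by (simp only: power_mult_distrib tt power2_eq_square[of "real m"])
    also have "\<dots> = real n * m" using m by simp
    finally have "(t * m)\<^sup>2 = real n * m" .
    hence "t * m = sqrt (real n * m)"
      by (intro real_sqrt_unique[symmetric]) (use m t in auto)
    thus ?thesis by (simp add: real_sqrt_divide m_def)
  qed
  finally show ?thesis by simp
qed

section \<open>One random direction hides moment-matched singular values\<close>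

lemma fact_le_self_power: "fact n \<le> (real n) ^ n"
  by (metis fact_le_power of_nat_fact of_nat_le_iff of_nat_power order_refl)

text \<open>Expand the exponential. Its \<open>n\<close>-th term factors into the square of the \<open>n\<close>-th moment of the signed
  weights \<open>d\<close> and two sign moments. For odd \<open>n\<close> the sign moments vanish by symmetry, for even \<open>n < 2L\<close> the
  moments of \<open>d\<close> vanish. In the remaining terms two factorials from the sign moments meet only one in the
  denominator, but \<open>n! \<le> n\<^sup>n\<close> absorbs the excess, so they are at most \<open>16 \<cdot> 10\<^bsup>-n\<^esup>\<close>.\<close>
lemma spiked_chi_square_le:
  fixes x d :: "'a \<Rightarrow> real"
  assumes S: "finite S" and x: "\<And>a. a \<in> S \<Longrightarrow> \<bar>x a\<bar> \<le> 1" and d: "(\<Sum>a\<in>S. \<bar>d a\<bar>) \<le> 2"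
    and mom: "\<And>l. l < L \<Longrightarrow> (\<Sum>a\<in>S. d a * x a ^ (2 * l)) = 0" and L: "0 < L"
    and J: "finite J" "J \<noteq> {}" and J': "finite J'" "J' \<noteq> {}"
    and e: "\<epsilon> \<in> signs J" and e': "\<epsilon>' \<in> signs J'"
    and lam: "0 \<le> \<theta>" "10 * exp 1 * \<theta> \<le> sqrt (real (card J) * real (card J'))"
  shows "(\<Sum>a\<in>S. \<Sum>b\<in>S. d a * d b * (\<Sum>\<eta>\<in>signs J. \<Sum>\<eta>'\<in>signs J'.
       exp (\<theta> * x a * x b * sign_corr J \<epsilon> \<eta> * sign_corr J' \<epsilon>' \<eta>')))
     \<le> 2 ^ card J * 2 ^ card J' * (18 * (1 / 100) ^ L)"
proof -
  define m where "m = real (card J)"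
  define m' where "m' = real (card J')"
  have m: "0 < m" "0 < m'" using J J' by (auto simp: m_def m'_def card_gt_0_iff)
  define s where "s = (\<lambda>\<eta>. sign_corr J \<epsilon> \<eta>)"
  define s' where "s' = (\<lambda>\<eta>'. sign_corr J' \<epsilon>' \<eta>')"
  define D where "D = (\<lambda>n. \<Sum>a\<in>S. d a * x a ^ n)"
  define U where "U = (\<lambda>n. sign_moment J n \<epsilon>)"
  define U' where "U' = (\<lambda>n. sign_moment J' n \<epsilon>')"
  define T where "T = (\<lambda>n. \<theta> ^ n / fact n * (D n)\<^sup>2 * (U n * U' n))"
  have expsums: "(\<lambda>n. \<Sum>a\<in>S. \<Sum>b\<in>S. d a * d b * (\<Sum>\<eta>\<in>signs J. \<Sum>\<eta>'\<in>signs J'.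
        (\<theta> * x a * x b * s \<eta> * s' \<eta>') ^ n /\<^sub>R fact n)) sums
      (\<Sum>a\<in>S. \<Sum>b\<in>S. d a * d b * (\<Sum>\<eta>\<in>signs J. \<Sum>\<eta>'\<in>signs J'. exp (\<theta> * x a * x b * s \<eta> * s' \<eta>')))"
    by (intro sums_sum sums_mult exp_converges)
  have eqT: "(\<Sum>a\<in>S. \<Sum>b\<in>S. d a * d b * (\<Sum>\<eta>\<in>signs J. \<Sum>\<eta>'\<in>signs J'.
        (\<theta> * x a * x b * s \<eta> * s' \<eta>') ^ n /\<^sub>R fact n)) = 2 ^ card J * 2 ^ card J' * T n" for n
  proof -
    have "(\<Sum>\<eta>\<in>signs J. \<Sum>\<eta>'\<in>signs J'. (\<theta> * x a * x b * s \<eta> * s' \<eta>') ^ n /\<^sub>R fact n)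
        = \<theta> ^ n / fact n * x a ^ n * x b ^ n * ((\<Sum>\<eta>\<in>signs J. s \<eta> ^ n) * (\<Sum>\<eta>'\<in>signs J'. s' \<eta>' ^ n))" for a b
      unfolding sum_product unfolding sum_distrib_left
      by (intro sum.cong refl) (simp add: power_mult_distrib field_simps)
    also have "((\<Sum>\<eta>\<in>signs J. s \<eta> ^ n) * (\<Sum>\<eta>'\<in>signs J'. s' \<eta>' ^ n))
       = 2 ^ card J * 2 ^ card J' * (U n * U' n)"
      by (simp add: U_def U'_def sign_moment_def s_def s'_def)
    finally have inner: "(\<Sum>\<eta>\<in>signs J. \<Sum>\<eta>'\<in>signs J'. (\<theta> * x a * x b * s \<eta> * s' \<eta>') ^ n /\<^sub>R fact n)
       = \<theta> ^ n / fact n * x a ^ n * x b ^ n * (2 ^ card J * 2 ^ card J' * (U n * U' n))" for a b .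
    show ?thesis
      unfolding inner T_def D_def power2_eq_square[of "\<Sum>a\<in>S. d a * x a ^ n"] sum_product
      unfolding sum_distrib_left sum_distrib_right
      by (intro sum.cong refl) (simp add: algebra_simps)
  qed
  have Tsums: "(\<lambda>n. 2 ^ card J * 2 ^ card J' * T n) sums
      (\<Sum>a\<in>S. \<Sum>b\<in>S. d a * d b * (\<Sum>\<eta>\<in>signs J. \<Sum>\<eta>'\<in>signs J'. exp (\<theta> * x a * x b * s \<eta> * s' \<eta>')))"
    using expsums unfolding eqT .
  have T0: "T n = 0" if "n < 2 * L" for n
  proof (cases "even n")
    case True
    then obtain l where "n = 2 * l" by blast
    hence "D n = 0" using mom[of l] that by (simp add: D_def)
    thus ?thesis by (simp add: T_def)
  next
    case False
    thus ?thesis by (simp add: T_def U_def sign_moment_odd)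
  qed
  have Tle: "T n \<le> 16 * (1 / 10) ^ n" if n: "2 * L \<le> n" for n
  proof -
    have n0: "0 < n" using n L by simp
    have "\<bar>D n\<bar> \<le> (\<Sum>a\<in>S. \<bar>d a * x a ^ n\<bar>)" unfolding D_def by (rule sum_abs)
    also have "\<dots> \<le> (\<Sum>a\<in>S. \<bar>d a\<bar>)"
      by (intro sum_mono) (use x in \<open>auto simp: abs_mult power_abs intro!: mult_left_le power_le_one\<close>)
    finally have "\<bar>D n\<bar> \<le> 2" using d by simp
    hence D4: "(D n)\<^sup>2 \<le> 4" using power_mono[of "\<bar>D n\<bar>" 2 2] by simp
    have UU: "\<bar>U n * U' n\<bar> \<le> (2 * fact n * sqrt (exp 1 / (real n * card J)) ^ n) * (2 * fact n * sqrt (exp 1 / (real n * card J')) ^ n)"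
      unfolding abs_mult U_def U'_def
      by (intro mult_mono sign_moment_le J J' e e' n0) auto
    also have "\<dots> = 4 * (fact n)\<^sup>2 * (sqrt (exp 1 / (real n * card J)) * sqrt (exp 1 / (real n * card J'))) ^ n"
      by (simp add: power2_eq_square power_mult_distrib)
    also have "sqrt (exp 1 / (real n * card J)) * sqrt (exp 1 / (real n * card J')) = exp 1 / (real n * sqrt (m * m'))"
    proof -
      have "sqrt (exp 1 / (real n * card J)) * sqrt (exp 1 / (real n * card J'))
         = sqrt ((exp 1 / real n)\<^sup>2 * (1 / (m * m')))"
        by (simp add: real_sqrt_mult[symmetric] m_def m'_def power2_eq_square)
      also have "\<dots> = exp 1 / real n * (1 / sqrt (m * m'))"
        by (simp only: real_sqrt_mult real_sqrt_divide real_sqrt_abs) simp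
      finally show ?thesis by simp
    qed
    finally have UU: "U n * U' n \<le> 4 * (fact n)\<^sup>2 * (exp 1 / (real n * sqrt (m * m'))) ^ n" by linarith
    have "T n \<le> \<theta> ^ n / fact n * 4 * (4 * (fact n)\<^sup>2 * (exp 1 / (real n * sqrt (m * m'))) ^ n)"
    proof -
      have "\<theta> ^ n / fact n * (D n)\<^sup>2 * (U n * U' n)
          \<le> \<theta> ^ n / fact n * (D n)\<^sup>2 * (4 * (fact n)\<^sup>2 * (exp 1 / (real n * sqrt (m * m'))) ^ n)"
        by (intro mult_left_mono UU) (use lam in auto)
      also have "\<dots> \<le> \<theta> ^ n / fact n * 4 * (4 * (fact n)\<^sup>2 * (exp 1 / (real n * sqrt (m * m'))) ^ n)"
        by (intro mult_right_mono mult_left_mono D4) (use lam m in auto)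
      finally show ?thesis by (simp add: T_def)
    qed
    also have "\<dots> = 16 * (fact n / real n ^ n) * (exp 1 * \<theta> / sqrt (m * m')) ^ n"
      by (simp add: power_divide power_mult_distrib power2_eq_square)
    also have "\<dots> \<le> 16 * 1 * (1 / 10) ^ n"
    proof (intro mult_mono power_mono)
      show "fact n / real n ^ n \<le> 1" using fact_le_self_power[of n] n0 by simp
      show "exp 1 * \<theta> / sqrt (m * m') \<le> 1 / 10"
        using lam(2) m by (simp add: m_def m'_def field_simps)
    qed (use lam m in auto)
    finally show ?thesis by simp
  qed
  define V where "V = (\<lambda>n. if n < 2 * L then 0 else 16 * (1 / 10 :: real) ^ n)"
  have TV: "T n \<le> V n" for n using T0 Tle by (auto simp: V_def)
  have Vsums: "V sums (16 * (10 / 9) * (1 / 100) ^ L)"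
  proof -
    have "(\<lambda>n. 16 * (1 / 10 :: real) ^ (2 * L) * (1 / 10) ^ n) sums (16 * (1 / 10 :: real) ^ (2 * L) * (1 / (1 - 1 / 10)))"
      by (intro sums_mult geometric_sums) auto
    also have "(\<lambda>n. 16 * (1 / 10 :: real) ^ (2 * L) * (1 / 10) ^ n) = (\<lambda>n. V (n + 2 * L))"
      by (auto simp: V_def power_add)
    finally have "V sums (16 * (1 / 10 :: real) ^ (2 * L) * (1 / (1 - 1 / 10)) + sum V {..<2 * L})"
      by (simp add: sums_iff_shift)
    moreover have "sum V {..<2 * L} = 0" by (simp add: V_def)
    moreover have "(1 / 10 :: real) ^ (2 * L) = (1 / 100) ^ L"
      by (simp only: power_mult) (simp add: power2_eq_square)
    ultimately show ?thesis by (simp add: algebra_simps)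
  qed
  have "(\<Sum>a\<in>S. \<Sum>b\<in>S. d a * d b * (\<Sum>\<eta>\<in>signs J. \<Sum>\<eta>'\<in>signs J'. exp (\<theta> * x a * x b * s \<eta> * s' \<eta>')))
     \<le> 2 ^ card J * 2 ^ card J' * (16 * (10 / 9) * (1 / 100) ^ L)"
    by (rule sums_le[OF _ Tsums sums_mult[OF Vsums]]) (auto intro!: mult_left_mono TV)
  also have "\<dots> \<le> 2 ^ card J * 2 ^ card J' * (18 * (1 / 100) ^ L)"
    by (intro mult_left_mono mult_right_mono) auto
  finally show ?thesis by (simp add: s_def s'_def)
qed

definition sign_dir :: "nat set \<Rightarrow> (nat \<Rightarrow> real) \<Rightarrow> nat \<Rightarrow> real" where
  "sign_dir J \<epsilon> = (\<lambda>k. if k \<in> J then \<epsilon> k / sqrt (card J) else 0)"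

abbreviation (input) sign_comb :: "nat \<Rightarrow> nat set \<Rightarrow> (nat \<Rightarrow> real) \<Rightarrow> (nat \<Rightarrow> nat \<Rightarrow> real) \<Rightarrow> nat \<Rightarrow> real" where
  "sign_comb n J \<epsilon> u i \<equiv> \<Sum>k<n. sign_dir J \<epsilon> k * u k i"

lemma sign_dir_inner:
  assumes "J \<subseteq> {..<n}"
  shows "(\<Sum>k<n. sign_dir J \<epsilon> k * sign_dir J \<eta> k) = sign_corr J \<epsilon> \<eta>"
proof -
  have "(\<Sum>k<n. sign_dir J \<epsilon> k * sign_dir J \<eta> k) = (\<Sum>k\<in>J. sign_dir J \<epsilon> k * sign_dir J \<eta> k)"
    using assms by (intro sum.mono_neutral_right) (auto simp: sign_dir_def)
  also have "\<dots> = (\<Sum>k\<in>J. \<epsilon> k * \<eta> k / card J)" by (intro sum.cong) (auto simp: sign_dir_def)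
  finally show ?thesis by (simp add: sum_divide_distrib)
qed

lemma sign_dir_unit:
  assumes J: "J \<subseteq> {..<n}" "J \<noteq> {}" and e: "\<epsilon> \<in> signs J"
  shows "(\<Sum>k<n. (sign_dir J \<epsilon> k)\<^sup>2) = 1"
proof -
  have "finite J" using J finite_subset by blast
  have "(\<Sum>k<n. (sign_dir J \<epsilon> k)\<^sup>2) = sign_corr J \<epsilon> \<epsilon>"
    unfolding power2_eq_square by (rule sign_dir_inner[OF J(1)])
  also have "(\<Sum>k\<in>J. \<epsilon> k * \<epsilon> k) = (\<Sum>k\<in>J. 1)"
    using e by (intro sum.cong) (auto simp: signs_def PiE_iff)
  finally show ?thesis using J \<open>finite J\<close> by simp
qed

definition gauss_mean :: "'i set \<Rightarrow> (('i \<Rightarrow> real) \<Rightarrow> real) \<Rightarrow> ('i \<Rightarrow> real) \<Rightarrow> real" where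
  "gauss_mean I \<psi> B = (\<integral>x. \<psi> (gauss_shift I B x) \<partial>gauss I)"

lemma sum_prod_pairs:
  fixes f g :: "nat \<Rightarrow> real"
  shows "(\<Sum>ij\<in>A \<times> B. f (fst ij) * g (snd ij)) = sum f A * sum g B"
  by (simp add: sum_product sum.cartesian_product case_prod_unfold)

text \<open>One spike with random directions on both sides: the two priors for its size lead to nearly the
  same mean of \<open>\<psi>\<close>, whatever fixed signal \<open>B0\<close> is added. The scalar product of two spikes is the product of
  their sizes and of two normalised sign sums, so the mixture bound reduces to the chi-square estimate.
  The constant comes from \<open>18 \<le> (17/4)\<^sup>2\<close>.\<close>
lemma hidden_spike:
  fixes x d :: "'a \<Rightarrow> real" and u v :: "nat \<Rightarrow> nat \<Rightarrow> real"
  assumes S: "finite S" and x: "\<And>a. a \<in> S \<Longrightarrow> \<bar>x a\<bar> \<le> 1" and d: "(\<Sum>a\<in>S. \<bar>d a\<bar>) \<le> 2"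
    and mom: "\<And>l. l < L \<Longrightarrow> (\<Sum>a\<in>S. d a * x a ^ (2 * l)) = 0" and L: "0 < L"
    and J: "J \<subseteq> {..<p}" "J \<noteq> {}" and J': "J' \<subseteq> {..<q}" "J' \<noteq> {}"
    and M: "10 * exp 1 * M\<^sup>2 \<le> sqrt (real (card J) * real (card J'))"
    and u: "frame p u" and v: "frame q v"
    and \<psi>: "\<psi> \<in> borel_measurable (\<Pi>\<^sub>M i\<in>{..<p} \<times> {..<q}. borel)" "\<And>y. \<bar>\<psi> y\<bar> \<le> 1"
  shows "\<bar>\<Sum>\<epsilon>\<in>signs J. \<Sum>\<epsilon>'\<in>signs J'. \<Sum>a\<in>S. d a * gauss_mean ({..<p} \<times> {..<q}) \<psi>
        (\<lambda>ij. B0 ij + M * x a * sign_comb p J \<epsilon> u (fst ij) * sign_comb q J' \<epsilon>' v (snd ij))\<bar>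
     \<le> 2 ^ card J * 2 ^ card J' * (17 / 4 * (1 / 10) ^ L)"
proof -
  have fJ: "finite J" "finite J'" using J J' finite_subset by blast+
  define I where "I = {..<p} \<times> {..<q}"
  define C where "C = (2 :: real) ^ card J * 2 ^ card J'"
  have C: "0 < C" by (simp add: C_def)
  define K where "K = signs J \<times> signs J' \<times> S"
  have K: "finite K" unfolding K_def using S fJ finite_signs by blast
  define B where "B = (\<lambda>(\<epsilon>, \<epsilon>', a) ij. M * x a * sign_comb p J \<epsilon> u (fst ij) * sign_comb q J' \<epsilon>' v (snd ij))"
  define w where "w = (\<lambda>k :: (nat \<Rightarrow> real) \<times> (nat \<Rightarrow> real) \<times> 'a. d (snd (snd k)))"
  define F where "F = (\<lambda>\<epsilon> \<epsilon>' \<eta> \<eta>' a b. d a * d b * exp (M\<^sup>2 * x a * x b * sign_corr J \<epsilon> \<eta> * sign_corr J' \<epsilon>' \<eta>'))"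
  have inner: "(\<Sum>i\<in>I. B (\<epsilon>, \<epsilon>', a) i * B (\<eta>, \<eta>', b) i)
      = M\<^sup>2 * x a * x b * sign_corr J \<epsilon> \<eta> * sign_corr J' \<epsilon>' \<eta>'" for \<epsilon> \<epsilon>' \<eta> \<eta>' a b
  proof -
    have "(\<Sum>i\<in>I. B (\<epsilon>, \<epsilon>', a) i * B (\<eta>, \<eta>', b) i) = (\<Sum>ij\<in>{..<p} \<times> {..<q}.
       (M\<^sup>2 * x a * x b * (sign_comb p J \<epsilon> u (fst ij) * sign_comb p J \<eta> u (fst ij)))
        * (sign_comb q J' \<epsilon>' v (snd ij) * sign_comb q J' \<eta>' v (snd ij)))"
      unfolding I_def by (intro sum.cong refl) (simp add: B_def power2_eq_square mult_ac)
    also have "\<dots> = (\<Sum>i<p. M\<^sup>2 * x a * x b * (sign_comb p J \<epsilon> u i * sign_comb p J \<eta> u i))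
        * (\<Sum>i<q. sign_comb q J' \<epsilon>' v i * sign_comb q J' \<eta>' v i)"
      by (rule sum_prod_pairs)
    also have "\<dots> = M\<^sup>2 * x a * x b * sign_corr J \<epsilon> \<eta> * sign_corr J' \<epsilon>' \<eta>'"
      unfolding sum_distrib_left[symmetric] frame_inner_product[OF u] frame_inner_product[OF v]
        sign_dir_inner[OF J(1)] sign_dir_inner[OF J'(1)] ..
    finally show ?thesis .
  qed
  have tripl: "(\<Sum>k\<in>K. G k) = (\<Sum>\<epsilon>\<in>signs J. \<Sum>\<epsilon>'\<in>signs J'. \<Sum>a\<in>S. G (\<epsilon>, \<epsilon>', a))"
    for G :: "(nat \<Rightarrow> real) \<times> (nat \<Rightarrow> real) \<times> 'a \<Rightarrow> real"
    unfolding K_def by (simp add: sum.cartesian_product case_prod_unfold)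
  have sw: "(\<Sum>a\<in>S. \<Sum>\<eta>\<in>signs J. \<Sum>\<eta>'\<in>signs J'. \<Sum>b\<in>S. F \<epsilon> \<epsilon>' \<eta> \<eta>' a b)
     = (\<Sum>a\<in>S. \<Sum>b\<in>S. \<Sum>\<eta>\<in>signs J. \<Sum>\<eta>'\<in>signs J'. F \<epsilon> \<epsilon>' \<eta> \<eta>' a b)" for \<epsilon> \<epsilon>'
  proof (intro sum.cong refl)
    fix a
    have "(\<Sum>\<eta>\<in>signs J. \<Sum>\<eta>'\<in>signs J'. \<Sum>b\<in>S. F \<epsilon> \<epsilon>' \<eta> \<eta>' a b)
       = (\<Sum>\<eta>\<in>signs J. \<Sum>b\<in>S. \<Sum>\<eta>'\<in>signs J'. F \<epsilon> \<epsilon>' \<eta> \<eta>' a b)"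
      by (intro sum.cong refl sum.swap)
    also have "\<dots> = (\<Sum>b\<in>S. \<Sum>\<eta>\<in>signs J. \<Sum>\<eta>'\<in>signs J'. F \<epsilon> \<epsilon>' \<eta> \<eta>' a b)" by (rule sum.swap)
    finally show "(\<Sum>\<eta>\<in>signs J. \<Sum>\<eta>'\<in>signs J'. \<Sum>b\<in>S. F \<epsilon> \<epsilon>' \<eta> \<eta>' a b)
       = (\<Sum>b\<in>S. \<Sum>\<eta>\<in>signs J. \<Sum>\<eta>'\<in>signs J'. F \<epsilon> \<epsilon>' \<eta> \<eta>' a b)" .
  qed
  have "(\<Sum>k\<in>K. w k * gauss_mean I \<psi> (\<lambda>i. B0 i + B k i))\<^sup>2
      \<le> (\<Sum>k\<in>K. \<Sum>l\<in>K. w k * w l * exp (\<Sum>i\<in>I. B k i * B l i))"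
    unfolding gauss_mean_def
    by (intro gauss_mixture_bound K \<psi>(2) \<psi>(1)[folded I_def]) (simp add: I_def)
  also have "\<dots> = (\<Sum>\<epsilon>\<in>signs J. \<Sum>\<epsilon>'\<in>signs J'. \<Sum>a\<in>S. \<Sum>\<eta>\<in>signs J. \<Sum>\<eta>'\<in>signs J'. \<Sum>b\<in>S. F \<epsilon> \<epsilon>' \<eta> \<eta>' a b)"
    unfolding tripl inner by (simp only: w_def F_def snd_conv)
  also have "\<dots> = (\<Sum>\<epsilon>\<in>signs J. \<Sum>\<epsilon>'\<in>signs J'. \<Sum>a\<in>S. \<Sum>b\<in>S. \<Sum>\<eta>\<in>signs J. \<Sum>\<eta>'\<in>signs J'. F \<epsilon> \<epsilon>' \<eta> \<eta>' a b)"
    unfolding sw ..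
  also have "\<dots> \<le> (\<Sum>\<epsilon>\<in>signs J. \<Sum>\<epsilon>'\<in>signs J'. C * (18 * (1 / 100) ^ L))"
  proof (intro sum_mono)
    fix \<epsilon> \<epsilon>' assume "\<epsilon> \<in> signs J" "\<epsilon>' \<in> signs J'"
    note chi = spiked_chi_square_le[OF S x d mom L fJ(1) J(2) fJ(2) J'(2) this zero_le_power2 M]
    have eqF: "d a * d b * (\<Sum>\<eta>\<in>signs J. \<Sum>\<eta>'\<in>signs J'. exp (M\<^sup>2 * x a * x b * sign_corr J \<epsilon> \<eta> * sign_corr J' \<epsilon>' \<eta>'))
       = (\<Sum>\<eta>\<in>signs J. \<Sum>\<eta>'\<in>signs J'. F \<epsilon> \<epsilon>' \<eta> \<eta>' a b)" for a b
      unfolding F_def by (simp only: sum_distrib_left)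
    show "(\<Sum>a\<in>S. \<Sum>b\<in>S. \<Sum>\<eta>\<in>signs J. \<Sum>\<eta>'\<in>signs J'. F \<epsilon> \<epsilon>' \<eta> \<eta>' a b) \<le> C * (18 * (1 / 100) ^ L)"
      using chi unfolding eqF C_def .
  qed
  also have "\<dots> = (real (card (signs J)) * real (card (signs J'))) * (C * (18 * (1 / 100) ^ L))"
    by (simp only: sum_constant mult.assoc)
  also have "real (card (signs J)) * real (card (signs J')) = C"
    using fJ by (simp add: card_signs C_def)
  also have "C * (C * (18 * (1 / 100) ^ L)) \<le> C * (C * ((289 / 16) * (1 / 100) ^ L))"
    using C by (intro mult_left_mono mult_right_mono) simp_all
  also have "\<dots> = (C * (17 / 4 * (1 / 10) ^ L))\<^sup>2"
  proof -
    have "(1 / 100 :: real) ^ L = (1 / 10 * (1 / 10)) ^ L" by simp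
    also have "\<dots> = (1 / 10) ^ L * (1 / 10) ^ L" by (rule power_mult_distrib)
    finally have e: "(1 / 100 :: real) ^ L = (1 / 10) ^ L * (1 / 10) ^ L" .
    have "c * (c * (289 / 16 * (y * y))) = (c * (17 / 4 * y)) * (c * (17 / 4 * y))" for c y :: real
      by (simp add: algebra_simps)
    thus ?thesis unfolding e power2_eq_square by blast
  qed
  finally have sq: "(\<Sum>k\<in>K. w k * gauss_mean I \<psi> (\<lambda>i. B0 i + B k i))\<^sup>2 \<le> (C * (17 / 4 * (1 / 10) ^ L))\<^sup>2" .
  have "0 \<le> C * (17 / 4 * (1 / 10) ^ L)" using C by simp
  with sq have "\<bar>\<Sum>k\<in>K. w k * gauss_mean I \<psi> (\<lambda>i. B0 i + B k i)\<bar> \<le> C * (17 / 4 * (1 / 10) ^ L)"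
    using abs_le_square_iff[THEN iffD2, OF sq] by (simp only: abs_of_nonneg)
  thus ?thesis unfolding tripl I_def C_def by (simp only: w_def B_def snd_conv prod.case)
qed

section \<open>Spectra of spiked matrices\<close>

definition spikes :: "nat \<Rightarrow> (nat \<Rightarrow> real) \<Rightarrow> (nat \<Rightarrow> nat \<Rightarrow> real) \<Rightarrow> (nat \<Rightarrow> nat \<Rightarrow> real) \<Rightarrow> nat \<times> nat \<Rightarrow> real" where
  "spikes r \<sigma> u v = (\<lambda>ij. \<Sum>k<r. \<sigma> k * u k (fst ij) * v k (snd ij))"

text \<open>The Gram matrix is diagonal in the orthonormal basis \<open>v\<close>.\<close>
lemma char_poly_gram_spikes:
  fixes \<sigma> :: "nat \<Rightarrow> real"
  assumes u: "frame p u" and v: "frame q v" and r: "r \<le> p" "r \<le> q"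
  defines "A \<equiv> Matrix.mat p q (spikes r \<sigma> u v)"
  shows "char_poly (transpose_mat A * A) = (\<Prod>k<q. [:- (if k < r then (\<sigma> k)\<^sup>2 else 0), 1:])"
proof -
  define D where "D = (\<lambda>k. if k < r then (\<sigma> k)\<^sup>2 else 0)"
  define V where "V = Matrix.mat q q (\<lambda>(i, k). v k i)"
  define Dm where "Dm = Matrix.mat q q (\<lambda>(i, k). if i = k then D k else 0)"
  have [simp]: "V \<in> carrier_mat q q" "Dm \<in> carrier_mat q q" "A \<in> carrier_mat p q"
    by (auto simp: V_def Dm_def A_def)
  have VV: "transpose_mat V * V = 1\<^sub>m q"
  proof (rule eq_matI)
    fix k l assume "k < dim_row (1\<^sub>m q :: real mat)" "l < dim_col (1\<^sub>m q :: real mat)"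
    thus "(transpose_mat V * V) $$ (k, l) = 1\<^sub>m q $$ (k, l)"
      using v by (auto simp: V_def scalar_prod_def frame_def atLeast0LessThan)
  qed (auto simp: V_def)
  hence VV': "V * transpose_mat V = 1\<^sub>m q"
    by (intro mat_mult_left_right_inverse[of "transpose_mat V" q V]) auto
  have "transpose_mat A * A = V * Dm * transpose_mat V"
  proof (rule eq_matI)
    fix j j' assume "j < dim_row (V * Dm * transpose_mat V)" "j' < dim_col (V * Dm * transpose_mat V)"
    hence jj: "j < q" "j' < q" by (auto simp: V_def)
    define x where "x = (\<lambda>j k. if k < r then \<sigma> k * v k j else 0)"
    have sp: "spikes r \<sigma> u v (i, j) = (\<Sum>k<p. x j k * u k i)" for i j
    proof -
      have "(\<Sum>k<p. x j k * u k i) = (\<Sum>k<r. x j k * u k i)"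
        using r by (intro sum.mono_neutral_right) (auto simp: x_def)
      thus ?thesis by (simp add: spikes_def x_def mult_ac)
    qed
    have "(transpose_mat A * A) $$ (j, j') = (\<Sum>i<p. spikes r \<sigma> u v (i, j) * spikes r \<sigma> u v (i, j'))"
      using jj by (simp add: A_def scalar_prod_def atLeast0LessThan)
    also have "\<dots> = (\<Sum>k<p. x j k * x j' k)" unfolding sp by (rule frame_inner_product[OF u])
    also have "\<dots> = (\<Sum>k<r. x j k * x j' k)"
      using r by (intro sum.mono_neutral_right) (auto simp: x_def)
    also have "\<dots> = (\<Sum>k<q. v k j * D k * v k j')"
      using r by (intro sum.mono_neutral_cong_left) (auto simp: x_def D_def power2_eq_square)
    also have "\<dots> = (V * Dm * transpose_mat V) $$ (j, j')"
    proof -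
      have "(V * Dm) $$ (j, k) = v k j * D k" if "k < q" for k
      proof -
        have "(V * Dm) $$ (j, k) = (\<Sum>l<q. v l j * (if l = k then D k else 0))"
          using jj that by (simp add: V_def Dm_def scalar_prod_def atLeast0LessThan)
        also have "\<dots> = (\<Sum>l<q. if l = k then v k j * D k else 0)" by (intro sum.cong) auto
        finally show ?thesis using that by simp
      qed
      moreover have "dim_row (V * Dm) = q" "dim_col (V * Dm) = q" by (auto simp: V_def Dm_def)
      ultimately show ?thesis
        using jj by (simp add: scalar_prod_def atLeast0LessThan V_def)
    qed
    finally show "(transpose_mat A * A) $$ (j, j') = (V * Dm * transpose_mat V) $$ (j, j')" .
  qed (auto simp: A_def V_def)
  moreover have c: "V * Dm * transpose_mat V \<in> carrier_mat q q"
    by (rule mult_carrier_mat[where n = q], rule mult_carrier_mat[where n = q]) auto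
  ultimately have "transpose_mat A * A = V * Dm * transpose_mat V" by blast
  moreover have "similar_mat (V * Dm * transpose_mat V) Dm"
    by (rule similar_matI[of _ _ V "transpose_mat V" q])
      (use VV VV' c in auto)
  ultimately have "char_poly (transpose_mat A * A) = char_poly Dm" using char_poly_similar by metis
  also have "\<dots> = (\<Prod>a\<leftarrow>diag_mat Dm. [:- a, 1:])"
    by (rule char_poly_upper_triangular[where n = q]) (auto simp: Dm_def)
  also have "diag_mat Dm = map D [0..<q]"
    by (auto simp: diag_mat_def Dm_def intro!: map_cong)
  also have "(\<Prod>a\<leftarrow>map D [0..<q]. [:- a, 1:]) = (\<Prod>k<q. [:- D k, 1:])"
    using prod.distinct_set_conv_list[of "[0..<q]" "\<lambda>k. [:- D k, 1:]"]
    by (simp only: map_map comp_def distinct_upt atLeast0LessThan set_upt simp_thms)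
  finally show ?thesis by (simp add: D_def)
qed

lemma singular_values_spikes:
  assumes "frame p u" "frame q v" "r \<le> p" "r \<le> q"
  shows "mset (singular_values (Matrix.mat p q (spikes r \<sigma> u v)))
    = image_mset (\<lambda>k. if k < r then \<bar>\<sigma> k\<bar> else 0) (mset_set {..<q})"
proof -
  have "proots (\<Prod>k<q. [:- (if k < r then (\<sigma> k)\<^sup>2 else 0), 1:])
      = (\<Sum>k<q. proots [:- (if k < r then (\<sigma> k)\<^sup>2 else 0), 1:])"
    by (rule proots_prod) auto
  also have "\<dots> = (\<Sum>k<q. {#if k < r then (\<sigma> k)\<^sup>2 else 0#})"
    by (intro sum.cong refl) (simp only: proots_linear_factor minus_minus)
  also have "\<dots> = image_mset (\<lambda>k. if k < r then (\<sigma> k)\<^sup>2 else 0) (mset_set {..<q})"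
  proof -
    have "(\<Sum>k\<in>B. {#f k#}) = image_mset f (mset_set B)" if "finite B" for f :: "nat \<Rightarrow> real" and B
      using that by (induction B rule: finite_induct) auto
    from this[OF finite_lessThan] show ?thesis .
  qed
  finally have "mset (singular_values (Matrix.mat p q (spikes r \<sigma> u v)))
      = image_mset sqrt (image_mset (\<lambda>k. if k < r then (\<sigma> k)\<^sup>2 else 0) (mset_set {..<q}))"
    unfolding singular_values_def char_poly_gram_spikes[OF assms] by (simp only: mset_rev mset_sorted_list_of_multiset)
  also have "\<dots> = image_mset (\<lambda>k. if k < r then \<bar>\<sigma> k\<bar> else 0) (mset_set {..<q})"
    unfolding multiset.map_comp by (intro image_mset_cong) simp
  finally show ?thesis .
qed

lemma schatten_power_spikes:
  assumes "frame p u" "frame q v" "r \<le> p" "r \<le> q"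
  shows "schatten_power s (Matrix.mat p q (spikes r \<sigma> u v)) = (\<Sum>k<r. \<bar>\<sigma> k\<bar> powr s)"
proof -
  let ?A = "Matrix.mat p q (spikes r \<sigma> u v)"
  have "schatten_power s ?A = (\<Sum>\<sigma>\<in>#mset (singular_values ?A). \<sigma> powr s)"
    unfolding schatten_power_def by (simp only: sum_mset_sum_list[symmetric] mset_map)
  also have "\<dots> = (\<Sum>k<q. (if k < r then \<bar>\<sigma> k\<bar> else 0) powr s)"
    unfolding singular_values_spikes[OF assms] multiset.map_comp comp_def sum_unfold_sum_mset ..
  also have "\<dots> = (\<Sum>k<r. \<bar>\<sigma> k\<bar> powr s)"
    using assms by (intro sum.mono_neutral_cong_right) auto
  finally show ?thesis .
qed

lemma spectral_norm_spikes_le: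
  assumes "frame p u" "frame q v" "r \<le> p" "r \<le> q" "0 < q"
    and "0 \<le> M" "\<And>k. k < r \<Longrightarrow> \<bar>\<sigma> k\<bar> \<le> M"
  shows "spectral_norm (Matrix.mat p q (spikes r \<sigma> u v)) \<le> M"
proof -
  let ?A = "Matrix.mat p q (spikes r \<sigma> u v)"
  note ms = singular_values_spikes[OF assms(1-4), of \<sigma>]
  have "length (singular_values ?A) = q" using arg_cong[OF ms, of size] by simp
  hence "spectral_norm ?A \<in> set (singular_values ?A)"
    using assms by (auto simp: spectral_norm_def)
  also have "set (singular_values ?A) = (\<lambda>k. if k < r then \<bar>\<sigma> k\<bar> else 0) ` {..<q}"
    using arg_cong[OF ms, of set_mset] by simp
  finally show ?thesis using assms by (auto split: if_splits)
qed

section \<open>Exchanging the priors one singular value at a time\<close>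

lemma sum_PiE_insert:
  fixes f :: "('i \<Rightarrow> 'a) \<Rightarrow> real"
  assumes "k \<notin> A"
  shows "(\<Sum>a\<in>insert k A \<rightarrow>\<^sub>E S. f a) = (\<Sum>a\<in>A \<rightarrow>\<^sub>E S. \<Sum>b\<in>S. f (a(k := b)))"
proof -
  have "(\<Sum>a\<in>insert k A \<rightarrow>\<^sub>E S. f a) = (\<Sum>(b, a)\<in>S \<times> (A \<rightarrow>\<^sub>E S). f (a(k := b)))"
    unfolding PiE_insert_eq using inj_combinator[OF assms, of "\<lambda>_. S"]
    by (subst sum.reindex) (auto simp: case_prod_unfold)
  also have "\<dots> = (\<Sum>b\<in>S. \<Sum>a\<in>A \<rightarrow>\<^sub>E S. f (a(k := b)))" by (simp add: sum.cartesian_product)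
  also have "\<dots> = (\<Sum>a\<in>A \<rightarrow>\<^sub>E S. \<Sum>b\<in>S. f (a(k := b)))" by (rule sum.swap)
  finally show ?thesis .
qed

lemma gauss_mean_dist:
  assumes I: "finite I" and \<psi>: "\<psi> \<in> borel_measurable (\<Pi>\<^sub>M i\<in>I. borel)" "\<And>y. \<bar>\<psi> y\<bar> \<le> 1"
  shows "(gauss_mean I \<psi> B - gauss_mean I \<psi> B')\<^sup>2 \<le> exp (\<Sum>i\<in>I. (B i - B' i)\<^sup>2) - 1"
proof -
  define C where "C = (\<lambda>k i. if k then B i - B' i else 0)"
  define w where "w = (\<lambda>k. if k then 1 else -1 :: real)"
  have "(\<Sum>k\<in>UNIV. w k * (\<integral>x. \<psi> (gauss_shift I (\<lambda>i. B' i + C k i) x) \<partial>gauss I))\<^sup>2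
      \<le> (\<Sum>k\<in>UNIV. \<Sum>l\<in>UNIV. w k * w l * exp (\<Sum>i\<in>I. C k i * C l i))"
    by (rule gauss_mixture_bound) (use assms in auto)
  thus ?thesis by (simp add: UNIV_bool w_def C_def gauss_mean_def power2_eq_square)
qed

lemma gauss_mean_nonneg: "(\<And>y. 0 \<le> \<psi> y) \<Longrightarrow> 0 \<le> gauss_mean I \<psi> B"
  unfolding gauss_mean_def by (intro integral_nonneg_AE) auto

text \<open>Labels are kept apart from the singular values \<open>x a\<close> that they stand for (up to the scale \<open>M\<close>), so
  that different labels may carry the same value. Only even moments are matched: the odd ones meet
  sign moments that vanish.\<close>
locale matched_priors =
  fixes S :: "'a set" and x \<nu>0 \<nu>1 :: "'a \<Rightarrow> real" and L :: nat
  assumes finite_S: "finite S"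
    and x_bounds: "a \<in> S \<Longrightarrow> 0 \<le> x a" "a \<in> S \<Longrightarrow> x a \<le> 1"
    and weight_nonneg: "a \<in> S \<Longrightarrow> 0 \<le> \<nu>0 a" "a \<in> S \<Longrightarrow> 0 \<le> \<nu>1 a"
    and weight_sum: "sum \<nu>0 S = 1" "sum \<nu>1 S = 1"
    and moments: "l < L \<Longrightarrow> (\<Sum>a\<in>S. (\<nu>1 a - \<nu>0 a) * x a ^ (2 * l)) = 0"
    and L_pos: "0 < L"
begin

abbreviation (input) labels :: "nat \<Rightarrow> (nat \<Rightarrow> 'a) set" where
  "labels r \<equiv> {..<r} \<rightarrow>\<^sub>E S"

definition prior :: "nat \<Rightarrow> nat \<Rightarrow> 'a \<Rightarrow> real" where
  "prior j i = (if i < j then \<nu>1 else \<nu>0)"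

definition hybrid_mean :: "nat \<Rightarrow> nat \<Rightarrow> nat \<Rightarrow> real \<Rightarrow> ((nat \<times> nat \<Rightarrow> real) \<Rightarrow> real) \<Rightarrow> nat
    \<Rightarrow> (nat \<Rightarrow> nat \<Rightarrow> real) \<Rightarrow> (nat \<Rightarrow> nat \<Rightarrow> real) \<Rightarrow> real" where
  "hybrid_mean p q r M \<psi> j u v = (\<Sum>a\<in>labels r. (\<Prod>i<r. prior j i (a i)) *
      gauss_mean ({..<p} \<times> {..<q}) \<psi> (spikes r (\<lambda>k. M * x (a k)) u v))"

lemma prior_nonneg: "b \<in> S \<Longrightarrow> 0 \<le> prior j i b"
  and prior_sum: "sum (prior j i) S = 1"
  by (auto simp: prior_def weight_nonneg weight_sum)

lemma prior_prod_nonneg: "a \<in> A \<rightarrow>\<^sub>E S \<Longrightarrow> 0 \<le> (\<Prod>i\<in>A. prior j i (a i))"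
  by (intro prod_nonneg) (auto simp: PiE_iff prior_nonneg)

lemma prior_prod_sum:
  assumes "finite A"
  shows "(\<Sum>a\<in>A \<rightarrow>\<^sub>E S. \<Prod>i\<in>A. prior j i (a i)) = 1"
  using prod_sum_PiE[of A "\<lambda>_. S" "prior j"] assms finite_S by (simp add: prior_sum)

text \<open>Only the law of the \<open>j\<close>-th label changes, so fixing the others leaves the signed weights \<open>\<nu>1 - \<nu>0\<close>.\<close>
lemma hybrid_mean_Suc:
  assumes j: "j < r"
  shows "hybrid_mean p q r M \<psi> (Suc j) u v - hybrid_mean p q r M \<psi> j u v
    = (\<Sum>a\<in>({..<r} - {j}) \<rightarrow>\<^sub>E S. (\<Prod>i\<in>{..<r} - {j}. prior j i (a i)) * (\<Sum>b\<in>S. (\<nu>1 b - \<nu>0 b) *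
        gauss_mean ({..<p} \<times> {..<q}) \<psi> (spikes r (\<lambda>k. M * x ((a(j := b)) k)) u v)))"
proof -
  define R where "R = {..<r} - {j}"
  have R: "{..<r} = insert j R" "j \<notin> R" "finite R" using j by (auto simp: R_def)
  define g where "g = (\<lambda>a. gauss_mean ({..<p} \<times> {..<q}) \<psi> (spikes r (\<lambda>k. M * x (a k)) u v))"
  define W where "W = (\<lambda>a. \<Prod>i\<in>R. prior j i (a i))"
  have W: "(\<Prod>i\<in>R. prior k i ((a(j := b)) i)) = W a" if "k = j \<or> k = Suc j" for k a b
    unfolding W_def
  proof (intro prod.cong refl)
    fix i assume "i \<in> R"
    hence "i \<noteq> j" using R(2) by blast
    thus "prior k i ((a(j := b)) i) = prior j i (a i)"
      using that by (elim disjE) (simp_all add: prior_def less_Suc_eq)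
  qed
  have p: "prior (Suc j) j = \<nu>1" "prior j j = \<nu>0" by (simp_all add: prior_def)
  have h: "hybrid_mean p q r M \<psi> k u v = (\<Sum>a\<in>R \<rightarrow>\<^sub>E S. W a * (\<Sum>b\<in>S. prior k j b * g (a(j := b))))"
    if k: "k = j \<or> k = Suc j" for k
  proof -
    have "hybrid_mean p q r M \<psi> k u v = (\<Sum>a\<in>labels r. (\<Prod>i<r. prior k i (a i)) * g a)"
      by (simp add: hybrid_mean_def g_def)
    also have "\<dots> = (\<Sum>a\<in>R \<rightarrow>\<^sub>E S. \<Sum>b\<in>S. (\<Prod>i\<in>insert j R. prior k i ((a(j := b)) i)) * g (a(j := b)))"
      unfolding R(1) by (rule sum_PiE_insert[OF R(2)])
    also have "\<dots> = (\<Sum>a\<in>R \<rightarrow>\<^sub>E S. W a * (\<Sum>b\<in>S. prior k j b * g (a(j := b))))"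
      unfolding prod.insert[OF R(3,2)] W[OF k] sum_distrib_left
      by (simp only: fun_upd_same mult.assoc mult.left_commute)
    finally show ?thesis .
  qed
  have "hybrid_mean p q r M \<psi> (Suc j) u v - hybrid_mean p q r M \<psi> j u v
      = (\<Sum>a\<in>R \<rightarrow>\<^sub>E S. W a * (\<Sum>b\<in>S. (\<nu>1 b - \<nu>0 b) * g (a(j := b))))"
    unfolding h[OF disjI1[OF refl]] h[OF disjI2[OF refl]] p
    by (simp only: left_diff_distrib right_diff_distrib sum_subtractf)
  thus ?thesis unfolding R_def W_def g_def .
qed

text \<open>Steering moves the \<open>j\<close>-th vector of each frame to a random sign combination of itself and of the
  vectors with index at least \<open>r\<close>, which carry no spike; the other spikes stay where they are. So, given the
  other labels, the difference of consecutive hybrids is the effect of one hidden spike.\<close>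
lemma hybrid_mean_steer_average:
  assumes j: "j < r" and r: "r \<le> p" "r \<le> q"
    and M: "10 * exp 1 * M\<^sup>2 \<le> sqrt (real (Suc (p - r)) * real (Suc (q - r)))"
    and u: "frame p u" and v: "frame q v"
    and \<psi>: "\<psi> \<in> borel_measurable (\<Pi>\<^sub>M i\<in>{..<p} \<times> {..<q}. borel)" "\<And>y. \<bar>\<psi> y\<bar> \<le> 1"
  defines "J \<equiv> insert j {r..<p}" and "J' \<equiv> insert j {r..<q}"
  defines "H \<equiv> \<lambda>k \<epsilon> \<epsilon>'. hybrid_mean p q r M \<psi> k (steer p j (sign_dir J \<epsilon>) u) (steer q j (sign_dir J' \<epsilon>') v)"
  shows "(\<Sum>\<epsilon>\<in>signs J. \<Sum>\<epsilon>'\<in>signs J'. H (Suc j) \<epsilon> \<epsilon>' - H j \<epsilon> \<epsilon>')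
    \<le> real (card (signs J \<times> signs J')) * (17 / 4 * (1 / 10) ^ L)"
proof -
  define I where "I = {..<p} \<times> {..<q}"
  define d where "d = (\<lambda>b. \<nu>1 b - \<nu>0 b)"
  have sub: "insert j {r..<n} \<subseteq> {..<n}" if "r \<le> n" for n
  proof
    fix k assume "k \<in> insert j {r..<n}"
    thus "k \<in> {..<n}" using j that by (elim insertE) simp_all
  qed
  have J: "J \<subseteq> {..<p}" "J' \<subseteq> {..<q}" "J \<noteq> {}" "J' \<noteq> {}" "finite J" "finite J'"
    unfolding J_def J'_def by (rule sub[OF r(1)], rule sub[OF r(2)], simp_all)
  have "j \<notin> {r..<n}" for n using j by simp
  hence card: "card J = Suc (p - r)" "card J' = Suc (q - r)"
    unfolding J_def J'_def by simp_all
  define R where "R = {..<r} - {j}"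
  have dsum: "(\<Sum>b\<in>S. \<bar>d b\<bar>) \<le> 2"
  proof -
    have "(\<Sum>b\<in>S. \<bar>d b\<bar>) \<le> (\<Sum>b\<in>S. \<nu>1 b + \<nu>0 b)"
    proof (rule sum_mono)
      fix b assume "b \<in> S"
      from weight_nonneg[OF this] show "\<bar>d b\<bar> \<le> \<nu>1 b + \<nu>0 b" unfolding d_def by linarith
    qed
    thus ?thesis by (simp add: sum.distrib weight_sum)
  qed
  have xb: "\<bar>x a\<bar> \<le> 1" if "a \<in> S" for a using x_bounds[OF that] by simp
  have mom: "(\<Sum>b\<in>S. d b * x b ^ (2 * l)) = 0" if "l < L" for l
    unfolding d_def by (rule moments[OF that])
  have Mc: "10 * exp 1 * M\<^sup>2 \<le> sqrt (real (card J) * real (card J'))" unfolding card by (rule M)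
  define B0 where "B0 = (\<lambda>a ij. \<Sum>k\<in>R. M * x (a k) * u k (fst ij) * v k (snd ij))"
  define G where "G = (\<lambda>a \<epsilon> \<epsilon>' b. gauss_mean I \<psi> (\<lambda>ij. B0 a ij + M * x b
      * sign_comb p J \<epsilon> u (fst ij) * sign_comb q J' \<epsilon>' v (snd ij)))"
  have sp: "spikes r (\<lambda>k. M * x ((a(j := b)) k)) (steer p j (sign_dir J \<epsilon>) u) (steer q j (sign_dir J' \<epsilon>') v)
     = (\<lambda>ij. B0 a ij + M * x b * sign_comb p J \<epsilon> u (fst ij) * sign_comb q J' \<epsilon>' v (snd ij))"
    if e: "\<epsilon> \<in> signs J" "\<epsilon>' \<in> signs J'" for a b \<epsilon> \<epsilon>'
  proof
    fix ij
    have fixed: "steer p j (sign_dir J \<epsilon>) u k = u k" "steer q j (sign_dir J' \<epsilon>') v k = v k" if "k \<in> R" for k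
      using that by (auto intro!: steer_fixes simp: R_def sign_dir_def J_def J'_def)
    have "{..<r} = insert j R" "j \<notin> R" "finite R" using j by (auto simp: R_def)
    hence "spikes r (\<lambda>k. M * x ((a(j := b)) k)) (steer p j (sign_dir J \<epsilon>) u) (steer q j (sign_dir J' \<epsilon>') v) ij
       = M * x b * steer p j (sign_dir J \<epsilon>) u j (fst ij) * steer q j (sign_dir J' \<epsilon>') v j (snd ij)
         + (\<Sum>k\<in>R. M * x ((a(j := b)) k) * steer p j (sign_dir J \<epsilon>) u k (fst ij) * steer q j (sign_dir J' \<epsilon>') v k (snd ij))"
      unfolding spikes_def by simp
    also have "(\<Sum>k\<in>R. M * x ((a(j := b)) k) * steer p j (sign_dir J \<epsilon>) u k (fst ij) * steer q j (sign_dir J' \<epsilon>') v k (snd ij))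
       = B0 a ij"
      unfolding B0_def by (intro sum.cong refl) (auto simp: fixed R_def)
    also have "steer p j (sign_dir J \<epsilon>) u j (fst ij) = sign_comb p J \<epsilon> u (fst ij)"
      using j r J e by (intro steer_moves sign_dir_unit) auto
    also have "steer q j (sign_dir J' \<epsilon>') v j (snd ij) = sign_comb q J' \<epsilon>' v (snd ij)"
      using j r J e by (intro steer_moves sign_dir_unit) auto
    finally show "spikes r (\<lambda>k. M * x ((a(j := b)) k)) (steer p j (sign_dir J \<epsilon>) u) (steer q j (sign_dir J' \<epsilon>') v) ij
      = B0 a ij + M * x b * sign_comb p J \<epsilon> u (fst ij) * sign_comb q J' \<epsilon>' v (snd ij)"
      by simp
  qed
  define W where "W = (\<lambda>a. \<Prod>i\<in>R. prior j i (a i))"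
  have "(\<Sum>\<epsilon>\<in>signs J. \<Sum>\<epsilon>'\<in>signs J'. H (Suc j) \<epsilon> \<epsilon>' - H j \<epsilon> \<epsilon>')
     = (\<Sum>\<epsilon>\<in>signs J. \<Sum>\<epsilon>'\<in>signs J'. \<Sum>a\<in>R \<rightarrow>\<^sub>E S. W a * (\<Sum>b\<in>S. d b * G a \<epsilon> \<epsilon>' b))"
    unfolding H_def hybrid_mean_Suc[OF j]
  proof (intro sum.cong refl)
    fix \<epsilon> \<epsilon>' a assume e: "\<epsilon> \<in> signs J" "\<epsilon>' \<in> signs J'"
    show "(\<Prod>i\<in>{..<r} - {j}. prior j i (a i)) * (\<Sum>b\<in>S. (\<nu>1 b - \<nu>0 b) *
        gauss_mean ({..<p} \<times> {..<q}) \<psi> (spikes r (\<lambda>k. M * x ((a(j := b)) k))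
          (steer p j (sign_dir J \<epsilon>) u) (steer q j (sign_dir J' \<epsilon>') v)))
       = W a * (\<Sum>b\<in>S. d b * G a \<epsilon> \<epsilon>' b)"
      unfolding sp[OF e] G_def W_def d_def R_def I_def ..
  qed (simp_all only: R_def)
  also have "\<dots> = (\<Sum>\<epsilon>\<in>signs J. \<Sum>a\<in>R \<rightarrow>\<^sub>E S. \<Sum>\<epsilon>'\<in>signs J'. W a * (\<Sum>b\<in>S. d b * G a \<epsilon> \<epsilon>' b))"
    by (intro sum.cong refl sum.swap)
  also have "\<dots> = (\<Sum>a\<in>R \<rightarrow>\<^sub>E S. \<Sum>\<epsilon>\<in>signs J. \<Sum>\<epsilon>'\<in>signs J'. W a * (\<Sum>b\<in>S. d b * G a \<epsilon> \<epsilon>' b))"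
    by (rule sum.swap)
  also have "\<dots> = (\<Sum>a\<in>R \<rightarrow>\<^sub>E S. W a * (\<Sum>\<epsilon>\<in>signs J. \<Sum>\<epsilon>'\<in>signs J'. \<Sum>b\<in>S. d b * G a \<epsilon> \<epsilon>' b))"
    by (simp only: sum_distrib_left)
  also have "\<dots> \<le> (\<Sum>a\<in>R \<rightarrow>\<^sub>E S. W a * (2 ^ card J * 2 ^ card J' * (17 / 4 * (1 / 10) ^ L)))"
  proof (intro sum_mono mult_left_mono)
    fix a assume a: "a \<in> R \<rightarrow>\<^sub>E S"
    show "0 \<le> W a" unfolding W_def by (rule prior_prod_nonneg[OF a])
    have "\<bar>\<Sum>\<epsilon>\<in>signs J. \<Sum>\<epsilon>'\<in>signs J'. \<Sum>b\<in>S. d b * G a \<epsilon> \<epsilon>' b\<bar>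
        \<le> 2 ^ card J * 2 ^ card J' * (17 / 4 * (1 / 10) ^ L)"
      unfolding G_def I_def
      by (rule hidden_spike[OF finite_S xb dsum mom L_pos J(1,3) J(2,4) Mc u v \<psi>])
    thus "(\<Sum>\<epsilon>\<in>signs J. \<Sum>\<epsilon>'\<in>signs J'. \<Sum>b\<in>S. d b * G a \<epsilon> \<epsilon>' b)
        \<le> 2 ^ card J * 2 ^ card J' * (17 / 4 * (1 / 10) ^ L)" by linarith
  qed
  also have "\<dots> = 2 ^ card J * 2 ^ card J' * (17 / 4 * (1 / 10) ^ L)"
  proof -
    have "sum W (R \<rightarrow>\<^sub>E S) = 1"
      unfolding W_def by (rule prior_prod_sum) (simp add: R_def)
    thus ?thesis by (simp only: sum_distrib_right[symmetric] mult_1)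
  qed
  also have "\<dots> = real (card (signs J \<times> signs J')) * (17 / 4 * (1 / 10) ^ L)"
    using J by (simp add: card_cartesian_product card_signs)
  finally show ?thesis .
qed

end

definition frame_pair_dist :: "nat \<Rightarrow> nat \<Rightarrow> (nat \<Rightarrow> nat \<Rightarrow> real) \<times> (nat \<Rightarrow> nat \<Rightarrow> real)
    \<Rightarrow> (nat \<Rightarrow> nat \<Rightarrow> real) \<times> (nat \<Rightarrow> nat \<Rightarrow> real) \<Rightarrow> real" where
  "frame_pair_dist p q X Y = frame_dist p (fst X) (fst Y) + frame_dist q (snd X) (snd Y)"

text \<open>Each spike is bilinear in its two vectors, whose entries are at most one.\<close>
lemma spikes_dist:
  assumes X: "frame p (fst X)" "frame q (snd X)" and Y: "frame p (fst Y)" "frame q (snd Y)"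
    and r: "r \<le> p" "r \<le> q" and M: "0 \<le> M" "\<And>k. k < r \<Longrightarrow> \<bar>\<sigma> k\<bar> \<le> M"
  shows "(\<Sum>ij\<in>{..<p} \<times> {..<q}. (spikes r \<sigma> (fst X) (snd X) ij - spikes r \<sigma> (fst Y) (snd Y) ij)\<^sup>2)
    \<le> real (p * q) * (2 * real r * M)\<^sup>2 * frame_pair_dist p q X Y"
proof -
  define D where "D = frame_pair_dist p q X Y"
  have fd: "0 \<le> frame_dist n u v" for n u v
    unfolding frame_dist_def by (intro sum_nonneg) auto
  have ent: "\<bar>u k i - v k i\<bar> \<le> sqrt (frame_dist n u v)" if "k < n" "i < n" for n u v k i
  proof -
    have "(case (k, i) of (k, i) \<Rightarrow> (u k i - v k i)\<^sup>2) \<le> frame_dist n u v"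
      unfolding frame_dist_def by (rule member_le_sum) (use that in auto)
    thus ?thesis by (intro real_le_rsqrt) simp
  qed
  have "(spikes r \<sigma> (fst X) (snd X) ij - spikes r \<sigma> (fst Y) (snd Y) ij)\<^sup>2 \<le> (2 * real r * M)\<^sup>2 * D"
    if ij: "ij \<in> {..<p} \<times> {..<q}" for ij
  proof -
    define i j where "i = fst ij" and "j = snd ij"
    have ij': "i < p" "j < q" using ij by (auto simp: i_def j_def)
    have t: "\<bar>\<sigma> k * fst X k i * snd X k j - \<sigma> k * fst Y k i * snd Y k j\<bar> \<le> M * (2 * sqrt D)" if k: "k < r" for k
    proof -
      have "\<bar>fst X k i * (snd X k j - snd Y k j)\<bar> \<le> 1 * sqrt D"
        unfolding abs_mult
      proof (intro mult_mono)
        show "\<bar>snd X k j - snd Y k j\<bar> \<le> sqrt D"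
          using ent[of k q j "snd X" "snd Y"] k r ij' fd[of p "fst X" "fst Y"]
          by (auto simp: D_def frame_pair_dist_def intro: order_trans)
      qed (use frame_entry_le_1[OF X(1)] k r ij' in auto)
      moreover have "\<bar>(fst X k i - fst Y k i) * snd Y k j\<bar> \<le> sqrt D * 1"
        unfolding abs_mult
      proof (intro mult_mono)
        show "\<bar>fst X k i - fst Y k i\<bar> \<le> sqrt D"
          using ent[of k p i "fst X" "fst Y"] k r ij' fd[of q "snd X" "snd Y"]
          by (auto simp: D_def frame_pair_dist_def intro: order_trans)
      qed (use frame_entry_le_1[OF Y(2)] k r ij' fd in \<open>auto simp: D_def frame_pair_dist_def\<close>)
      ultimately have "\<bar>fst X k i * (snd X k j - snd Y k j) + (fst X k i - fst Y k i) * snd Y k j\<bar> \<le> 2 * sqrt D"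
        by linarith
      hence "\<bar>\<sigma> k\<bar> * \<bar>fst X k i * (snd X k j - snd Y k j) + (fst X k i - fst Y k i) * snd Y k j\<bar> \<le> M * (2 * sqrt D)"
        using M k by (intro mult_mono) auto
      thus ?thesis by (simp add: abs_mult[symmetric] algebra_simps)
    qed
    have "\<bar>spikes r \<sigma> (fst X) (snd X) ij - spikes r \<sigma> (fst Y) (snd Y) ij\<bar>
       = \<bar>\<Sum>k<r. \<sigma> k * fst X k i * snd X k j - \<sigma> k * fst Y k i * snd Y k j\<bar>"
      by (simp add: spikes_def sum_subtractf i_def j_def)
    also have "\<dots> \<le> (\<Sum>k<r. \<bar>\<sigma> k * fst X k i * snd X k j - \<sigma> k * fst Y k i * snd Y k j\<bar>)" by (rule sum_abs)
    also have "\<dots> \<le> (\<Sum>k<r. M * (2 * sqrt D))" by (intro sum_mono t) auto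
    also have "\<dots> = 2 * real r * M * sqrt D" by simp
    finally have "\<bar>spikes r \<sigma> (fst X) (snd X) ij - spikes r \<sigma> (fst Y) (snd Y) ij\<bar>\<^sup>2 \<le> (2 * real r * M * sqrt D)\<^sup>2"
      by (intro power_mono) auto
    also have "\<dots> = (2 * real r * M)\<^sup>2 * D"
      using fd by (simp add: power_mult_distrib D_def frame_pair_dist_def)
    finally show ?thesis by simp
  qed
  hence "(\<Sum>ij\<in>{..<p} \<times> {..<q}. (spikes r \<sigma> (fst X) (snd X) ij - spikes r \<sigma> (fst Y) (snd Y) ij)\<^sup>2)
     \<le> (\<Sum>ij\<in>{..<p} \<times> {..<q}. (2 * real r * M)\<^sup>2 * D)" by (rule sum_mono)
  thus ?thesis by (simp add: D_def)
qed

lemma card_separated_frames_le: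
  assumes "0 < \<epsilon>"
  obtains b where "\<And>P. finite P \<Longrightarrow> P \<subseteq> {X. frame p (fst X) \<and> frame q (snd X)}
    \<Longrightarrow> separated (frame_pair_dist p q) \<epsilon> P \<Longrightarrow> card P \<le> b"
proof -
  define I where "I = ({..<p} \<times> {..<p}) <+> ({..<q} \<times> {..<q})"
  define c where "c = (\<lambda>X :: (nat \<Rightarrow> nat \<Rightarrow> real) \<times> (nat \<Rightarrow> nat \<Rightarrow> real). case_sum (case_prod (fst X)) (case_prod (snd X)))"
  have I: "finite I" by (simp add: I_def)
  have "(\<Sum>i\<in>I. (c X i - c Y i)\<^sup>2) = frame_pair_dist p q X Y" for X Y
    unfolding I_def by (subst sum.Plus) (auto simp: c_def frame_pair_dist_def frame_dist_def case_prod_unfold)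
  hence d: "(\<lambda>X Y. \<Sum>i\<in>I. (c X i - c Y i)\<^sup>2) = frame_pair_dist p q" by (intro ext)
  have "\<bar>c X i\<bar> \<le> 1" if "X \<in> {X. frame p (fst X) \<and> frame q (snd X)}" "i \<in> I" for X i
    using that frame_entry_le_1 by (auto simp: c_def I_def)
  from card_separated_cube_le[where c = c, OF I assms this] show ?thesis
    unfolding d using that by blast
qed

context matched_priors
begin

text \<open>The noise smooths: two signals at distance \<open>D\<close> have means of \<open>\<psi>\<close> that differ by at most
  \<open>(exp (D\<^sup>2) - 1)\<^bsup>1/2\<^esup>\<close>, and this is \<open>\<omega>\<close> when \<open>D\<^sup>2 = ln (1 + \<omega>\<^sup>2)\<close>.\<close>
lemma hybrid_mean_modulus:
  assumes X: "frame p (fst X)" "frame q (snd X)" and Y: "frame p (fst Y)" "frame q (snd Y)"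
    and r: "r \<le> p" "r \<le> q" and M: "0 \<le> M"
    and \<psi>: "\<psi> \<in> borel_measurable (\<Pi>\<^sub>M i\<in>{..<p} \<times> {..<q}. borel)" "\<And>y. \<bar>\<psi> y\<bar> \<le> 1"
    and om: "0 \<le> \<omega>" and close: "real (p * q) * (2 * real r * M)\<^sup>2 * frame_pair_dist p q X Y \<le> ln (1 + \<omega>\<^sup>2)"
  shows "hybrid_mean p q r M \<psi> j (fst X) (snd X) \<le> hybrid_mean p q r M \<psi> j (fst Y) (snd Y) + \<omega>"
proof -
  define I where "I = {..<p} \<times> {..<q}"
  define g where "g = (\<lambda>a X. gauss_mean I \<psi> (spikes r (\<lambda>k. M * x (a k)) (fst X) (snd X)))"
  have "g a X \<le> g a Y + \<omega>" if a: "a \<in> labels r" for a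
  proof -
    have sig: "\<bar>M * x (a k)\<bar> \<le> M" if "k < r" for k
      using x_bounds[of "a k"] a that M by (auto simp: PiE_iff abs_mult intro!: mult_left_le)
    have "(g a X - g a Y)\<^sup>2 \<le> exp (\<Sum>ij\<in>I. (spikes r (\<lambda>k. M * x (a k)) (fst X) (snd X) ij
        - spikes r (\<lambda>k. M * x (a k)) (fst Y) (snd Y) ij)\<^sup>2) - 1"
      unfolding g_def by (intro gauss_mean_dist) (use \<psi> in \<open>auto simp: I_def\<close>)
    also have "\<dots> \<le> exp (ln (1 + \<omega>\<^sup>2)) - 1"
      using order_trans[OF spikes_dist[OF X Y r M sig] close] unfolding I_def by simp
    also have "\<dots> = \<omega>\<^sup>2" by (simp add: add_pos_nonneg)
    finally have "\<bar>g a X - g a Y\<bar> \<le> \<bar>\<omega>\<bar>" by (simp only: abs_le_square_iff)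
    thus ?thesis using om by linarith
  qed
  hence "(\<Sum>a\<in>labels r. (\<Prod>i<r. prior j i (a i)) * g a X)
     \<le> (\<Sum>a\<in>labels r. (\<Prod>i<r. prior j i (a i)) * (g a Y + \<omega>))"
    by (intro sum_mono mult_left_mono prior_prod_nonneg) auto
  also have "\<dots> = (\<Sum>a\<in>labels r. (\<Prod>i<r. prior j i (a i)) * g a Y) + \<omega>"
    using prior_prod_sum[of "{..<r}" j] by (simp add: distrib_left sum.distrib sum_distrib_right[symmetric])
  finally show ?thesis by (simp add: hybrid_mean_def g_def I_def)
qed

lemma hybrid_mean_nonneg: "(\<And>y. 0 \<le> \<psi> y) \<Longrightarrow> 0 \<le> hybrid_mean p q r M \<psi> j u v"
  unfolding hybrid_mean_def
  by (intro sum_nonneg mult_nonneg_nonneg prior_prod_nonneg gauss_mean_nonneg)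

text \<open>Average over an almost invariant set \<open>N\<close> of frame pairs. For each \<open>j\<close> the frames may be steered at the
  price of \<open>2 \<omega>\<close>, and after averaging over the signs the step from \<open>j\<close> to \<open>j + 1\<close> costs only \<open>\<delta>\<close>. The
  steps add up to a bound for the average over \<open>N\<close>, so some pair in \<open>N\<close> satisfies it.\<close>
lemma exists_indistinguishing_frames:
  assumes r: "0 < r" "r \<le> p" "r \<le> q" and M: "0 \<le> M"
    and M': "10 * exp 1 * M\<^sup>2 \<le> sqrt (real (Suc (p - r)) * real (Suc (q - r)))"
    and \<psi>: "\<psi> \<in> borel_measurable (\<Pi>\<^sub>M i\<in>{..<p} \<times> {..<q}. borel)" "\<And>y. 0 \<le> \<psi> y" "\<And>y. \<psi> y \<le> 1"
    and eta: "0 < \<theta>"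
  obtains u v where "frame p u" "frame q v"
    "hybrid_mean p q r M \<psi> r u v - hybrid_mean p q r M \<psi> 0 u v \<le> real r * (17 / 4 * (1 / 10) ^ L) + \<theta>"
proof -
  define X where "X = {X. frame p (fst X) \<and> frame q (snd X)}"
  define d where "d = frame_pair_dist p q"
  define H where "H = (\<lambda>j X. hybrid_mean p q r M \<psi> j (fst X) (snd X))"
  define \<delta> where "\<delta> = 17 / 4 * (1 / 10 :: real) ^ L"
  \<comment> \<open>The modulus is lost twice in each of the \<open>r\<close> steps.\<close>
  define \<omega> where "\<omega> = \<theta> / (2 * real r)"
  have om: "0 < \<omega>" using eta r by (simp add: \<omega>_def)
  \<comment> \<open>Adding one keeps the constant positive when \<open>M = 0\<close>.\<close>
  define C where "C = real (p * q) * (2 * real r * M)\<^sup>2 + 1"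
  have C: "0 < C" unfolding C_def by (intro add_nonneg_pos mult_nonneg_nonneg) auto
  define \<epsilon> where "\<epsilon> = ln (1 + \<omega>\<^sup>2) / C"
  have eps: "0 < \<epsilon>" unfolding \<epsilon>_def using om C by (simp add: add_pos_pos)
  have \<psi>': "\<And>y. \<bar>\<psi> y\<bar> \<le> 1" using \<psi>(2,3) by simp
  have dnn: "0 \<le> d A B" for A B
    unfolding d_def frame_pair_dist_def frame_dist_def by (intro add_nonneg_nonneg sum_nonneg) auto
  have modulus: "H j A \<le> H j B + \<omega>" if "A \<in> X" "B \<in> X" "d A B < \<epsilon>" for j A B
    unfolding H_def
  proof (rule hybrid_mean_modulus[OF _ _ _ _ r(2,3) M \<psi>(1) \<psi>'])
    have "real (p * q) * (2 * real r * M)\<^sup>2 * d A B \<le> C * d A B"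
      unfolding C_def by (intro mult_right_mono dnn) simp
    also have "\<dots> \<le> C * \<epsilon>" using that C by (intro mult_left_mono) auto
    finally show "real (p * q) * (2 * real r * M)\<^sup>2 * frame_pair_dist p q A B \<le> ln (1 + \<omega>\<^sup>2)"
      using C by (simp add: d_def \<epsilon>_def)
  qed (use that om in \<open>auto simp: X_def\<close>)
  have Hnn: "0 \<le> H j A" for j A unfolding H_def by (rule hybrid_mean_nonneg[OF \<psi>(2)])
  have sym: "d A B = d B A" for A B
    unfolding d_def frame_pair_dist_def frame_dist_def by (simp add: power2_commute case_prod_unfold)
  have d_refl: "d A A = 0" for A
    unfolding d_def frame_pair_dist_def frame_dist_def by (simp add: case_prod_unfold)
  have "(\<lambda>k i. of_bool (k = i), \<lambda>k i. of_bool (k = i)) \<in> X" by (simp add: X_def frame_identity)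
  hence ne: "X \<noteq> {}" by blast
  obtain b where b: "\<And>P. finite P \<Longrightarrow> P \<subseteq> X \<Longrightarrow> separated d \<epsilon> P \<Longrightarrow> card P \<le> b"
    using card_separated_frames_le[OF eps, of p q] unfolding X_def d_def by blast
  obtain N where N: "finite N" "N \<noteq> {}" "N \<subseteq> X"
    and inv: "\<And>g (f :: _ \<Rightarrow> real) (\<omega> :: real). \<lbrakk>g ` X \<subseteq> X; \<And>x y. x \<in> X \<Longrightarrow> y \<in> X \<Longrightarrow> d (g x) (g y) = d x y;
       \<And>x. x \<in> X \<Longrightarrow> 0 \<le> f x; 0 \<le> \<omega>;
       \<And>x y. x \<in> X \<Longrightarrow> y \<in> X \<Longrightarrow> d x y < \<epsilon> \<Longrightarrow> f x \<le> f y + \<omega>\<rbrakk>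
      \<Longrightarrow> \<bar>(\<Sum>x\<in>N. f (g x)) - sum f N\<bar> \<le> card N * \<omega>"
  proof (rule almost_invariant_average[of \<epsilon> d X b, OF eps sym d_refl ne b])
    fix N
    assume N: "finite N" "N \<noteq> {}" "N \<subseteq> X"
      and inv: "\<And>g (f :: _ \<Rightarrow> real) (\<omega> :: real). \<lbrakk>g ` X \<subseteq> X; \<And>x y. x \<in> X \<Longrightarrow> y \<in> X \<Longrightarrow> d (g x) (g y) = d x y;
       \<And>x. x \<in> X \<Longrightarrow> 0 \<le> f x; 0 \<le> \<omega>;
       \<And>x y. x \<in> X \<Longrightarrow> y \<in> X \<Longrightarrow> d x y < \<epsilon> \<Longrightarrow> f x \<le> f y + \<omega>\<rbrakk>
      \<Longrightarrow> \<bar>(\<Sum>x\<in>N. f (g x)) - sum f N\<bar> \<le> card N * \<omega>"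
    show thesis by (rule that[OF N inv])
  qed assumption+
  have step: "(\<Sum>A\<in>N. H (Suc j) A - H j A) \<le> card N * (\<delta> + 2 * \<omega>)" if j: "j < r" for j
  proof -
    define J where "J = insert j {r..<p}"
    define J' where "J' = insert j {r..<q}"
    define E where "E = signs J \<times> signs J'"
    have E: "finite E" "0 < card E"
      unfolding E_def by (auto simp: J_def J'_def card_cartesian_product card_signs intro!: finite_cartesian_product finite_signs)
    define g where "g = (\<lambda>e A. (steer p j (sign_dir J (fst e)) (fst A), steer q j (sign_dir J' (snd e)) (snd A)))"
    have gX: "g e ` X \<subseteq> X" for e by (auto simp: g_def X_def frame_steer)
    have gd: "d (g e A) (g e B) = d A B" for e A B
      by (simp add: g_def d_def frame_pair_dist_def frame_dist_steer)
    have move: "(\<Sum>A\<in>N. H (Suc j) A - H j A) \<le> (\<Sum>A\<in>N. H (Suc j) (g e A) - H j (g e A)) + 2 * (card N * \<omega>)" for e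
    proof -
      have "\<bar>(\<Sum>A\<in>N. H k (g e A)) - sum (H k) N\<bar> \<le> card N * \<omega>" for k
        by (rule inv[of "g e" "H k" \<omega>]) (rule gX, rule gd, rule Hnn, rule less_imp_le[OF om], rule modulus, assumption+)
      from this[of j] this[of "Suc j"] show ?thesis unfolding sum_subtractf by linarith
    qed
    have "real (card E) * (\<Sum>A\<in>N. H (Suc j) A - H j A) = (\<Sum>e\<in>E. \<Sum>A\<in>N. H (Suc j) A - H j A)" by simp
    also have "\<dots> \<le> (\<Sum>e\<in>E. (\<Sum>A\<in>N. H (Suc j) (g e A) - H j (g e A)) + 2 * (card N * \<omega>))"
      by (intro sum_mono move)
    also have "\<dots> = (\<Sum>A\<in>N. \<Sum>e\<in>E. H (Suc j) (g e A) - H j (g e A)) + card E * (2 * (card N * \<omega>))"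
      unfolding sum.distrib by (subst sum.swap) simp
    also have "(\<Sum>A\<in>N. \<Sum>e\<in>E. H (Suc j) (g e A) - H j (g e A)) \<le> (\<Sum>A\<in>N. card E * \<delta>)"
    proof (intro sum_mono)
      fix A assume "A \<in> N"
      hence A: "frame p (fst A)" "frame q (snd A)" using N by (auto simp: X_def)
      show "(\<Sum>e\<in>E. H (Suc j) (g e A) - H j (g e A)) \<le> card E * \<delta>"
      proof -
        have "(\<Sum>e\<in>E. H (Suc j) (g e A) - H j (g e A))
           = (\<Sum>\<epsilon>\<in>signs J. \<Sum>\<epsilon>'\<in>signs J'. H (Suc j) (g (\<epsilon>, \<epsilon>') A) - H j (g (\<epsilon>, \<epsilon>') A))"
          unfolding E_def sum.cartesian_product
          by (intro sum.cong refl) (simp add: case_prod_unfold)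
        also have "\<dots> \<le> real (card (signs J \<times> signs J')) * (17 / 4 * (1 / 10) ^ L)"
          using hybrid_mean_steer_average[OF j r(2,3) M' A \<psi>(1) \<psi>']
          unfolding H_def g_def J_def[symmetric] J'_def[symmetric] fst_conv snd_conv .
        finally show ?thesis unfolding E_def \<delta>_def .
      qed
    qed
    finally have "real (card E) * (\<Sum>A\<in>N. H (Suc j) A - H j A) \<le> real (card E) * (card N * (\<delta> + 2 * \<omega>))"
      by (simp add: algebra_simps)
    thus ?thesis using E by (simp only: mult_le_cancel_left_pos of_nat_0_less_iff)
  qed
  have "(\<Sum>A\<in>N. H r A - H 0 A) = (\<Sum>A\<in>N. \<Sum>j<r. H (Suc j) A - H j A)"
    by (intro sum.cong refl sum_lessThan_telescope[symmetric])
  also have "\<dots> = (\<Sum>j<r. \<Sum>A\<in>N. H (Suc j) A - H j A)" by (rule sum.swap)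
  also have "\<dots> \<le> (\<Sum>j<r. card N * (\<delta> + 2 * \<omega>))" by (intro sum_mono step) auto
  also have "\<dots> = (\<Sum>A\<in>N. real r * \<delta> + \<theta>)" using r by (simp add: \<omega>_def field_simps)
  finally have le: "(\<Sum>A\<in>N. H r A - H 0 A) \<le> (\<Sum>A\<in>N. real r * \<delta> + \<theta>)" .
  have "\<not> (\<forall>A\<in>N. real r * \<delta> + \<theta> < H r A - H 0 A)"
  proof
    assume "\<forall>A\<in>N. real r * \<delta> + \<theta> < H r A - H 0 A"
    hence "(\<Sum>A\<in>N. real r * \<delta> + \<theta>) < (\<Sum>A\<in>N. H r A - H 0 A)"
      by (intro sum_strict_mono N) blast
    thus False using le by linarith
  qed
  then obtain A where A: "A \<in> N" "H r A - H 0 A \<le> real r * \<delta> + \<theta>" by force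
  show ?thesis by (rule that[of "fst A" "snd A"]) (use A N in \<open>auto simp: X_def H_def \<delta>_def\<close>)
qed

end

section \<open>A signed measure that annihilates polynomials but not fractional powers\<close>

definition unity_root :: "nat \<Rightarrow> nat \<Rightarrow> complex" where
  "unity_root n j = exp (2 * of_real pi * \<i> * of_nat j / of_nat n)"

lemma unity_root_eq_1_iff: "0 < n \<Longrightarrow> unity_root n j = 1 \<longleftrightarrow> n dvd j"
  unfolding unity_root_def using complex_root_unity_eq_1[of n j] by simp

lemma unity_root_power: "unity_root n j ^ k = unity_root n (j * k)"
  unfolding unity_root_def by (simp add: exp_of_nat_mult[symmetric] algebra_simps)

lemma norm_unity_root: "norm (unity_root n j) = 1"
proof -
  have "unity_root n j = exp (\<i> * of_real (2 * pi * real j / real n))"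
    by (simp add: unity_root_def algebra_simps)
  thus ?thesis by (simp only: norm_exp_i_times)
qed

lemma Re_unity_root: "Re (unity_root n j) = cos (2 * pi * real j / real n)"
proof -
  have "unity_root n j = cis (2 * pi * real j / real n)"
    by (simp add: unity_root_def cis_conv_exp algebra_simps)
  thus ?thesis by simp
qed

lemma unity_root_power_n: "0 < n \<Longrightarrow> unity_root n j ^ n = 1"
  by (simp add: unity_root_power unity_root_eq_1_iff)

lemma cnj_unity_root:
  assumes "0 < n"
  shows "cnj (unity_root n j) = unity_root n j ^ (n - 1)"
proof -
  have "unity_root n j * unity_root n j ^ (n - 1) = 1"
    using unity_root_power_n[OF assms, of j] assms by (simp add: power_eq_if)
  moreover have "unity_root n j * cnj (unity_root n j) = 1"
    by (simp add: complex_norm_square[symmetric] norm_unity_root)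
  moreover have "unity_root n j \<noteq> 0" by (simp add: unity_root_def)
  ultimately show ?thesis by (metis mult_left_cancel)
qed

lemma sum_unity_root_powers:
  assumes n: "0 < n"
  shows "(\<Sum>j<n. unity_root n j ^ k) = (if n dvd k then of_nat n else 0)"
proof -
  define y where "y = unity_root n k"
  have "unity_root n j ^ k = y ^ j" for j
    by (simp add: unity_root_power y_def mult.commute)
  hence s: "(\<Sum>j<n. unity_root n j ^ k) = (\<Sum>j<n. y ^ j)" by simp
  show ?thesis
  proof (cases "n dvd k")
    case True
    hence "y = 1" using unity_root_eq_1_iff[OF n] by (simp add: y_def)
    thus ?thesis using s True by simp
  next
    case False
    hence "y \<noteq> 1" using unity_root_eq_1_iff[OF n] by (simp add: y_def)
    thus ?thesis using s False unity_root_power_n[OF n, of k] geometric_sum[of y n] by (simp add: y_def)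
  qed
qed

text \<open>A root of unity other than one keeps away from one: its powers average to zero.\<close>
lemma norm_one_minus_root_ge:
  fixes y :: complex
  assumes n: "0 < n" and y: "y ^ n = 1" "y \<noteq> 1"
  shows "1 / real n \<le> norm (1 - y)"
proof -
  have ny: "norm y = 1"
    using y n power_eq_1_iff[of y n] by (metis norm_one norm_power norm_ge_zero power_eq_1_iff zero_less_iff_neq_zero)
  have le: "norm (1 - y ^ k) \<le> real k * norm (1 - y)" for k
  proof (induction k)
    case (Suc k)
    have "1 - y ^ Suc k = (1 - y ^ k) + y ^ k * (1 - y)" by (simp add: algebra_simps)
    hence "norm (1 - y ^ Suc k) \<le> norm (1 - y ^ k) + norm (y ^ k * (1 - y))"
      by (metis norm_triangle_ineq)
    moreover have "norm (y ^ k * (1 - y)) = norm (1 - y)"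
      by (simp only: norm_mult norm_power ny power_one mult_1)
    moreover have "real (Suc k) * norm (1 - y) = real k * norm (1 - y) + norm (1 - y)"
      by (simp add: algebra_simps)
    ultimately show ?case using Suc by linarith
  qed simp
  have "(\<Sum>k<n. y ^ k) = 0" using y geometric_sum[of y n] by simp
  hence "of_nat n = (\<Sum>k<n. 1 - y ^ k)" by (simp add: sum_subtractf)
  hence "real n = norm (\<Sum>k<n. 1 - y ^ k)" by (metis norm_of_nat)
  also have "\<dots> \<le> (\<Sum>k<n. norm (1 - y ^ k))" by (rule norm_sum)
  also have "\<dots> \<le> (\<Sum>k<n. real n * norm (1 - y))"
  proof (intro sum_mono)
    fix k assume "k \<in> {..<n}"
    hence "real k * norm (1 - y) \<le> real n * norm (1 - y)" by (intro mult_right_mono) auto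
    thus "norm (1 - y ^ k) \<le> real n * norm (1 - y)" using le[of k] by linarith
  qed
  also have "\<dots> = real n * (real n * norm (1 - y))" by simp
  finally have "1 \<le> real n * norm (1 - y)" using n by simp
  thus ?thesis using n by (simp add: field_simps)
qed

definition node :: "nat \<Rightarrow> nat \<Rightarrow> real" where
  "node L j = cos (2 * pi * real j / real (4 * L))"

text \<open>The Fejer kernel \<open>\<Sum>\<^sub>k (1 - \<bar>k\<bar> / L) z\<^sup>k\<close>, whose frequencies are below \<open>L\<close>; as a square it is visibly
  nonnegative.\<close>
definition fejer :: "nat \<Rightarrow> nat \<Rightarrow> real" where
  "fejer L j = (norm (\<Sum>k<L. unity_root (4 * L) j ^ k))\<^sup>2 / real L"

text \<open>On the roots of unity of order \<open>4L\<close> the sign \<open>(-1)\<^sup>j\<close> is the character of frequency \<open>2L\<close>. It moves the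
  frequencies of the kernel to a band around \<open>2L\<close> that, modulo \<open>4L\<close>, avoids all frequencies below \<open>L\<close>.\<close>
definition node_weight :: "nat \<Rightarrow> nat \<Rightarrow> real" where
  "node_weight L j = (-1) ^ j * fejer L j / real (4 * L)"

definition node_moment :: "nat \<Rightarrow> nat \<Rightarrow> real" where
  "node_moment L m = (\<Sum>j<4 * L. node_weight L j * node L j ^ m)"

lemma fejer_nonneg: "0 \<le> fejer L j"
  by (simp add: fejer_def)

lemma fejer_expand:
  assumes "0 < L"
  shows "of_real (fejer L j) = (\<Sum>k<L. \<Sum>l<L. unity_root (4 * L) j ^ (k + (4 * L - 1) * l)) / of_nat L"
proof -
  define z where "z = unity_root (4 * L) j"
  have cz: "cnj z = z ^ (4 * L - 1)" unfolding z_def using assms by (intro cnj_unity_root) simp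
  have "of_real ((norm (\<Sum>k<L. z ^ k))\<^sup>2) = (\<Sum>k<L. z ^ k) * cnj (\<Sum>k<L. z ^ k)"
    by (rule complex_norm_square)
  also have "cnj (\<Sum>k<L. z ^ k) = (\<Sum>l<L. z ^ ((4 * L - 1) * l))"
    by (simp only: cnj_sum complex_cnj_power cz power_mult)
  also have "(\<Sum>k<L. z ^ k) * \<dots> = (\<Sum>k<L. \<Sum>l<L. z ^ (k + (4 * L - 1) * l))"
    unfolding sum_product power_add ..
  finally have "of_real ((norm (\<Sum>k<L. z ^ k))\<^sup>2) = (\<Sum>k<L. \<Sum>l<L. z ^ (k + (4 * L - 1) * l))" .
  thus ?thesis unfolding fejer_def of_real_divide z_def by simp
qed

lemma sum_fejer:
  assumes L: "0 < L"
  shows "(\<Sum>j<4 * L. fejer L j) = real (4 * L)"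
proof -
  have n1: "int (4 * L - 1) = int (4 * L) - 1" using L by linarith
  have "complex_of_real (\<Sum>j<4 * L. fejer L j)
     = (\<Sum>j<4 * L. (\<Sum>k<L. \<Sum>l<L. unity_root (4 * L) j ^ (k + (4 * L - 1) * l)) / of_nat L)"
    unfolding of_real_sum fejer_expand[OF L] ..
  also have "\<dots> = (\<Sum>j<4 * L. \<Sum>k<L. \<Sum>l<L. unity_root (4 * L) j ^ (k + (4 * L - 1) * l)) / of_nat L"
    by (simp only: sum_divide_distrib)
  also have "(\<Sum>j<4 * L. \<Sum>k<L. \<Sum>l<L. unity_root (4 * L) j ^ (k + (4 * L - 1) * l))
     = (\<Sum>k<L. \<Sum>j<4 * L. \<Sum>l<L. unity_root (4 * L) j ^ (k + (4 * L - 1) * l))" by (rule sum.swap)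
  also have "\<dots> = (\<Sum>k<L. \<Sum>l<L. \<Sum>j<4 * L. unity_root (4 * L) j ^ (k + (4 * L - 1) * l))"
    by (intro sum.cong refl sum.swap)
  also have "\<dots> = (\<Sum>k<L. \<Sum>l<L. if l = k then of_nat (4 * L) else 0)"
  proof (intro sum.cong refl)
    fix k l assume kl: "k \<in> {..<L}" "l \<in> {..<L}"
    have "4 * L dvd k + (4 * L - 1) * l \<longleftrightarrow> l = k"
    proof
      assume "4 * L dvd k + (4 * L - 1) * l"
      hence "int (4 * L) dvd int (k + (4 * L - 1) * l)" by (simp only: of_nat_dvd_iff)
      also have "int (k + (4 * L - 1) * l) = (int k - int l) + int (4 * L) * int l"
        by (simp only: of_nat_add of_nat_mult[of "4 * L - 1"] n1) (simp add: algebra_simps)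
      finally have "int (4 * L) dvd int k - int l" by (simp add: dvd_add_left_iff)
      moreover have "\<bar>int k - int l\<bar> < int (4 * L)" using kl by auto
      ultimately show "l = k" using zdvd_not_zless[of "\<bar>int k - int l\<bar>" "int (4 * L)"] by force
    next
      assume "l = k"
      hence "k + (4 * L - 1) * l = 4 * L * k" using L by (simp add: algebra_simps diff_mult_distrib)
      thus "4 * L dvd k + (4 * L - 1) * l" by simp
    qed
    thus "(\<Sum>j<4 * L. unity_root (4 * L) j ^ (k + (4 * L - 1) * l)) = (if l = k then of_nat (4 * L) else 0)"
      using L sum_unity_root_powers[of "4 * L" "k + (4 * L - 1) * l"] by simp
  qed
  also have "\<dots> = of_nat L * of_nat (4 * L)" by simp
  finally have "complex_of_real (\<Sum>j<4 * L. fejer L j) = complex_of_real (real (4 * L))" using L by simp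
  thus ?thesis by (simp only: of_real_eq_iff)
qed

lemma sum_abs_node_weight:
  assumes "0 < L"
  shows "(\<Sum>j<4 * L. \<bar>node_weight L j\<bar>) = 1"
proof -
  have "(\<Sum>j<4 * L. \<bar>node_weight L j\<bar>) = (\<Sum>j<4 * L. fejer L j) / real (4 * L)"
    unfolding sum_divide_distrib
    by (intro sum.cong refl) (simp add: node_weight_def abs_mult power_abs fejer_nonneg)
  thus ?thesis using sum_fejer[OF assms] assms by simp
qed

text \<open>Everything in a node moment is a polynomial in the root of unity with nonnegative coefficients (the
  inverse of a root being its power with exponent \<open>4L - 1\<close>), and averaging over all roots keeps exactly the exponents
  divisible by \<open>4L\<close>.\<close>
lemma node_moment_eq:
  assumes L: "0 < L"
  shows "node_moment L m = (\<Sum>k<L. \<Sum>l<L. \<Sum>i\<le>m. real (m choose i) *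
      of_bool (4 * L dvd 2 * L + (k + (4 * L - 1) * l) + (i + (4 * L - 1) * (m - i)))) / (real L * 2 ^ m)"
proof -
  define E where "E = (\<lambda>k l i. 2 * L + (k + (4 * L - 1) * l) + (i + (4 * L - 1) * (m - i)))"
  define z where "z = unity_root (4 * L)"
  have cosz: "complex_of_real (node L j) = (z j + z j ^ (4 * L - 1)) / 2" for j
  proof -
    have "complex_of_real (2 * Re (z j)) = z j + cnj (z j)" by (rule complex_add_cnj[symmetric])
    also have "cnj (z j) = z j ^ (4 * L - 1)" unfolding z_def using L by (intro cnj_unity_root) simp
    finally show ?thesis by (simp add: node_def z_def Re_unity_root field_simps)
  qed
  have signz: "(-1) ^ j = z j ^ (2 * L)" for j
  proof -
    have "z j ^ (2 * L) = exp (of_nat (2 * L) * (2 * of_real pi * \<i> * of_nat j / of_nat (4 * L)))"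
      by (simp only: z_def unity_root_def exp_of_nat_mult)
    also have "of_nat (2 * L) * (2 * of_real pi * \<i> * of_nat j / of_nat (4 * L)) = of_nat j * (of_real pi * \<i>)"
      using L by (simp add: field_simps)
    also have "exp (of_nat j * (of_real pi * \<i>)) = (-1) ^ j"
      by (simp only: exp_of_nat_mult exp_pi_i)
    finally show ?thesis ..
  qed
  have powz: "complex_of_real (node L j ^ m) = (\<Sum>i\<le>m. of_nat (m choose i) * z j ^ (i + (4 * L - 1) * (m - i))) / 2 ^ m" for j
    unfolding of_real_power cosz power_divide binomial_ring
    by (simp only: power_add power_mult mult.assoc)
  have term1: "complex_of_real (node_weight L j * node L j ^ m)
     = (\<Sum>k<L. \<Sum>l<L. \<Sum>i\<le>m. of_nat (m choose i) * z j ^ E k l i) / (of_nat (4 * L) * of_nat L * 2 ^ m)" for j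
  proof -
    have "complex_of_real (node_weight L j * node L j ^ m)
       = z j ^ (2 * L) * ((\<Sum>k<L. \<Sum>l<L. z j ^ (k + (4 * L - 1) * l)) / of_nat L) / of_nat (4 * L)
         * ((\<Sum>i\<le>m. of_nat (m choose i) * z j ^ (i + (4 * L - 1) * (m - i))) / 2 ^ m)"
      unfolding node_weight_def of_real_mult of_real_divide powz[symmetric] fejer_expand[OF L]
      by (simp add: signz z_def)
    also have "\<dots> = (z j ^ (2 * L) * ((\<Sum>k<L. \<Sum>l<L. z j ^ (k + (4 * L - 1) * l))
         * (\<Sum>i\<le>m. of_nat (m choose i) * z j ^ (i + (4 * L - 1) * (m - i))))) / (of_nat (4 * L) * of_nat L * 2 ^ m)"
      by (simp add: mult_ac)
    also have "z j ^ (2 * L) * ((\<Sum>k<L. \<Sum>l<L. z j ^ (k + (4 * L - 1) * l))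
         * (\<Sum>i\<le>m. of_nat (m choose i) * z j ^ (i + (4 * L - 1) * (m - i))))
       = (\<Sum>k<L. \<Sum>l<L. \<Sum>i\<le>m. of_nat (m choose i) * z j ^ E k l i)"
      unfolding sum_distrib_right unfolding sum_distrib_left
      by (intro sum.cong refl) (simp only: E_def power_add mult_ac)
    finally show ?thesis .
  qed
  have "complex_of_real (node_moment L m)
     = (\<Sum>j<4 * L. (\<Sum>k<L. \<Sum>l<L. \<Sum>i\<le>m. of_nat (m choose i) * z j ^ E k l i)) / (of_nat (4 * L) * of_nat L * 2 ^ m)"
    unfolding node_moment_def of_real_sum term1 sum_divide_distrib ..
  also have "(\<Sum>j<4 * L. \<Sum>k<L. \<Sum>l<L. \<Sum>i\<le>m. of_nat (m choose i) * z j ^ E k l i)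
     = (\<Sum>k<L. \<Sum>j<4 * L. \<Sum>l<L. \<Sum>i\<le>m. of_nat (m choose i) * z j ^ E k l i)" by (rule sum.swap)
  also have "\<dots> = (\<Sum>k<L. \<Sum>l<L. \<Sum>j<4 * L. \<Sum>i\<le>m. of_nat (m choose i) * z j ^ E k l i)"
    by (intro sum.cong refl sum.swap)
  also have "\<dots> = (\<Sum>k<L. \<Sum>l<L. \<Sum>i\<le>m. \<Sum>j<4 * L. of_nat (m choose i) * z j ^ E k l i)"
    by (intro sum.cong refl sum.swap)
  also have "\<dots> = (\<Sum>k<L. \<Sum>l<L. \<Sum>i\<le>m. of_nat (4 * L) * (of_nat (m choose i) * of_bool (4 * L dvd E k l i)))"
  proof (intro sum.cong refl)
    fix k l i
    have "(\<Sum>j<4 * L. z j ^ E k l i) = of_nat (4 * L) * of_bool (4 * L dvd E k l i)"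
      unfolding z_def using L sum_unity_root_powers[of "4 * L" "E k l i"] by simp
    thus "(\<Sum>j<4 * L. of_nat (m choose i) * z j ^ E k l i)
       = of_nat (4 * L) * (of_nat (m choose i) * of_bool (4 * L dvd E k l i))"
      unfolding sum_distrib_left[symmetric] by (simp only: mult.left_commute)
  qed
  also have "\<dots> = of_nat (4 * L) * complex_of_real (\<Sum>k<L. \<Sum>l<L. \<Sum>i\<le>m. real (m choose i) * of_bool (4 * L dvd E k l i))"
    unfolding sum_distrib_left[symmetric] by simp
  finally have "complex_of_real (node_moment L m)
    = complex_of_real ((\<Sum>k<L. \<Sum>l<L. \<Sum>i\<le>m. real (m choose i) * of_bool (4 * L dvd E k l i)) / (real L * 2 ^ m))"
    using L by simp
  thus ?thesis unfolding E_def by (simp only: of_real_eq_iff)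
qed

lemma node_moment_nonneg: "0 < L \<Longrightarrow> 0 \<le> node_moment L m"
  unfolding node_moment_eq by (intro divide_nonneg_nonneg sum_nonneg mult_nonneg_nonneg) auto

text \<open>Modulo \<open>4L\<close> the exponents are \<open>2L + (k - l) + (2i - m)\<close>, which lie strictly between \<open>0\<close> and \<open>4L\<close>.\<close>
lemma node_moment_eq_0:
  assumes L: "0 < L" and m: "m < L"
  shows "node_moment L m = 0"
proof -
  have n1: "int (4 * L - 1) = int (4 * L) - 1" using L by linarith
  have "\<not> 4 * L dvd 2 * L + (k + (4 * L - 1) * l) + (i + (4 * L - 1) * (m - i))"
    if kl: "k < L" "l < L" "i \<le> m" for k l i
  proof
    assume "4 * L dvd 2 * L + (k + (4 * L - 1) * l) + (i + (4 * L - 1) * (m - i))"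
    hence "int (4 * L) dvd int (2 * L + (k + (4 * L - 1) * l) + (i + (4 * L - 1) * (m - i)))"
      by (simp only: of_nat_dvd_iff)
    also have "int (2 * L + (k + (4 * L - 1) * l) + (i + (4 * L - 1) * (m - i)))
       = (2 * int L + int k - int l + 2 * int i - int m) + int (4 * L) * (int l + int m - int i)"
      by (simp only: of_nat_add of_nat_mult[of "4 * L - 1"] n1 of_nat_diff[OF kl(3)]) (simp add: algebra_simps)
    finally have "int (4 * L) dvd 2 * int L + int k - int l + 2 * int i - int m"
      by (simp only: dvd_add_left_iff dvd_triv_left)
    moreover have "0 < 2 * int L + int k - int l + 2 * int i - int m"
      "2 * int L + int k - int l + 2 * int i - int m < int (4 * L)"
      using kl m by auto
    ultimately show False using zdvd_not_zless by blast
  qed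
  thus ?thesis unfolding node_moment_eq[OF L] by simp
qed

text \<open>The atom at \<open>j = 0\<close>, where the node is \<open>1\<close>, has weight \<open>1/4\<close>. The node \<open>-1\<close> has weight zero because \<open>L\<close> is even.
  All other nodes have modulus at most \<open>1 - 1 / (2 N\<^sup>2)\<close> with \<open>N = 4L\<close>, so their \<open>m\<close>-th powers are at most \<open>1/8\<close>
  once \<open>m \<ge> 6 N\<^sup>2\<close>.\<close>
lemma node_moment_ge:
  assumes L: "0 < L" "even L" and m: "6 * (4 * L)\<^sup>2 \<le> m"
  shows "1 / 8 \<le> node_moment L m"
proof -
  define N where "N = 4 * L"
  have N: "0 < N" using L by (simp add: N_def)
  have w0: "node_weight L 0 = 1 / 4" "node L 0 = 1"
    using L by (simp_all add: node_weight_def node_def fejer_def unity_root_def power2_eq_square)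
  have small: "\<bar>node_weight L j * node L j ^ m\<bar> \<le> \<bar>node_weight L j\<bar> * (1 / 8)" if j: "j < N" "j \<noteq> 0" for j
  proof (cases "j = 2 * L")
    case True
    have "unity_root (4 * L) j = -1"
    proof -
      have "2 * of_real pi * \<i> * of_nat j / of_nat (4 * L) = of_real pi * \<i>" using L True by simp
      thus ?thesis by (simp only: unity_root_def exp_pi_i)
    qed
    moreover have "(\<Sum>k<L. (-1) ^ k) = (0 :: complex)"
      using L geometric_sum[of "-1 :: complex" L] by simp
    ultimately have "fejer L j = 0" by (simp add: fejer_def)
    thus ?thesis by (simp add: node_weight_def)
  next
    case False
    define z where "z = unity_root N j"
    have zz: "z\<^sup>2 = unity_root N (j * 2)" unfolding z_def by (rule unity_root_power)
    have "\<not> N dvd j * 2"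
    proof
      assume "N dvd j * 2"
      then obtain t where t: "j * 2 = N * t" by (auto simp: dvd_def)
      have "N * t < N * 2" using t j by linarith
      hence "t < 2" by simp
      hence "t = 0 \<or> t = 1" by linarith
      thus False using t j False by (auto simp: N_def)
    qed
    hence z1: "z\<^sup>2 \<noteq> 1" using unity_root_eq_1_iff[OF N] zz by simp
    have "(z\<^sup>2) ^ (2 * L) = 1"
      using unity_root_power_n[OF N, of j] by (simp add: z_def N_def power_mult[symmetric])
    from norm_one_minus_root_ge[OF _ this z1] L have ge: "1 / real (2 * L) \<le> norm (1 - z\<^sup>2)" by simp
    have nz: "(Re z)\<^sup>2 + (Im z)\<^sup>2 = 1"
      using norm_unity_root[of N j] by (simp add: z_def norm_complex_def real_sqrt_eq_1_iff)
    \<comment> \<open>The squared root has order dividing \<open>2L\<close>, which bounds the sine from below.\<close>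
    have "1 - z\<^sup>2 = - 2 * \<i> * Im z * z"
      using nz by (simp add: complex_eq_iff power2_eq_square algebra_simps)
    hence "norm (1 - z\<^sup>2) = 2 * \<bar>Im z\<bar>"
      by (simp add: norm_mult norm_unity_root z_def)
    hence im: "1 / real N \<le> \<bar>Im z\<bar>" using ge by (simp add: N_def field_simps)
    have im2: "1 / (real N)\<^sup>2 \<le> (Im z)\<^sup>2"
      using power_mono[OF im, of 2] N by (simp add: power_divide)
    have c: "node L j = Re z" by (simp add: node_def z_def Re_unity_root N_def)
    have N1: "1 / (real N)\<^sup>2 \<le> 1" using N by simp
    have "\<bar>node L j\<bar>\<^sup>2 \<le> (1 - 1 / (2 * (real N)\<^sup>2))\<^sup>2"
    proof -
      have "(1 - y / 2)\<^sup>2 \<ge> 1 - y" for y :: real by (simp add: power2_eq_square algebra_simps)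
      hence "1 - 1 / (real N)\<^sup>2 \<le> (1 - 1 / (real N)\<^sup>2 / 2)\<^sup>2" .
      moreover have "(Re z)\<^sup>2 \<le> 1 - 1 / (real N)\<^sup>2" using nz im2 by linarith
      moreover have "1 / (real N)\<^sup>2 / 2 = 1 / (2 * (real N)\<^sup>2)" by simp
      ultimately show ?thesis unfolding c power2_abs by (metis order_trans)
    qed
    hence "\<bar>node L j\<bar> \<le> 1 - 1 / (2 * (real N)\<^sup>2)"
      by (rule power2_le_imp_le) (use N1 in simp)
    also have "\<dots> \<le> exp (- (1 / (2 * (real N)\<^sup>2)))"
      using exp_ge_add_one_self[of "- (1 / (2 * (real N)\<^sup>2))"] by simp
    finally have "\<bar>node L j\<bar> ^ m \<le> exp (- (1 / (2 * (real N)\<^sup>2))) ^ m" by (intro power_mono) auto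
    also have "\<dots> = exp (- (real m / (2 * (real N)\<^sup>2)))" by (simp add: exp_of_nat_mult[symmetric])
    also have "\<dots> \<le> exp (- 3)"
    proof -
      have "6 * (real N)\<^sup>2 \<le> real m"
        using m unfolding N_def[symmetric] by (metis of_nat_le_iff of_nat_mult of_nat_numeral of_nat_power)
      thus ?thesis using N by (simp add: field_simps)
    qed
    also have "exp (- 3 :: real) \<le> 1 / 8"
    proof -
      have "(2 :: real) ^ 3 \<le> exp 1 ^ 3" using exp_ge_add_one_self[of 1] by (intro power_mono) auto
      also have "\<dots> = exp 3" by (simp add: exp_of_nat_mult[symmetric])
      finally show ?thesis by (simp add: exp_minus field_simps)
    qed
    finally show ?thesis unfolding abs_mult power_abs by (intro mult_left_mono) auto
  qed
  have "node_moment L m = node_weight L 0 * node L 0 ^ m + (\<Sum>j\<in>{..<N} - {0}. node_weight L j * node L j ^ m)"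
    unfolding node_moment_def N_def[symmetric] using N by (subst sum.remove[of _ 0]) auto
  moreover have "\<bar>\<Sum>j\<in>{..<N} - {0}. node_weight L j * node L j ^ m\<bar> \<le> 1 / 8"
  proof -
    have "\<bar>\<Sum>j\<in>{..<N} - {0}. node_weight L j * node L j ^ m\<bar> \<le> (\<Sum>j\<in>{..<N} - {0}. \<bar>node_weight L j * node L j ^ m\<bar>)"
      by (rule sum_abs)
    also have "\<dots> \<le> (\<Sum>j\<in>{..<N} - {0}. \<bar>node_weight L j\<bar> * (1 / 8))" by (intro sum_mono small) auto
    also have "\<dots> \<le> (\<Sum>j<N. \<bar>node_weight L j\<bar> * (1 / 8))" by (intro sum_mono2) auto
    also have "\<dots> = 1 / 8" using sum_abs_node_weight[OF L(1)] by (simp add: sum_divide_distrib[symmetric] N_def)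
    finally show ?thesis .
  qed
  ultimately show ?thesis using w0 by simp
qed


text \<open>The coefficients behave like \<open>\<bar>m\<^bsup>-t-1\<^esup> / \<Gamma>(-t)\<bar>\<close>, and \<open>-t\<close> is no pole of the Gamma function.\<close>
lemma gbinomial_lower_bound:
  fixes t :: real
  assumes t: "t \<notin> \<nat>"
  obtains \<kappa> m1 where "0 < \<kappa>" "\<And>m. m1 \<le> m \<Longrightarrow> \<kappa> * real m powr (- (t + 1)) \<le> \<bar>t gchoose m\<bar>"
proof -
  define f where "f = (\<lambda>n. (t gchoose n) / ((- 1) ^ n / exp ((t + 1) * of_real (ln (real n)))))"
  define \<kappa> where "\<kappa> = \<bar>inverse (Gamma (- t))\<bar> / 2"
  have "- t \<notin> \<int>\<^sub>\<le>\<^sub>0"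
  proof
    assume "- t \<in> \<int>\<^sub>\<le>\<^sub>0"
    then obtain n where n: "- t = of_int n" "n \<le> 0" by (elim nonpos_Ints_cases)
    hence "t = real (nat (- n))" by simp
    thus False using t by (metis of_nat_in_Nats)
  qed
  hence kp: "0 < \<kappa>" by (simp add: \<kappa>_def Gamma_eq_zero_iff)
  have "f \<longlonglongrightarrow> inverse (Gamma (- t))" unfolding f_def by (rule gbinomial_asymptotic)
  hence "(\<lambda>n. \<bar>f n\<bar>) \<longlonglongrightarrow> \<bar>inverse (Gamma (- t))\<bar>" by (rule tendsto_rabs)
  moreover have "\<kappa> < \<bar>inverse (Gamma (- t))\<bar>" using kp by (simp add: \<kappa>_def)
  ultimately have "eventually (\<lambda>n. \<kappa> < \<bar>f n\<bar>) sequentially" by (rule order_tendstoD(1))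
  then obtain m1 where m1: "\<And>n. m1 \<le> n \<Longrightarrow> \<kappa> < \<bar>f n\<bar>" by (auto simp: eventually_sequentially)
  show ?thesis
  proof (rule that[OF kp, of "Suc m1"])
    fix m assume m: "Suc m1 \<le> m"
    have "\<bar>f m\<bar> = \<bar>t gchoose m\<bar> * exp ((t + 1) * ln (real m))"
      by (simp add: f_def abs_mult power_abs)
    hence "\<kappa> \<le> \<bar>t gchoose m\<bar> * exp ((t + 1) * ln (real m))" using m1[of m] m by simp
    hence "\<kappa> * exp (- ((t + 1) * ln (real m))) \<le> \<bar>t gchoose m\<bar> * exp ((t + 1) * ln (real m)) * exp (- ((t + 1) * ln (real m)))"
      by (intro mult_right_mono) auto
    also have "\<dots> = \<bar>t gchoose m\<bar>" by (simp add: mult.assoc exp_add[symmetric])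
    also have "exp (- ((t + 1) * ln (real m))) = real m powr (- (t + 1))"
      using m by (simp add: powr_def algebra_simps)
    finally show "\<kappa> * real m powr (- (t + 1)) \<le> \<bar>t gchoose m\<bar>" .
  qed
qed

text \<open>Consecutive coefficients have the ratio \<open>(t - m) / (m + 1)\<close>, which is negative for \<open>m > t\<close>.\<close>
lemma gbinomial_alternates:
  fixes t :: real
  assumes m0: "t < real m0"
  obtains sg :: real where "\<bar>sg\<bar> = 1" "\<And>m. m0 \<le> m \<Longrightarrow> sg * ((t gchoose m) * (- 1) ^ m) = \<bar>t gchoose m\<bar>"
proof -
  define \<beta> where "\<beta> = (\<lambda>m. (t gchoose m) * (- 1) ^ m)"
  define sg :: real where "sg = (if 0 \<le> \<beta> m0 then 1 else - 1)"
  have rec: "real (Suc m) * \<beta> (Suc m) = (real m - t) * \<beta> m" for m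
  proof -
    have g: "real (Suc m) * (t gchoose Suc m) = (t - real m) * (t gchoose m)"
      using gbinomial_mult_1[of t m] by (simp add: algebra_simps)
    have "real (Suc m) * \<beta> (Suc m) = real (Suc m) * (t gchoose Suc m) * (- 1) ^ Suc m"
      by (simp only: \<beta>_def mult.assoc)
    also have "\<dots> = (real m - t) * \<beta> m" unfolding g by (simp add: \<beta>_def algebra_simps)
    finally show ?thesis .
  qed
  have "0 \<le> sg * \<beta> m" if "m0 \<le> m" for m
    using that
  proof (induction m rule: dec_induct)
    case base
    show ?case by (simp add: sg_def)
  next
    case (step m)
    have "0 \<le> (real m - t) * (sg * \<beta> m)" 
      by (rule mult_nonneg_nonneg) (use step m0 in auto)
    also have "\<dots> = real (Suc m) * (sg * \<beta> (Suc m))" using rec[of m] by (simp only: mult.left_commute)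
    finally have h: "0 \<le> real (Suc m) * (sg * \<beta> (Suc m))" .
    show ?case
    proof (rule ccontr)
      assume "\<not> 0 \<le> sg * \<beta> (Suc m)"
      hence "sg * \<beta> (Suc m) < 0" by simp
      from mult_pos_neg[OF _ this, of "real (Suc m)"] show False using h by simp
    qed
  qed
  moreover have "\<bar>sg * \<beta> m\<bar> = \<bar>t gchoose m\<bar>" for m
    by (simp add: sg_def \<beta>_def abs_mult power_abs)
  ultimately have "sg * ((t gchoose m) * (- 1) ^ m) = \<bar>t gchoose m\<bar>" if "m0 \<le> m" for m
    using that by (metis \<beta>_def abs_of_nonneg)
  moreover have "\<bar>sg\<bar> = 1" by (simp add: sg_def)
  ultimately show ?thesis using that by blast
qed

text \<open>Insert the binomial series of \<open>(1 - \<rho> y)\<^sup>t\<close> at \<open>\<rho> < 1\<close> into the signed measure. Terms below \<open>L\<close> are annihilated, all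
  later ones have the same sign, so finitely many of them bound the sum from below. Then \<open>\<rho>\<close> tends to
  one; this detour is needed because the series is used at the boundary point \<open>y = 1\<close>.\<close>
lemma node_powr_sum_ge:
  assumes t: "0 < t" "t < real m0" and L: "0 < L" "even L" "m0 \<le> L"
    and sg: "\<And>m. m0 \<le> m \<Longrightarrow> sg * ((t gchoose m) * (- 1) ^ m) = \<bar>t gchoose m\<bar>"
    and A: "finite A" "\<And>m. m \<in> A \<Longrightarrow> 6 * (4 * L)\<^sup>2 \<le> m"
  shows "(\<Sum>m\<in>A. \<bar>t gchoose m\<bar>) / 8 \<le> sg * (\<Sum>j<4 * L. node_weight L j * (1 - node L j) powr t)"
proof -
  have node1: "\<bar>node L j\<bar> \<le> 1" for j by (simp add: node_def)
  have A_ge: "m0 \<le> m" if "m \<in> A" for m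
  proof -
    have "L \<le> 6 * (4 * L)\<^sup>2" by (simp add: power2_eq_square)
    thus ?thesis using A(2)[OF that] L(3) by linarith
  qed
  have rho: "(\<Sum>m\<in>A. \<bar>t gchoose m\<bar> * \<rho> ^ m) / 8 \<le> sg * (\<Sum>j<4 * L. node_weight L j * (1 - \<rho> * node L j) powr t)"
    if r: "0 < \<rho>" "\<rho> < 1" for \<rho>
  proof -
    define T where "T = (\<lambda>m. sg * ((t gchoose m) * (- 1) ^ m) * \<rho> ^ m * node_moment L m)"
    have "(\<lambda>m. \<Sum>j<4 * L. node_weight L j * ((t gchoose m) * (- (\<rho> * node L j)) ^ m)) sums
        (\<Sum>j<4 * L. node_weight L j * (1 + - (\<rho> * node L j)) powr t)"
    proof (intro sums_sum sums_mult gen_binomial_real)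
      fix j
      have "\<bar>\<rho> * node L j\<bar> \<le> \<rho> * 1" unfolding abs_mult using r node1 by (intro mult_mono) auto
      thus "\<bar>- (\<rho> * node L j)\<bar> < 1" using r by simp
    qed
    hence "(\<lambda>m. sg * (\<Sum>j<4 * L. node_weight L j * ((t gchoose m) * (- (\<rho> * node L j)) ^ m))) sums
        (sg * (\<Sum>j<4 * L. node_weight L j * (1 - \<rho> * node L j) powr t))"
      using sums_mult by simp
    moreover have "sg * (\<Sum>j<4 * L. node_weight L j * ((t gchoose m) * (- (\<rho> * node L j)) ^ m)) = T m" for m
    proof -
      have "(- (\<rho> * node L j)) ^ m = (- 1) ^ m * (\<rho> ^ m * node L j ^ m)" for j
        using power_mult_distrib[of "- 1" "\<rho> * node L j" m] power_mult_distrib[of \<rho> "node L j" m] by simp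
      thus ?thesis
        unfolding T_def node_moment_def sum_distrib_left by (intro sum.cong refl) (simp only: mult_ac)
    qed
    ultimately have Tsums: "T sums (sg * (\<Sum>j<4 * L. node_weight L j * (1 - \<rho> * node L j) powr t))" by simp
    have Tnn: "0 \<le> T m" for m
    proof (cases "m < L")
      case True
      thus ?thesis using node_moment_eq_0[OF L(1) True] by (simp add: T_def)
    next
      case False
      hence "sg * ((t gchoose m) * (- 1) ^ m) = \<bar>t gchoose m\<bar>" using sg L(3) by simp
      thus ?thesis using node_moment_nonneg[OF L(1), of m] r by (simp add: T_def)
    qed
    have "(\<Sum>m\<in>A. \<bar>t gchoose m\<bar> * \<rho> ^ m) / 8 = (\<Sum>m\<in>A. \<bar>t gchoose m\<bar> * \<rho> ^ m * (1 / 8))"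
      by (simp add: sum_divide_distrib)
    also have "\<dots> \<le> (\<Sum>m\<in>A. T m)"
    proof (rule sum_mono)
      fix m assume m: "m \<in> A"
      have "T m = \<bar>t gchoose m\<bar> * \<rho> ^ m * node_moment L m"
        unfolding T_def sg[OF A_ge[OF m]] ..
      thus "\<bar>t gchoose m\<bar> * \<rho> ^ m * (1 / 8) \<le> T m"
        using node_moment_ge[OF L(1,2) A(2)[OF m]] r by (simp only:) (intro mult_left_mono, auto)
    qed
    also have "\<dots> \<le> suminf T"
      by (rule sum_le_suminf) (use Tsums Tnn A sums_summable in auto)
    also have "suminf T = sg * (\<Sum>j<4 * L. node_weight L j * (1 - \<rho> * node L j) powr t)"
      using Tsums by (rule sums_unique[symmetric])
    finally show ?thesis .
  qed
  define r where "r = (\<lambda>n :: nat. 1 - inverse (real (Suc (Suc n))))"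
  have r: "0 < r n" "r n < 1" for n
  proof -
    have "inverse (real (Suc (Suc n))) < 1" by (rule inverse_less_1_iff[THEN iffD2]) simp
    thus "0 < r n" by (simp add: r_def)
  qed (simp add: r_def)
  have rl: "r \<longlonglongrightarrow> 1"
  proof -
    have "(\<lambda>n. inverse (real (Suc (Suc n)))) \<longlonglongrightarrow> 0"
      using LIMSEQ_Suc[OF LIMSEQ_inverse_real_of_nat] by simp
    from tendsto_diff[OF tendsto_const[of 1] this] show ?thesis by (simp add: r_def)
  qed
  have "(\<lambda>n. (\<Sum>m\<in>A. \<bar>t gchoose m\<bar> * r n ^ m) / 8) \<longlonglongrightarrow> (\<Sum>m\<in>A. \<bar>t gchoose m\<bar> * 1 ^ m) / 8"
    by (intro tendsto_intros rl) auto
  moreover have "(\<lambda>n. sg * (\<Sum>j<4 * L. node_weight L j * (1 - r n * node L j) powr t))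
      \<longlonglongrightarrow> sg * (\<Sum>j<4 * L. node_weight L j * (1 - 1 * node L j) powr t)"
  proof (intro tendsto_mult tendsto_sum tendsto_const tendsto_powr' tendsto_diff rl)
    fix j
    have "0 \<le> 1 - r n * node L j" for n
    proof -
      have "\<bar>r n * node L j\<bar> \<le> 1 * 1" unfolding abs_mult using r[of n] node1 by (intro mult_mono) auto
      thus ?thesis by linarith
    qed
    thus "1 - 1 * node L j \<noteq> 0 \<or> 0 < t \<and> (\<forall>\<^sub>F n in sequentially. 0 \<le> 1 - r n * node L j)"
      using t by auto
  qed
  ultimately have "(\<Sum>m\<in>A. \<bar>t gchoose m\<bar> * 1 ^ m) / 8 \<le> sg * (\<Sum>j<4 * L. node_weight L j * (1 - 1 * node L j) powr t)"
    by (rule LIMSEQ_le) (use rho r in auto)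
  thus ?thesis by simp
qed

lemma node_weight_annihilates:
  assumes "0 < L" "l < L"
  shows "(\<Sum>j<4 * L. node_weight L j * ((1 - node L j) / 2) ^ l) = 0"
proof -
  have "((1 - node L j) / 2) ^ l = (\<Sum>i\<le>l. real (l choose i) * (- 1) ^ i / 2 ^ l * node L j ^ i)" for j
  proof -
    have "(- node L j + 1) ^ l = (\<Sum>i\<le>l. real (l choose i) * (- node L j) ^ i * 1 ^ (l - i))" by (rule binomial_ring)
    also have "\<dots> = (\<Sum>i\<le>l. real (l choose i) * (- 1) ^ i * node L j ^ i)"
      by (intro sum.cong refl) (simp add: power_minus[of "node L j"])
    finally show ?thesis by (simp add: power_divide sum_divide_distrib)
  qed
  hence "(\<Sum>j<4 * L. node_weight L j * ((1 - node L j) / 2) ^ l)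
      = (\<Sum>j<4 * L. \<Sum>i\<le>l. real (l choose i) * (- 1) ^ i / 2 ^ l * (node_weight L j * node L j ^ i))"
    by (simp only: sum_distrib_left mult_ac)
  also have "\<dots> = (\<Sum>i\<le>l. real (l choose i) * (- 1) ^ i / 2 ^ l * node_moment L i)"
    unfolding node_moment_def sum_distrib_left by (rule sum.swap)
  also have "\<dots> = 0" using assms by (intro sum.neutral ballI) (simp add: node_moment_eq_0)
  finally show ?thesis .
qed

text \<open>The label \<open>j\<close> stands for \<open>x\<^sub>j = ((1 - y\<^sub>j) / 2)\<^bsup>1/2\<^esup>\<close> with the node \<open>y\<^sub>j\<close>. Then \<open>x\<^bsup>2l\<^esup>\<close> is a polynomial of degree \<open>l\<close> in the
  node, while \<open>x\<^sup>s\<close> is a multiple of \<open>(1 - y)\<^bsup>s/2\<^esup>\<close>. The priors are twice the positive and the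
  negative part of the signed measure, exchanged if this is what makes the difference positive.\<close>
lemma moment_matched_priors_exist:
  fixes s :: real
  assumes s: "0 < s" and ne: "\<nexists>k :: nat. even k \<and> s = real k"
  obtains c L0 where "0 < c" "\<And>L. L0 \<le> L \<Longrightarrow> even L \<Longrightarrow> 0 < L \<Longrightarrow>
     \<exists>x \<nu>0 \<nu>1. matched_priors {..<4 * L} x \<nu>0 \<nu>1 L
       \<and> c * real L powr (- s) \<le> (\<Sum>j<4 * L. (\<nu>1 j - \<nu>0 j) * x j powr s)"
proof -
  define t where "t = s / 2"
  have t: "0 < t" using s by (simp add: t_def)
  have tn: "t \<notin> \<nat>"
  proof
    assume "t \<in> \<nat>"
    then obtain n where "t = real n" by (elim Nats_cases)
    hence "even (2 * n) \<and> s = real (2 * n)" by (simp add: t_def)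
    thus False using ne by blast
  qed
  obtain m0 where m0: "t < real m0" using reals_Archimedean2 by blast
  obtain sg :: real where sg: "\<bar>sg\<bar> = 1" "\<And>m. m0 \<le> m \<Longrightarrow> sg * ((t gchoose m) * (- 1) ^ m) = \<bar>t gchoose m\<bar>"
    using gbinomial_alternates[OF m0] by metis
  obtain \<kappa> m1 where kap: "0 < \<kappa>" "\<And>m. m1 \<le> m \<Longrightarrow> \<kappa> * real m powr (- (t + 1)) \<le> \<bar>t gchoose m\<bar>"
    using gbinomial_lower_bound[OF tn] by metis
  define c where "c = \<kappa> * 192 powr (- t) / 16 * 2 powr (- t) * 2"
  have c: "0 < c" using kap by (simp add: c_def)
  have "\<exists>x \<nu>0 \<nu>1. matched_priors {..<4 * L} x \<nu>0 \<nu>1 L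
       \<and> c * real L powr (- s) \<le> (\<Sum>j<4 * L. (\<nu>1 j - \<nu>0 j) * x j powr s)"
    if L: "max m0 m1 \<le> L" "even L" "0 < L" for L
  proof -
    define w where "w = node_weight L"
    define x where "x = (\<lambda>j. sqrt ((1 - node L j) / 2))"
    define \<nu>0 where "\<nu>0 = (\<lambda>j. \<bar>w j\<bar> - sg * w j)"
    define \<nu>1 where "\<nu>1 = (\<lambda>j. \<bar>w j\<bar> + sg * w j)"
    have node1: "node L j \<le> 1" "-1 \<le> node L j" for j by (simp_all add: node_def)
    have diff: "\<nu>1 j - \<nu>0 j = 2 * sg * w j" for j by (simp add: \<nu>0_def \<nu>1_def)
    have absw: "\<bar>sg * w j\<bar> = \<bar>w j\<bar>" for j using sg(1) by (simp add: abs_mult)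
    have sumabs: "(\<Sum>j<4 * L. \<bar>w j\<bar>) = 1" unfolding w_def by (rule sum_abs_node_weight[OF L(3)])
    have ann: "(\<Sum>j<4 * L. w j * ((1 - node L j) / 2) ^ l) = 0" if "l < L" for l
      unfolding w_def by (rule node_weight_annihilates[OF L(3) that])
    have sumw: "(\<Sum>j<4 * L. w j) = 0" using ann[of 0] L by simp
    have mp: "matched_priors {..<4 * L} x \<nu>0 \<nu>1 L"
    proof
      fix j :: nat assume "j \<in> {..<4 * L}"
      show "0 \<le> x j" "x j \<le> 1" using node1[of j] by (auto simp: x_def)
      show "0 \<le> \<nu>0 j" "0 \<le> \<nu>1 j"
        unfolding \<nu>0_def \<nu>1_def
        using absw[of j] abs_ge_self[of "sg * w j"] abs_ge_minus_self[of "sg * w j"] by linarith+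
    next
      show "sum \<nu>0 {..<4 * L} = 1" "sum \<nu>1 {..<4 * L} = 1"
        unfolding \<nu>0_def \<nu>1_def sum.distrib sum_subtractf sum_distrib_left[symmetric] sumabs sumw by simp_all
    next
      fix l assume l: "l < L"
      have "x j ^ (2 * l) = ((1 - node L j) / 2) ^ l" for j
      proof -
        have "(x j)\<^sup>2 = (1 - node L j) / 2" unfolding x_def using node1[of j] by (intro real_sqrt_pow2) simp
        thus ?thesis by (simp only: power_mult)
      qed
      hence "(\<Sum>j<4 * L. (\<nu>1 j - \<nu>0 j) * x j ^ (2 * l)) = 2 * sg * (\<Sum>j<4 * L. w j * ((1 - node L j) / 2) ^ l)"
        unfolding sum_distrib_left diff by (simp only: mult.assoc)
      thus "(\<Sum>j<4 * L. (\<nu>1 j - \<nu>0 j) * x j ^ (2 * l)) = 0" by (simp only: ann[OF l] mult_zero_right)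
    qed (use L in auto)
    \<comment> \<open>The terms from \<open>6K\<close> to \<open>12K\<close> number more than \<open>6K\<close>, and each is of order \<open>K\<^bsup>-t-1\<^esup>\<close>.\<close>
    define K where "K = (4 * L)\<^sup>2"
    have K: "0 < K" "real K = 16 * (real L)\<^sup>2" using L by (simp_all add: K_def power_mult_distrib)
    have "2 powr (- t) * (\<kappa> * 192 powr (- t) * real L powr (- s) / 16) \<le> 2 powr (- t) * ((\<Sum>m\<in>{6 * K..12 * K}. \<bar>t gchoose m\<bar>) / 8)"
    proof (rule mult_left_mono)
      have Kpow: "real (12 * K) powr (- t) = 192 powr (- t) * real L powr (- s)"
      proof -
        have "real (12 * K) = 192 * (real L powr 2)" using K L by simp
        hence "real (12 * K) powr (- t) = 192 powr (- t) * (real L powr 2) powr (- t)"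
          by (simp only: powr_mult[of 192 "real L powr 2" "- t"])
        also have "(real L powr 2) powr (- t) = real L powr (- s)"
          by (simp only: powr_powr) (simp add: t_def)
        finally show ?thesis .
      qed
      have "\<kappa> * 192 powr (- t) * real L powr (- s) / 2 = 6 * real K * (\<kappa> * (real (12 * K) powr (- t) / real (12 * K)))"
        using K(1) unfolding Kpow by (simp add: field_simps)
      also have "real (12 * K) powr (- t) / real (12 * K) = real (12 * K) powr (- (t + 1))"
        using K(1) powr_diff[of "real (12 * K)" "- t" 1] by simp
      also have "6 * real K * (\<kappa> * real (12 * K) powr (- (t + 1))) \<le> real (card {6 * K..12 * K}) * (\<kappa> * real (12 * K) powr (- (t + 1)))"
        using kap by (intro mult_right_mono) auto
      also have "\<dots> = (\<Sum>m\<in>{6 * K..12 * K}. \<kappa> * real (12 * K) powr (- (t + 1)))" by simp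
      also have "\<dots> \<le> (\<Sum>m\<in>{6 * K..12 * K}. \<bar>t gchoose m\<bar>)"
      proof (rule sum_mono)
        fix m assume m: "m \<in> {6 * K..12 * K}"
        have "L \<le> K" by (simp add: K_def power2_eq_square)
        hence "m1 \<le> m" using m L(1) by simp
        have "\<kappa> * real (12 * K) powr (- (t + 1)) \<le> \<kappa> * real m powr (- (t + 1))"
          using m K kap t by (intro mult_left_mono powr_mono2') auto
        also have "\<dots> \<le> \<bar>t gchoose m\<bar>" by (rule kap(2)[OF \<open>m1 \<le> m\<close>])
        finally show "\<kappa> * real (12 * K) powr (- (t + 1)) \<le> \<bar>t gchoose m\<bar>" .
      qed
      finally show "\<kappa> * 192 powr (- t) * real L powr (- s) / 16 \<le> (\<Sum>m\<in>{6 * K..12 * K}. \<bar>t gchoose m\<bar>) / 8"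
        by linarith
    qed simp
    also have "\<dots> \<le> 2 powr (- t) * (sg * (\<Sum>j<4 * L. w j * (1 - node L j) powr t))"
      unfolding w_def
      by (intro mult_left_mono node_powr_sum_ge[OF t m0 L(3,2) _ sg(2)]) (use L in \<open>auto simp: K_def\<close>)
    also have "\<dots> = sg * (\<Sum>j<4 * L. w j * x j powr s)"
    proof -
      have "x j powr s = 2 powr (- t) * (1 - node L j) powr t" for j
      proof -
        have "x j powr s = (((1 - node L j) / 2) powr (1 / 2)) powr s"
          unfolding x_def using node1[of j] by (subst powr_half_sqrt) auto
        also have "\<dots> = ((1 - node L j) / 2) powr t" by (simp only: powr_powr t_def) simp
        also have "\<dots> = 2 powr (- t) * (1 - node L j) powr t"
          using node1[of j] by (simp add: powr_divide powr_minus field_simps)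
        finally show ?thesis .
      qed
      thus ?thesis unfolding sum_distrib_left by (simp only: mult_ac)
    qed
    finally have main: "2 * (2 powr (- t) * (\<kappa> * 192 powr (- t) * real L powr (- s) / 16)) \<le> 2 * (sg * (\<Sum>j<4 * L. w j * x j powr s))"
      by (intro mult_left_mono) auto
    have "(\<Sum>j<4 * L. (\<nu>1 j - \<nu>0 j) * x j powr s) = 2 * (sg * (\<Sum>j<4 * L. w j * x j powr s))"
      unfolding diff sum_distrib_left by (simp only: mult.assoc)
    hence "c * real L powr (- s) \<le> (\<Sum>j<4 * L. (\<nu>1 j - \<nu>0 j) * x j powr s)"
      using main by (simp add: c_def mult_ac)
    thus ?thesis using mp by blast
  qed
  thus ?thesis using that[OF c, of "max m0 m1"] by blast
qed

section \<open>From hidden priors to a lower bound on the risk\<close>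

text \<open>The sum of \<open>r\<close> independent variables in \<open>[0, 1]\<close> has variance at most \<open>r\<close>, and the mean absolute
  deviation is at most the standard deviation.\<close>
lemma (in matched_priors) prior_mean_deviation:
  fixes f :: "'a \<Rightarrow> real"
  assumes f: "\<And>b. b \<in> S \<Longrightarrow> 0 \<le> f b" "\<And>b. b \<in> S \<Longrightarrow> f b \<le> 1"
    and pr: "\<And>i. i < r \<Longrightarrow> prior j i = \<nu>"
  shows "(\<Sum>a\<in>labels r. (\<Prod>i<r. prior j i (a i)) * \<bar>(\<Sum>k<r. f (a k)) - real r * (\<Sum>b\<in>S. \<nu> b * f b)\<bar>) \<le> sqrt (real r)"
proof (cases "r = 0")
  case True
  thus ?thesis by simp
next
  case False
  have \<nu>: "\<nu> = prior j 0" using pr[of 0] False by simp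
  have \<nu>nn: "0 \<le> \<nu> b" if "b \<in> S" for b unfolding \<nu> by (rule prior_nonneg[OF that])
  have \<nu>sum: "sum \<nu> S = 1" unfolding \<nu> by (rule prior_sum)
  define \<mu> where "\<mu> = (\<Sum>b\<in>S. \<nu> b * f b)"
  define g where "g = (\<lambda>b. f b - \<mu>)"
  define P where "P = (\<lambda>a. \<Prod>i<r. \<nu> (a i))"
  define Z where "Z = (\<lambda>a. \<Sum>k<r. g (a k))"
  have Peq: "(\<Prod>i<r. prior j i (a i)) = P a" for a unfolding P_def by (intro prod.cong refl) (simp add: pr)
  have Pnn: "0 \<le> P a" if "a \<in> labels r" for a
    unfolding Peq[symmetric] by (rule prior_prod_nonneg[OF that])
  have Psum: "(\<Sum>a\<in>labels r. P a) = 1"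
    unfolding Peq[symmetric] by (rule prior_prod_sum) simp
  have mu01: "0 \<le> \<mu>" "\<mu> \<le> 1"
  proof -
    show "0 \<le> \<mu>" unfolding \<mu>_def by (intro sum_nonneg mult_nonneg_nonneg \<nu>nn f)
    have "\<mu> \<le> (\<Sum>b\<in>S. \<nu> b * 1)" unfolding \<mu>_def by (intro sum_mono mult_left_mono \<nu>nn f)
    thus "\<mu> \<le> 1" by (simp add: \<nu>sum)
  qed
  have g1: "\<bar>g b\<bar> \<le> 1" if "b \<in> S" for b using f[OF that] mu01 by (simp add: g_def abs_le_iff)
  have g0: "(\<Sum>b\<in>S. \<nu> b * g b) = 0"
    by (simp add: g_def right_diff_distrib sum_subtractf sum_distrib_right[symmetric] \<nu>sum \<mu>_def[symmetric])
  have cross: "(\<Sum>a\<in>labels r. P a * (g (a k) * g (a l))) \<le> of_bool (k = l)" if kl: "k < r" "l < r" for k l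
  proof (cases "k = l")
    case True
    have "(\<Sum>a\<in>labels r. P a * (g (a k) * g (a l))) \<le> (\<Sum>a\<in>labels r. P a * 1)"
    proof (intro sum_mono mult_left_mono Pnn)
      fix a assume "a \<in> labels r"
      hence "\<bar>g (a k)\<bar> \<le> 1" using kl by (intro g1) auto
      hence "\<bar>g (a k)\<bar> * \<bar>g (a k)\<bar> \<le> 1 * 1" by (intro mult_mono) auto
      thus "g (a k) * g (a l) \<le> 1" by (simp add: True)
    qed
    thus ?thesis using True by (simp add: Psum)
  next
    case False
    define h where "h = (\<lambda>i b. \<nu> b * (if i = k \<or> i = l then g b else 1))"
    have "P a * (g (a k) * g (a l)) = (\<Prod>i<r. h i (a i))" for a
    proof -
      have "(\<Prod>i<r. if i = k \<or> i = l then g (a i) else 1) = (\<Prod>i\<in>{k, l}. g (a i))"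
        using kl by (intro prod.mono_neutral_cong_right) auto
      thus ?thesis using False by (simp add: h_def prod.distrib P_def)
    qed
    hence "(\<Sum>a\<in>labels r. P a * (g (a k) * g (a l))) = (\<Prod>i<r. \<Sum>b\<in>S. h i b)"
      using finite_S by (subst prod_sum_PiE) auto
    also have "\<dots> = 0"
      by (rule prod_zero) (use kl g0 in \<open>auto simp: h_def intro!: bexI[of _ k]\<close>)
    finally show ?thesis by simp
  qed
  have var: "(\<Sum>a\<in>labels r. P a * (Z a)\<^sup>2) \<le> real r"
  proof -
    have "(\<Sum>a\<in>labels r. P a * (Z a)\<^sup>2) = (\<Sum>a\<in>labels r. \<Sum>k<r. \<Sum>l<r. P a * (g (a k) * g (a l)))"
      unfolding Z_def power2_eq_square sum_product unfolding sum_distrib_left ..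
    also have "\<dots> = (\<Sum>k<r. \<Sum>a\<in>labels r. \<Sum>l<r. P a * (g (a k) * g (a l)))" by (rule sum.swap)
    also have "\<dots> = (\<Sum>k<r. \<Sum>l<r. \<Sum>a\<in>labels r. P a * (g (a k) * g (a l)))"
      by (intro sum.cong refl sum.swap)
    also have "\<dots> \<le> (\<Sum>k<r. \<Sum>l<r. of_bool (k = l))" by (intro sum_mono cross) auto
    also have "\<dots> = (\<Sum>k<r. \<Sum>l<r. if k = l then 1 else 0)" by (intro sum.cong refl) auto
    also have "\<dots> = (\<Sum>k<r. 1)" by (intro sum.cong refl) (simp add: sum.delta)
    finally show ?thesis by simp
  qed
  have "(\<Sum>a\<in>labels r. P a * \<bar>Z a\<bar>)\<^sup>2 \<le> (\<Sum>a\<in>labels r. P a * (Z a)\<^sup>2)"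
  proof -
    define m where "m = (\<Sum>a\<in>labels r. P a * \<bar>Z a\<bar>)"
    have "0 \<le> (\<Sum>a\<in>labels r. P a * (\<bar>Z a\<bar> - m)\<^sup>2)" by (intro sum_nonneg mult_nonneg_nonneg Pnn) auto
    also have "\<dots> = (\<Sum>a\<in>labels r. P a * (Z a)\<^sup>2 - 2 * m * (P a * \<bar>Z a\<bar>) + m\<^sup>2 * P a)"
      by (intro sum.cong refl) (simp add: power2_diff algebra_simps)
    also have "\<dots> = (\<Sum>a\<in>labels r. P a * (Z a)\<^sup>2) - 2 * m * m + m\<^sup>2 * 1"
      unfolding sum.distrib sum_subtractf sum_distrib_left[symmetric] Psum m_def[symmetric] ..
    finally show ?thesis by (simp add: m_def[symmetric] power2_eq_square)
  qed
  hence "(\<Sum>a\<in>labels r. P a * \<bar>Z a\<bar>) \<le> sqrt (real r)"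
    using var by (intro real_le_rsqrt) linarith
  moreover have "(\<Sum>k<r. f (a k)) - real r * \<mu> = Z a" for a by (simp add: Z_def g_def sum_subtractf)
  ultimately show ?thesis by (simp add: Peq \<mu>_def)
qed

lemma gaussian_entries_eq: "gaussian_entries p q = gauss ({..<p} \<times> {..<q})"
  by (simp add: gaussian_entries_def gauss_def)

lemma mat_gauss_shift:
  "Matrix.mat p q (gauss_shift ({..<p} \<times> {..<q}) B E) = Matrix.mat p q B + Matrix.mat p q E"
  by (rule eq_matI) (auto simp: gauss_shift_def)

lemma estimator_shift_measurable:
  assumes "T \<in> estimators p q"
  shows "(\<lambda>E. T (Matrix.mat p q B + Matrix.mat p q E)) \<in> borel_measurable (gauss ({..<p} \<times> {..<q}))"
proof -
  have "(\<lambda>E. T (Matrix.mat p q (gauss_shift ({..<p} \<times> {..<q}) B E))) \<in> borel_measurable (gauss ({..<p} \<times> {..<q}))"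
    by (rule measurable_compose[OF gauss_shift_measurable]) (use assms in \<open>simp add: estimators_def\<close>)
  thus ?thesis by (simp only: mat_gauss_shift)
qed

text \<open>A test that can only be wrong when the estimator is far from \<open>m\<close> has an error probability
  controlled by the risk.\<close>
lemma gauss_mean_le_risk:
  fixes p q :: nat and B :: "nat \<times> nat \<Rightarrow> real"
  defines "A \<equiv> Matrix.mat p q B"
  assumes T: "T \<in> estimators p q" and \<Delta>: "0 < \<Delta>" and R: "0 \<le> R"
    and risk: "risk p q \<phi> T A \<le> ennreal R"
    and \<xi>: "\<xi> \<in> borel_measurable (\<Pi>\<^sub>M i\<in>{..<p} \<times> {..<q}. borel)" "\<And>y. 0 \<le> \<xi> y" "\<And>y. \<xi> y \<le> 1"
    and far: "\<And>y. \<xi> y * \<Delta> \<le> \<bar>T (Matrix.mat p q y) - m\<bar>"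
  shows "gauss_mean ({..<p} \<times> {..<q}) \<xi> B * \<Delta> \<le> R + \<bar>\<phi> A - m\<bar>"
proof -
  define I where "I = {..<p} \<times> {..<q}"
  interpret G: prob_space "gauss I" by (rule prob_space_gauss)
  have shift: "Matrix.mat p q (gauss_shift I B E) = A + Matrix.mat p q E" for E
    unfolding A_def I_def by (rule mat_gauss_shift)
  have meas: "(\<lambda>E. T (A + Matrix.mat p q E)) \<in> borel_measurable (gauss I)"
    unfolding A_def I_def by (rule estimator_shift_measurable[OF T])
  have \<xi>m: "(\<lambda>E. \<xi> (gauss_shift I B E)) \<in> borel_measurable (gauss I)"
    by (rule measurable_compose[OF gauss_shift_measurable]) (use \<xi>(1) in \<open>simp add: I_def\<close>)
  have int: "integrable (gauss I) (\<lambda>E. \<xi> (gauss_shift I B E))"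
    by (rule G.integrable_const_bound[where B = 1]) (use \<xi> \<xi>m in auto)
  have "ennreal (gauss_mean I \<xi> B * \<Delta>) = ennreal (\<integral>E. \<xi> (gauss_shift I B E) * \<Delta> \<partial>gauss I)"
    by (simp add: gauss_mean_def)
  also have "\<dots> = (\<integral>\<^sup>+E. ennreal (\<xi> (gauss_shift I B E) * \<Delta>) \<partial>gauss I)"
    by (rule nn_integral_eq_integral[symmetric]) (use int \<xi> \<Delta> in auto)
  also have "\<dots> \<le> (\<integral>\<^sup>+E. ennreal \<bar>T (A + Matrix.mat p q E) - \<phi> A\<bar> + ennreal \<bar>\<phi> A - m\<bar> \<partial>gauss I)"
  proof (rule nn_integral_mono)
    fix E
    have "\<xi> (gauss_shift I B E) * \<Delta> \<le> \<bar>T (A + Matrix.mat p q E) - \<phi> A\<bar> + \<bar>\<phi> A - m\<bar>"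
      using far[of "gauss_shift I B E"] unfolding shift by linarith
    from ennreal_leI[OF this]
    show "ennreal (\<xi> (gauss_shift I B E) * \<Delta>) \<le> ennreal \<bar>T (A + Matrix.mat p q E) - \<phi> A\<bar> + ennreal \<bar>\<phi> A - m\<bar>"
      by (simp only: ennreal_plus[OF abs_ge_zero abs_ge_zero])
  qed
  also have "\<dots> = risk p q \<phi> T A + ennreal \<bar>\<phi> A - m\<bar>"
    unfolding risk_def gaussian_entries_eq I_def[symmetric] using meas
    by (subst nn_integral_add) (auto simp: G.emeasure_space_1)
  also have "\<dots> \<le> ennreal R + ennreal \<bar>\<phi> A - m\<bar>" by (intro add_right_mono risk)
  also have "\<dots> = ennreal (R + \<bar>\<phi> A - m\<bar>)" using R by (simp add: ennreal_plus)
  finally show ?thesis using R unfolding I_def by (subst (asm) ennreal_le_iff) auto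
qed

abbreviation (input) sv_bound :: "nat \<Rightarrow> nat \<Rightarrow> real" where
  "sv_bound p q \<equiv> 0.125 * (real p * real q) powr (1 / 4)"

text \<open>Only matrices with Schatten power in \<open>[0, q M\<^sup>s]\<close> are considered: on them clipping an estimator of
  the norm to \<open>[0, (q M\<^sup>s)\<^bsup>1/s\<^esup>]\<close> loses nothing.\<close>
definition power_risk_le :: "nat \<Rightarrow> nat \<Rightarrow> real \<Rightarrow> (real mat \<Rightarrow> real) \<Rightarrow> real \<Rightarrow> bool" where
  "power_risk_le p q s T R \<longleftrightarrow> T \<in> estimators p q \<and> 0 \<le> R \<and>
     (\<forall>A\<in>carrier_mat p q. spectral_norm A \<le> sv_bound p q \<longrightarrow>
        0 \<le> schatten_power s A \<longrightarrow> schatten_power s A \<le> real q * sv_bound p q powr s \<longrightarrow>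
        risk p q (schatten_power s) T A \<le> ennreal R)"

text \<open>An estimator yields the test \<open>\<psi>\<close> that interpolates linearly between the two means \<open>m0\<close> and \<open>m1\<close>. On
  average its error probability under either prior is at most \<open>(R + M\<^sup>s V) / (m1 - m0)\<close>, whereas for suitable frames its means
  under the two priors differ by at most three quarters.\<close>
lemma (in matched_priors) risk_lower_bound:
  assumes q: "q \<le> p" and r: "0 < r" "2 * r \<le> Suc q" and s: "0 < s"
    and M_def: "M = sv_bound p q" and le: "power_risk_le p q s T R"
    and hidden: "real r * (17 / 4 * (1 / 10) ^ L) \<le> 1 / 2"
    and gap: "0 < \<kappa>" "\<kappa> \<le> (\<Sum>b\<in>S. (\<nu>1 b - \<nu>0 b) * x b powr s)"
    and dev: "\<And>j \<nu>. (j, \<nu>) \<in> {(0, \<nu>0), (r, \<nu>1)} \<Longrightarrow>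
      (\<Sum>a\<in>labels r. (\<Prod>i<r. prior j i (a i)) * \<bar>(\<Sum>k<r. x (a k) powr s) - real r * (\<Sum>b\<in>S. \<nu> b * x b powr s)\<bar>) \<le> V"
  shows "M powr s * (real r * \<kappa> / 8 - V) \<le> R"
proof -
  have T: "T \<in> estimators p q" and R: "0 \<le> R" using le by (auto simp: power_risk_le_def)
  have rq: "r \<le> q" "r \<le> p" "0 < q" "0 < p" using q r by linarith+
  have pq: "0 < real p * real q" using rq by simp
  have M: "0 < M" using rq by (simp add: M_def)
  define I where "I = {..<p} \<times> {..<q}"
  define Ms where "Ms = M powr s"
  have Ms: "0 < Ms" using M by (simp add: Ms_def)
  define \<mu>0 where "\<mu>0 = (\<Sum>b\<in>S. \<nu>0 b * x b powr s)"
  define \<mu>1 where "\<mu>1 = (\<Sum>b\<in>S. \<nu>1 b * x b powr s)"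
  have gap': "\<kappa> \<le> \<mu>1 - \<mu>0"
    using gap(2) by (simp add: \<mu>0_def \<mu>1_def left_diff_distrib sum_subtractf)
  define m0 where "m0 = Ms * (real r * \<mu>0)"
  define m1 where "m1 = Ms * (real r * \<mu>1)"
  define \<Delta> where "\<Delta> = m1 - m0"
  have \<Delta>eq: "\<Delta> = Ms * (real r * (\<mu>1 - \<mu>0))" by (simp add: \<Delta>_def m0_def m1_def algebra_simps)
  have \<Delta>ge: "Ms * (real r * \<kappa>) \<le> \<Delta>"
    unfolding \<Delta>eq using Ms gap' by (intro mult_left_mono) auto
  have "0 < Ms * (real r * \<kappa>)" using Ms r gap by simp
  hence \<Delta>: "0 < \<Delta>" using \<Delta>ge by linarith
  define \<psi> where "\<psi> = (\<lambda>y. max 0 (min 1 ((T (Matrix.mat p q y) - m0) / \<Delta>)))"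
  have Tm: "(\<lambda>y. T (Matrix.mat p q y)) \<in> borel_measurable (\<Pi>\<^sub>M i\<in>I. borel)"
    using T by (simp add: estimators_def I_def)
  have \<psi>m: "\<psi> \<in> borel_measurable (\<Pi>\<^sub>M i\<in>I. borel)" unfolding \<psi>_def using Tm by measurable
  have \<psi>01: "0 \<le> \<psi> y" "\<psi> y \<le> 1" for y by (auto simp: \<psi>_def)
  have far0: "\<psi> y * \<Delta> \<le> \<bar>T (Matrix.mat p q y) - m0\<bar>" for y
  proof -
    have "\<psi> y \<le> \<bar>T (Matrix.mat p q y) - m0\<bar> / \<Delta>"
      using \<Delta> by (auto simp: \<psi>_def min_def max_def divide_right_mono intro: order_trans)
    thus ?thesis using \<Delta> by (simp add: field_simps)
  qed
  have far1: "(1 - \<psi> y) * \<Delta> \<le> \<bar>T (Matrix.mat p q y) - m1\<bar>" for y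
  proof -
    have "1 - \<bar>T (Matrix.mat p q y) - m1\<bar> / \<Delta> \<le> (T (Matrix.mat p q y) - m0) / \<Delta>"
    proof -
      have "\<Delta> - \<bar>T (Matrix.mat p q y) - m1\<bar> \<le> T (Matrix.mat p q y) - m0"
        unfolding \<Delta>_def by linarith
      hence "(\<Delta> - \<bar>T (Matrix.mat p q y) - m1\<bar>) / \<Delta> \<le> (T (Matrix.mat p q y) - m0) / \<Delta>"
        using \<Delta> by (intro divide_right_mono) auto
      thus ?thesis using \<Delta> by (simp add: diff_divide_distrib)
    qed
    hence "1 - \<bar>T (Matrix.mat p q y) - m1\<bar> / \<Delta> \<le> \<psi> y"
      using \<Delta> divide_nonneg_pos[OF abs_ge_zero \<Delta>, of "T (Matrix.mat p q y) - m1"]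
      unfolding \<psi>_def by linarith
    hence "1 - \<psi> y \<le> \<bar>T (Matrix.mat p q y) - m1\<bar> / \<Delta>" by linarith
    thus ?thesis using \<Delta> by (simp add: field_simps)
  qed
  have M2: "10 * exp 1 * M\<^sup>2 \<le> sqrt (real (Suc (p - r)) * real (Suc (q - r)))"
  proof -
    have "((real p * real q) powr (1 / 4))\<^sup>2 = sqrt (real p * real q)"
    proof -
      have "(y powr (1 / 4))\<^sup>2 = y powr (1 / 2)" for y :: real
        by (simp add: power2_eq_square flip: powr_add)
      thus ?thesis using pq by (simp only: powr_half_sqrt less_imp_le)
    qed
    hence "10 * exp 1 * M\<^sup>2 = 10 * exp 1 / 64 * sqrt (real p * real q)"
      by (simp add: M_def power_mult_distrib power_divide)
    \<comment> \<open>Here the factor \<open>0.125\<close> enters: its square is \<open>1/64\<close>, and \<open>10 e < 32\<close>.\<close>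
    also have "\<dots> \<le> 1 / 2 * sqrt (real p * real q)"
      using exp_le by (intro mult_right_mono) auto
    also have "\<dots> = sqrt ((real p / 2) * (real q / 2))"
    proof -
      have "sqrt ((real p / 2) * (real q / 2)) = sqrt ((1 / 2)\<^sup>2 * (real p * real q))"
        by (rule arg_cong[of _ _ sqrt]) (simp add: power2_eq_square)
      also have "\<dots> = 1 / 2 * sqrt (real p * real q)" by (simp only: real_sqrt_mult real_sqrt_abs)
      finally show ?thesis ..
    qed
    also have "\<dots> \<le> sqrt (real (Suc (p - r)) * real (Suc (q - r)))"
    proof (intro real_sqrt_le_mono mult_mono)
      show "real q / 2 \<le> real (Suc (q - r))" "real p / 2 \<le> real (Suc (p - r))"
        using r q rq by (simp_all add: of_nat_diff)
    qed auto
    finally show ?thesis .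
  qed
  obtain u v where uv: "frame p u" "frame q v"
    and close: "hybrid_mean p q r M \<psi> r u v - hybrid_mean p q r M \<psi> 0 u v \<le> real r * (17 / 4 * (1 / 10) ^ L) + 1 / 4"
    using exists_indistinguishing_frames[OF r(1) rq(2,1) less_imp_le[OF M] M2 \<psi>m[unfolded I_def] \<psi>01, of "1 / 4"]
    by auto
  define B where "B = (\<lambda>a. spikes r (\<lambda>k. M * x (a k)) u v)"
  define A where "A = (\<lambda>a. Matrix.mat p q (B a))"
  define \<phi> where "\<phi> = (\<lambda>a. \<Sum>k<r. x (a k) powr s)"
  define gm where "gm = (\<lambda>a. gauss_mean I \<psi> (B a))"
  have xa: "0 \<le> x (a k)" "x (a k) \<le> 1" if "a \<in> labels r" "k < r" for a k
    using x_bounds[of "a k"] that by (auto simp: PiE_iff)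
  have power: "schatten_power s (A a) = Ms * \<phi> a" if a: "a \<in> labels r" for a
  proof -
    have "schatten_power s (A a) = (\<Sum>k<r. \<bar>M * x (a k)\<bar> powr s)"
      unfolding A_def B_def by (rule schatten_power_spikes[OF uv rq(2,1)])
    also have "\<dots> = (\<Sum>k<r. Ms * x (a k) powr s)"
    proof (intro sum.cong refl)
      fix k assume "k \<in> {..<r}"
      hence "0 \<le> x (a k)" using xa[OF a] by simp
      thus "\<bar>M * x (a k)\<bar> powr s = Ms * x (a k) powr s"
        using M by (simp add: Ms_def powr_mult)
    qed
    finally show ?thesis by (simp add: \<phi>_def sum_distrib_left)
  qed
  have phi_bd: "0 \<le> \<phi> a" "\<phi> a \<le> real q" if a: "a \<in> labels r" for a
  proof -
    show "0 \<le> \<phi> a" unfolding \<phi>_def by (intro sum_nonneg) simp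
    have "\<phi> a \<le> (\<Sum>k<r. 1)" unfolding \<phi>_def
    proof (rule sum_mono)
      fix k assume "k \<in> {..<r}"
      thus "x (a k) powr s \<le> 1" using xa[OF a, of k] s by (intro powr_le1) auto
    qed
    thus "\<phi> a \<le> real q" using rq by simp
  qed
  have riskA: "risk p q (schatten_power s) T (A a) \<le> ennreal R" if a: "a \<in> labels r" for a
  proof -
    have "spectral_norm (A a) \<le> M"
      unfolding A_def B_def
    proof (rule spectral_norm_spikes_le[OF uv rq(2,1,3) less_imp_le[OF M]])
      fix k assume "k < r"
      thus "\<bar>M * x (a k)\<bar> \<le> M" using xa[OF a, of k] M by (simp add: abs_mult mult_left_le)
    qed
    moreover have "0 \<le> schatten_power s (A a)" "schatten_power s (A a) \<le> real q * M powr s"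
      unfolding power[OF a] using phi_bd[OF a] Ms by (auto simp: Ms_def mult.commute intro!: mult_left_mono)
    moreover have "A a \<in> carrier_mat p q" by (simp add: A_def)
    ultimately show ?thesis using le by (simp add: power_risk_le_def M_def)
  qed
  have gm1: "gauss_mean I (\<lambda>y. 1 - \<psi> y) b = 1 - gauss_mean I \<psi> b" for b
  proof -
    interpret G: prob_space "gauss I" by (rule prob_space_gauss)
    have "integrable (gauss I) (\<lambda>E. \<psi> (gauss_shift I b E))"
      by (rule G.integrable_const_bound[where B = 1])
         (use \<psi>01 in \<open>auto intro!: measurable_compose[OF gauss_shift_measurable \<psi>m]\<close>)
    thus ?thesis by (simp add: gauss_mean_def G.prob_space)
  qed
  have err0: "gm a * \<Delta> \<le> R + Ms * \<bar>\<phi> a - real r * \<mu>0\<bar>" if a: "a \<in> labels r" for a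
  proof -
    have "gm a * \<Delta> \<le> R + \<bar>schatten_power s (A a) - m0\<bar>"
      unfolding gm_def I_def A_def
      by (rule gauss_mean_le_risk[OF T \<Delta> R riskA[OF a, unfolded A_def] \<psi>m[unfolded I_def] \<psi>01 far0])
    also have "\<bar>schatten_power s (A a) - m0\<bar> = Ms * \<bar>\<phi> a - real r * \<mu>0\<bar>"
      unfolding power[OF a] m0_def right_diff_distrib[symmetric] abs_mult using Ms by simp
    finally show ?thesis .
  qed
  have err1: "(1 - gm a) * \<Delta> \<le> R + Ms * \<bar>\<phi> a - real r * \<mu>1\<bar>" if a: "a \<in> labels r" for a
  proof -
    have "(\<lambda>y. 1 - \<psi> y) \<in> borel_measurable (\<Pi>\<^sub>M i\<in>I. borel)" using \<psi>m by measurable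
    hence "gauss_mean I (\<lambda>y. 1 - \<psi> y) (B a) * \<Delta> \<le> R + \<bar>schatten_power s (A a) - m1\<bar>"
      unfolding I_def A_def
      by (intro gauss_mean_le_risk[OF T \<Delta> R riskA[OF a, unfolded A_def] _ _ _ far1])
         (use \<psi>01 in auto)
    also have "\<bar>schatten_power s (A a) - m1\<bar> = Ms * \<bar>\<phi> a - real r * \<mu>1\<bar>"
      unfolding power[OF a] m1_def right_diff_distrib[symmetric] abs_mult using Ms by simp
    finally show ?thesis unfolding gm1 gm_def .
  qed
  define P where "P = (\<lambda>j a. \<Prod>i<r. prior j i (a i))"
  have Psum: "(\<Sum>a\<in>labels r. P j a) = 1" for j unfolding P_def by (rule prior_prod_sum) simp
  have average: "(\<Sum>a\<in>labels r. P j a * f a) \<le> R + Ms * V"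
    if f: "\<And>a. a \<in> labels r \<Longrightarrow> f a \<le> R + Ms * \<bar>\<phi> a - real r * \<mu>\<bar>"
      and j: "(j, \<nu>) \<in> {(0, \<nu>0), (r, \<nu>1)}" "\<mu> = (\<Sum>b\<in>S. \<nu> b * x b powr s)" for j \<nu> \<mu> f
  proof -
    have "(\<Sum>a\<in>labels r. P j a * f a) \<le> (\<Sum>a\<in>labels r. P j a * (R + Ms * \<bar>\<phi> a - real r * \<mu>\<bar>))"
      unfolding P_def by (intro sum_mono mult_left_mono f prior_prod_nonneg)
    also have "\<dots> = (\<Sum>a\<in>labels r. R * P j a + Ms * (P j a * \<bar>\<phi> a - real r * \<mu>\<bar>))"
      by (intro sum.cong refl) (simp add: algebra_simps)
    also have "\<dots> = R * 1 + Ms * (\<Sum>a\<in>labels r. P j a * \<bar>\<phi> a - real r * \<mu>\<bar>)"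
      unfolding sum.distrib sum_distrib_left[symmetric] Psum ..
    also have "\<dots> \<le> R * 1 + Ms * V"
      using dev[OF j(1)] Ms unfolding j(2) P_def \<phi>_def by (intro add_left_mono mult_left_mono) auto
    finally show ?thesis by simp
  qed
  have H: "hybrid_mean p q r M \<psi> j u v = (\<Sum>a\<in>labels r. P j a * gm a)" for j
    by (simp only: hybrid_mean_def P_def gm_def B_def I_def)
  have h0: "hybrid_mean p q r M \<psi> 0 u v * \<Delta> \<le> R + Ms * V"
  proof -
    have "hybrid_mean p q r M \<psi> 0 u v * \<Delta> = (\<Sum>a\<in>labels r. P 0 a * (gm a * \<Delta>))"
      unfolding H sum_distrib_right by (simp only: mult.assoc)
    also have "\<dots> \<le> R + Ms * V"
      by (rule average[OF err0, of 0 \<nu>0]) (auto simp: \<mu>0_def)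
    finally show ?thesis .
  qed
  have h1: "(1 - hybrid_mean p q r M \<psi> r u v) * \<Delta> \<le> R + Ms * V"
  proof -
    have "1 - hybrid_mean p q r M \<psi> r u v = (\<Sum>a\<in>labels r. P r a * (1 - gm a))"
      unfolding H right_diff_distrib sum_subtractf mult_1_right Psum ..
    hence "(1 - hybrid_mean p q r M \<psi> r u v) * \<Delta> = (\<Sum>a\<in>labels r. P r a * ((1 - gm a) * \<Delta>))"
      unfolding sum_distrib_right by (simp only: mult.assoc sum_distrib_right)
    also have "\<dots> \<le> R + Ms * V"
      by (rule average[OF err1, of r \<nu>1]) (auto simp: \<mu>1_def)
    finally show ?thesis .
  qed
  have "(1 / 4) * \<Delta> \<le> (1 - (hybrid_mean p q r M \<psi> r u v - hybrid_mean p q r M \<psi> 0 u v)) * \<Delta>"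
    using close hidden \<Delta> by (intro mult_right_mono) auto
  also have "\<dots> = (1 - hybrid_mean p q r M \<psi> r u v) * \<Delta> + hybrid_mean p q r M \<psi> 0 u v * \<Delta>"
    by (simp add: algebra_simps)
  also have "\<dots> \<le> 2 * (R + Ms * V)" using add_mono[OF h1 h0] by (simp only: mult_2)
  finally have "Ms * (real r * \<kappa>) / 4 \<le> 2 * (R + Ms * V)" using \<Delta>ge by linarith
  thus ?thesis by (simp add: Ms_def algebra_simps)
qed

text \<open>With \<open>L = 1\<close> only the total masses have to agree, so the two extreme values may be used.\<close>
lemma two_point_priors:
  "matched_priors {0, 1 :: nat} real (\<lambda>j. of_bool (j = 0)) (\<lambda>j. of_bool (j = 1)) 1"
  by unfold_locales auto

lemma power_risk_bound_rank_one:
  assumes q: "0 < q" "q \<le> p" and s: "0 < s" and T: "power_risk_le p q s T R"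
  shows "sv_bound p q powr s / 8 \<le> R"
proof -
  interpret matched_priors "{0, 1 :: nat}" real "\<lambda>j. of_bool (j = 0)" "\<lambda>j. of_bool (j = 1)" 1
    by (rule two_point_priors)
  have "sv_bound p q powr s * (real 1 * 1 / 8 - 0) \<le> R"
  proof (rule risk_lower_bound[OF q(2) _ _ s refl T])
    fix j :: nat and \<nu> :: "nat \<Rightarrow> real"
    assume j: "(j, \<nu>) \<in> {(0, \<lambda>j. of_bool (j = 0)), (1, \<lambda>j. of_bool (j = 1))}"
    have "(\<Prod>i<1. prior j i (a i)) * \<bar>(\<Sum>k<1. real (a k) powr s) - real 1 * (\<Sum>b\<in>{0, 1}. \<nu> b * real b powr s)\<bar> = 0"
      if "a \<in> {..<1} \<rightarrow>\<^sub>E {0, 1}" for a :: "nat \<Rightarrow> nat"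
    proof -
      have "a 0 = 0 \<or> a 0 = 1" using that by (auto simp: PiE_iff)
      thus ?thesis using j unfolding prior_def by auto
    qed
    thus "(\<Sum>a\<in>{..<1} \<rightarrow>\<^sub>E {0, 1 :: nat}. (\<Prod>i<1. prior j i (a i)) *
        \<bar>(\<Sum>k<1. real (a k) powr s) - real 1 * (\<Sum>b\<in>{0, 1}. \<nu> b * real b powr s)\<bar>) \<le> 0"
      by (intro eq_refl sum.neutral ballI)
  qed (use q in auto)
  thus ?thesis by simp
qed

text \<open>Take \<open>r\<close> about \<open>q / 2\<close> and \<open>L\<close> even of order \<open>ln q\<close>. The gap \<open>r \<kappa>\<close> is of order \<open>q / (ln q)\<^sup>s\<close> and dominates the
  fluctuation \<open>\<surd>r\<close> for large \<open>q\<close>.\<close>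
lemma power_risk_bound_large:
  assumes s: "0 < s" and ne: "\<nexists>k :: nat. even k \<and> s = real k"
  obtains c q0 where "0 < c" "3 \<le> q0" "\<And>p q T R. \<lbrakk>q0 \<le> q; q \<le> p; power_risk_le p q s T R\<rbrakk> \<Longrightarrow>
     c * (real q / ln (real q) powr s) * sv_bound p q powr s \<le> R"
proof -
  obtain c L0 where c: "0 < c" and priors: "\<And>L. L0 \<le> L \<Longrightarrow> even L \<Longrightarrow> 0 < L \<Longrightarrow>
     \<exists>x \<nu>0 \<nu>1. matched_priors {..<4 * L} x \<nu>0 \<nu>1 L
       \<and> c * real L powr (- s) \<le> (\<Sum>j<4 * L. (\<nu>1 j - \<nu>0 j) * x j powr s)"
    by (rule moment_matched_priors_exist[OF s ne]) (rule that)
  define c1 where "c1 = c * 4 powr (- s)"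
  have c1: "0 < c1" using c by (simp add: c1_def)
  have "eventually (\<lambda>q. 16 \<le> c1 * sqrt (real q / 2) * ln (real q) powr (- s)) sequentially"
    using c1 s by real_asymp
  moreover have "eventually (\<lambda>q. real L0 \<le> ln (real q)) sequentially" by real_asymp
  ultimately have "eventually (\<lambda>q. 16 \<le> c1 * sqrt (real q / 2) * ln (real q) powr (- s) \<and> real L0 \<le> ln (real q)) sequentially"
    by (rule eventually_conj)
  then obtain q1 where q1: "\<And>q. q1 \<le> q \<Longrightarrow> 16 \<le> c1 * sqrt (real q / 2) * ln (real q) powr (- s) \<and> real L0 \<le> ln (real q)"
    by (auto simp: eventually_sequentially)
  have main: "c1 / 32 * (real q / ln (real q) powr s) * sv_bound p q powr s \<le> R"
    if q: "max 3 q1 \<le> q" "q \<le> p" and T: "power_risk_le p q s T R" for p q T R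
  proof -
    have q3: "3 \<le> q" "q1 \<le> q" using q by auto
    have ln1: "1 \<le> ln (real q)"
    proof -
      have "exp 1 \<le> real q" using exp_le q3 by linarith
      thus ?thesis using q3 by (subst ln_ge_iff) auto
    qed
    \<comment> \<open>The least even integer that is at least \<open>ln q + 1\<close>, so that \<open>10\<^sup>L \<ge> 10 q\<close>.\<close>
    define L where "L = 2 * nat \<lceil>(ln (real q) + 1) / 2\<rceil>"
    have L_eq: "real L = 2 * of_int \<lceil>(ln (real q) + 1) / 2\<rceil>" using ln1 by (simp add: L_def)
    have L_ge: "ln (real q) + 1 \<le> real L"
    proof -
      have "2 * ((ln (real q) + 1) / 2) \<le> 2 * real_of_int \<lceil>(ln (real q) + 1) / 2\<rceil>"
        by (intro mult_left_mono le_of_int_ceiling) simp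
      moreover have "2 * ((ln (real q) + 1) / 2) = ln (real q) + 1" by simp
      ultimately show ?thesis unfolding L_eq by (simp only:)
    qed
    have L_le: "real L \<le> 4 * ln (real q)"
    proof -
      have "2 * real_of_int \<lceil>(ln (real q) + 1) / 2\<rceil> \<le> 2 * ((ln (real q) + 1) / 2 + 1)"
        by (intro mult_left_mono of_int_ceiling_le_add_one) simp
      also have "\<dots> = ln (real q) + 3" by simp
      also have "\<dots> \<le> 4 * ln (real q)" using ln1 by simp
      finally show ?thesis unfolding L_eq .
    qed
    have L0: "L0 \<le> L" using q1[OF q3(2)] L_ge by linarith
    have Lp: "0 < L" using L_ge ln1 by linarith
    obtain x \<nu>0 \<nu>1 where mp: "matched_priors {..<4 * L} x \<nu>0 \<nu>1 L"
      and gap: "c * real L powr (- s) \<le> (\<Sum>j<4 * L. (\<nu>1 j - \<nu>0 j) * x j powr s)"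
      using priors[OF L0 _ Lp] by (auto simp: L_def)
    interpret matched_priors "{..<4 * L}" x \<nu>0 \<nu>1 L by (rule mp)
    define r where "r = Suc q div 2"
    have r: "0 < r" "2 * r \<le> Suc q" "real q / 2 \<le> real r" using q3 by (auto simp: r_def)
    define lq where "lq = ln (real q) powr (- s)"
    have lq: "0 < lq" using ln1 by (simp add: lq_def)
    have \<kappa>: "c1 * lq \<le> c * real L powr (- s)"
    proof -
      have "c1 * lq = c * (4 * ln (real q)) powr (- s)"
        using ln1 by (simp add: c1_def lq_def powr_mult)
      also have "\<dots> \<le> c * real L powr (- s)"
        using c L_le Lp s by (intro mult_left_mono powr_mono2') auto
      finally show ?thesis .
    qed
    have "sv_bound p q powr s * (real r * (c1 * lq) / 8 - sqrt (real r)) \<le> R"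
    proof (rule risk_lower_bound[OF q(2) r(1,2) s refl T])
      have "(1 / 10 :: real) ^ L \<le> 1 / (10 * real q)"
      proof -
        have "10 * real q \<le> 10 powr 1 * 10 powr ln (real q)"
        proof -
          have "real q = exp 1 powr ln (real q)" using q3 by (simp add: powr_def)
          also have "\<dots> \<le> 10 powr ln (real q)" using exp_le ln1 by (intro powr_mono2) auto
          finally show ?thesis by simp
        qed
        also have "\<dots> = 10 powr (ln (real q) + 1)" by (simp add: powr_add)
        also have "\<dots> \<le> 10 powr real L" using L_ge by (intro powr_mono) auto
        also have "\<dots> = 10 ^ L" by (simp add: powr_realpow)
        finally show ?thesis using q3 by (simp add: power_one_over divide_simps)
      qed
      hence "real r * (17 / 4 * (1 / 10) ^ L) \<le> real q * (17 / 4 * (1 / (10 * real q)))"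
        using r q3 by (intro mult_mono) auto
      also have "\<dots> \<le> 1 / 2" using q3 by simp
      finally show "real r * (17 / 4 * (1 / 10) ^ L) \<le> 1 / 2" .
    next
      show "0 < c1 * lq" using c1 lq by simp
      show "c1 * lq \<le> (\<Sum>b\<in>{..<4 * L}. (\<nu>1 b - \<nu>0 b) * x b powr s)" using \<kappa> gap by linarith
    next
      fix j \<nu> assume j: "(j, \<nu>) \<in> {(0, \<nu>0), (r, \<nu>1)}"
      show "(\<Sum>a\<in>{..<r} \<rightarrow>\<^sub>E {..<4 * L}. (\<Prod>i<r. prior j i (a i)) * \<bar>(\<Sum>k<r. x (a k) powr s)
          - real r * (\<Sum>b\<in>{..<4 * L}. \<nu> b * x b powr s)\<bar>) \<le> sqrt (real r)"
      proof (rule prior_mean_deviation)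
        fix b assume "b \<in> {..<4 * L}"
        thus "0 \<le> x b powr s" "x b powr s \<le> 1" using x_bounds[of b] s by (auto intro: powr_le1)
      qed (use j in \<open>auto simp: prior_def\<close>)
    qed
    moreover have "real q * (c1 * lq) / 32 \<le> real r * (c1 * lq) / 8 - sqrt (real r)"
    proof -
      have "16 \<le> c1 * sqrt (real q / 2) * lq" using q1[OF q3(2)] by (simp add: lq_def)
      also have "\<dots> \<le> c1 * sqrt (real r) * lq" using r c1 lq by (intro mult_mono) auto
      finally have "16 * sqrt (real r) \<le> (c1 * sqrt (real r) * lq) * sqrt (real r)"
        by (intro mult_right_mono) auto
      also have "\<dots> = c1 * lq * (sqrt (real r) * sqrt (real r))" by (simp only: mult_ac)
      also have "\<dots> = real r * (c1 * lq)" by simp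
      finally have "sqrt (real r) \<le> real r * (c1 * lq) / 16" by simp
      moreover have "real q / 2 * (c1 * lq) \<le> real r * (c1 * lq)" using r c1 lq by (intro mult_right_mono) auto
      ultimately show ?thesis by linarith
    qed
    ultimately have "sv_bound p q powr s * (real q * (c1 * lq) / 32) \<le> R"
      by (meson mult_left_mono order_trans powr_ge_zero)
    moreover have "lq = 1 / ln (real q) powr s" by (simp add: lq_def powr_minus_divide)
    ultimately show ?thesis by (simp add: mult_ac)
  qed
  show ?thesis
    by (rule that[of "c1 / 32" "max 3 q1"]) (use c1 in simp, simp, rule main)
qed

section \<open>The two minimax bounds\<close>

lemma power_risk_bound:
  assumes s: "0 < s" and ne: "\<nexists>k :: nat. even k \<and> s = real k"
  obtains c where "0 < c" "\<And>p q T R. \<lbrakk>0 < q; q \<le> p; power_risk_le p q s T R\<rbrakk> \<Longrightarrow>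
     c * (real q / max (ln (real q) powr s) 1) * (real p * real q) powr (s / 4) \<le> R"
proof -
  obtain c1 q0 where c1: "0 < c1" "3 \<le> q0" and large: "\<And>p q T R. \<lbrakk>q0 \<le> q; q \<le> p; power_risk_le p q s T R\<rbrakk> \<Longrightarrow>
     c1 * (real q / ln (real q) powr s) * sv_bound p q powr s \<le> R"
    by (rule power_risk_bound_large[OF s ne]) (rule that)
  define e where "e = (0.125 :: real) powr s"
  have e: "0 < e" by (simp add: e_def)
  define c where "c = min (c1 * e) (e / (8 * real q0))"
  have c: "0 < c" using c1 e by (simp add: c_def)
  have main: "c * (real q / max (ln (real q) powr s) 1) * (real p * real q) powr (s / 4) \<le> R"
    if q: "0 < q" "q \<le> p" and T: "power_risk_le p q s T R" for p q T R
  proof -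
    define P where "P = (real p * real q) powr (s / 4)"
    have P: "0 \<le> P" by (simp add: P_def)
    have Ms: "sv_bound p q powr s = e * P"
      by (simp only: e_def P_def powr_mult powr_powr) simp
    show ?thesis
    proof (cases "q0 \<le> q")
      case True
      have "exp 1 \<le> real q" using exp_le True c1 by linarith
      hence "1 \<le> ln (real q)" using q by (subst ln_ge_iff) auto
      hence l: "max (ln (real q) powr s) 1 = ln (real q) powr s" "0 < ln (real q) powr s"
        using s by (auto intro!: max_absorb1 ge_one_powr_ge_zero)
      have "c * (real q / ln (real q) powr s) * P \<le> c1 * e * (real q / ln (real q) powr s) * P"
        using P l by (intro mult_right_mono) (auto simp: c_def)
      also have "\<dots> \<le> R" using large[OF True q(2) T] unfolding Ms by (simp add: mult_ac)
      finally show ?thesis unfolding l P_def .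
    next
      case False
      have "real q / max (ln (real q) powr s) 1 \<le> real q / 1" by (intro divide_left_mono) auto
      hence "real q / max (ln (real q) powr s) 1 \<le> real q0" using False by simp
      hence "c * (real q / max (ln (real q) powr s) 1) * P \<le> e / (8 * real q0) * real q0 * P"
        using P e by (intro mult_right_mono mult_mono) (auto simp: c_def)
      also have "\<dots> = e * P / 8" using c1 by simp
      also have "\<dots> \<le> R" using power_risk_bound_rank_one[OF q s T] unfolding Ms .
      finally show ?thesis unfolding P_def .
    qed
  qed
  show ?thesis by (rule that[OF c]) (rule main)
qed

lemma powr_lipschitz:
  fixes a b c s :: real
  assumes s: "1 \<le> s" and a: "0 \<le> a" "a \<le> b" and c: "0 \<le> c" "c \<le> b"
  shows "\<bar>a powr s - c powr s\<bar> \<le> s * b powr (s - 1) * \<bar>a - c\<bar>"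
proof -
  have *: "\<bar>y powr s - x powr s\<bar> \<le> s * b powr (s - 1) * \<bar>y - x\<bar>"
    if xy: "0 \<le> x" "x < y" "y \<le> b" for x y
  proof -
    have d: "((\<lambda>z. z powr s) has_real_derivative s * z powr (s - 1)) (at z)" if "x < z" for z
      using that xy by (intro has_real_derivative_powr) auto
    have "\<exists>l z. x < z \<and> z < y \<and> ((\<lambda>z. z powr s) has_real_derivative l) (at z) \<and> y powr s - x powr s = (y - x) * l"
    proof (rule MVT)
      show "continuous_on {x..y} (\<lambda>z. z powr s)"
        by (intro continuous_on_powr' continuous_intros) (use xy s in auto)
      show "(\<lambda>z. z powr s) differentiable (at z)" if "x < z" "z < y" for z
        using d[OF that(1)] by (auto simp: real_differentiable_def)
    qed (use xy in auto)
    then obtain l z where z: "x < z" "z < y" "((\<lambda>z. z powr s) has_real_derivative l) (at z)"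
      and eq: "y powr s - x powr s = (y - x) * l" by blast
    have l: "l = s * z powr (s - 1)" by (rule DERIV_unique[OF z(3) d[OF z(1)]])
    have "z powr (s - 1) \<le> b powr (s - 1)" using z xy s by (intro powr_mono2) auto
    hence "l \<le> s * b powr (s - 1)" unfolding l using s by (intro mult_left_mono) auto
    moreover have "0 \<le> l" unfolding l using s by simp
    ultimately have "\<bar>y - x\<bar> * \<bar>l\<bar> \<le> \<bar>y - x\<bar> * (s * b powr (s - 1))" by (intro mult_left_mono) auto
    thus ?thesis unfolding eq abs_mult by (simp only: mult.commute)
  qed
  consider "a < c" | "a = c" | "c < a" by linarith
  thus ?thesis
  proof cases
    case 1
    thus ?thesis using *[of a c] a c by (simp add: abs_minus_commute)
  next
    case 2
    thus ?thesis by simp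
  next
    case 3
    thus ?thesis using *[of c a] a c by simp
  qed
qed

text \<open>On the matrices in question the norm lies in \<open>[0, b]\<close>. Clipping the estimator to this interval does not increase
  its error, and there the \<open>s\<close>-th power is Lipschitz with constant \<open>s b\<^bsup>s-1\<^esup>\<close>.\<close>
lemma norm_risk_imp_power_risk:
  assumes s: "1 \<le> s" and M: "M = sv_bound p q"
    and T: "T \<in> estimators p q" and R: "0 \<le> R"
    and risk: "\<And>A. A \<in> carrier_mat p q \<Longrightarrow> spectral_norm A \<le> M \<Longrightarrow> risk p q (schatten_norm s) T A \<le> ennreal R"
  defines "b \<equiv> real q powr (1 / s) * M"
  shows "power_risk_le p q s (\<lambda>Y. (max 0 (min b (T Y))) powr s) (s * b powr (s - 1) * R)"
  unfolding power_risk_le_def M[symmetric]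
proof (intro conjI ballI impI)
  define K where "K = s * b powr (s - 1)"
  have K: "0 \<le> K" using s by (simp add: K_def)
  have M0: "0 \<le> M" by (simp add: M)
  have b: "0 \<le> b" using M0 by (simp add: b_def)
  have bs: "b powr s = real q * M powr s"
    using s M0 by (simp add: b_def powr_mult powr_powr)
  show "(\<lambda>Y. (max 0 (min b (T Y))) powr s) \<in> estimators p q"
    using T unfolding estimators_def mem_Collect_eq by measurable
  show "0 \<le> s * b powr (s - 1) * R" using K R by (simp add: K_def)
  fix A assume A: "A \<in> carrier_mat p q" "spectral_norm A \<le> M" "0 \<le> schatten_power s A"
    "schatten_power s A \<le> real q * M powr s"
  define t where "t = schatten_norm s A"
  have t: "0 \<le> t" by (simp add: t_def schatten_norm_def)
  have ts: "t powr s = schatten_power s A"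
    using s A(3) by (simp add: t_def schatten_norm_def powr_powr)
  have tb: "t \<le> b"
  proof (rule ccontr)
    assume "\<not> t \<le> b"
    hence "b powr s < t powr s" using s b by (intro powr_less_mono2) auto
    thus False using A(4) by (simp add: ts bs)
  qed
  have AB: "A = Matrix.mat p q (\<lambda>ij. A $$ ij)" using A(1) by (intro eq_matI) auto
  have meas: "(\<lambda>E. T (A + Matrix.mat p q E)) \<in> borel_measurable (gauss ({..<p} \<times> {..<q}))"
    by (subst AB) (rule estimator_shift_measurable[OF T])
  have "risk p q (schatten_power s) (\<lambda>Y. (max 0 (min b (T Y))) powr s) A
      \<le> (\<integral>\<^sup>+E. ennreal K * ennreal \<bar>T (A + Matrix.mat p q E) - t\<bar> \<partial>gauss ({..<p} \<times> {..<q}))"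
    unfolding risk_def gaussian_entries_eq
  proof (rule nn_integral_mono)
    fix E
    define y where "y = T (A + Matrix.mat p q E)"
    have "\<bar>max 0 (min b y) powr s - t powr s\<bar> \<le> K * \<bar>max 0 (min b y) - t\<bar>"
      unfolding K_def by (intro powr_lipschitz s t tb) (use b in auto)
    also have "\<dots> \<le> K * \<bar>y - t\<bar>" using K t tb by (intro mult_left_mono) auto
    finally have "\<bar>max 0 (min b y) powr s - schatten_power s A\<bar> \<le> K * \<bar>y - t\<bar>" unfolding ts .
    from ennreal_leI[OF this]
    show "ennreal \<bar>max 0 (min b (T (A + Matrix.mat p q E))) powr s - schatten_power s A\<bar>
      \<le> ennreal K * ennreal \<bar>T (A + Matrix.mat p q E) - t\<bar>"
      unfolding y_def by (simp only: ennreal_mult[OF K abs_ge_zero])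
  qed
  also have "\<dots> = ennreal K * risk p q (schatten_norm s) T A"
    unfolding risk_def gaussian_entries_eq t_def[symmetric] using meas
    by (intro nn_integral_cmult) auto
  also have "\<dots> \<le> ennreal K * ennreal R" by (intro mult_left_mono risk A) auto
  also have "\<dots> = ennreal (K * R)" by (rule ennreal_mult[OF K R, symmetric])
  finally show "risk p q (schatten_power s) (\<lambda>Y. (max 0 (min b (T Y))) powr s) A \<le> ennreal (s * b powr (s - 1) * R)"
    unfolding K_def .
qed

lemma le_SUP_ennreal:
  assumes "\<And>R. 0 \<le> R \<Longrightarrow> (\<And>a. a \<in> A \<Longrightarrow> f a \<le> ennreal R) \<Longrightarrow> X \<le> R"
  shows "ennreal X \<le> (SUP a\<in>A. f a)"
proof (cases "SUP a\<in>A. f a")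
  case (real R)
  have "f a \<le> ennreal R" if "a \<in> A" for a
    using SUP_upper[OF that, of f] real by simp
  hence "X \<le> R" using assms real by blast
  thus ?thesis using real by (simp add: ennreal_leI)
next
  case top
  show ?thesis unfolding top by (rule top_greatest)
qed

theorem corollary4p10:
  fixes s :: real
  assumes "s \<ge> 1"
    and "\<nexists>k :: nat. even k \<and> s = real k"
  shows "\<exists>c > (0 :: real). \<exists>c' > (0 :: real). \<forall>(p :: nat) (q :: nat). 0 < q \<and> q \<le> p \<longrightarrow>
    (INF T \<in> estimators p q.
       SUP A \<in> {A \<in> carrier_mat p q. spectral_norm A \<le> 0.125 * (real p * real q) powr (1 / 4)}.
         risk p q (schatten_power s) T A)
      \<ge> ennreal (c * (real q / max ((ln (real q)) powr s) 1) * (real p * real q) powr (s / 4))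
    \<and>
    (INF T \<in> estimators p q.
       SUP A \<in> {A \<in> carrier_mat p q. spectral_norm A \<le> 0.125 * (real p * real q) powr (1 / 4)}.
         risk p q (schatten_norm s) T A)
      \<ge> ennreal (c' * (real q powr (1 / s) / max ((ln (real q)) powr s) 1)
                  * (real p * real q) powr (1 / 4))"
proof -
  have s: "0 < s" using assms(1) by simp
  obtain c where c: "0 < c" and bound: "\<And>p q T R. \<lbrakk>0 < q; q \<le> p; power_risk_le p q s T R\<rbrakk> \<Longrightarrow>
     c * (real q / max (ln (real q) powr s) 1) * (real p * real q) powr (s / 4) \<le> R"
    by (rule power_risk_bound[OF s assms(2)]) (rule that)
  define c' where "c' = c / (s * 0.125 powr (s - 1))"
  have c': "0 < c'" using c s by (simp add: c'_def)
  have power: "ennreal (c * (real q / max ((ln (real q)) powr s) 1) * (real p * real q) powr (s / 4))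
      \<le> (INF T \<in> estimators p q.
       SUP A \<in> {A \<in> carrier_mat p q. spectral_norm A \<le> sv_bound p q}.
         risk p q (schatten_power s) T A)" if q: "0 < q" "q \<le> p" for p q
  proof (intro INF_greatest le_SUP_ennreal)
    fix T R assume T: "T \<in> estimators p q" and R: "0 \<le> R"
      and risk: "\<And>A. A \<in> {A \<in> carrier_mat p q. spectral_norm A \<le> sv_bound p q}
        \<Longrightarrow> risk p q (schatten_power s) T A \<le> ennreal R"
    show "c * (real q / max ((ln (real q)) powr s) 1) * (real p * real q) powr (s / 4) \<le> R"
      by (rule bound[OF q]) (use T R risk in \<open>auto simp: power_risk_le_def\<close>)
  qed
  have norm: "ennreal (c' * (real q powr (1 / s) / max ((ln (real q)) powr s) 1) * (real p * real q) powr (1 / 4))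
      \<le> (INF T \<in> estimators p q.
       SUP A \<in> {A \<in> carrier_mat p q. spectral_norm A \<le> sv_bound p q}.
         risk p q (schatten_norm s) T A)" if q: "0 < q" "q \<le> p" for p q
  proof (intro INF_greatest le_SUP_ennreal)
    fix T R assume T: "T \<in> estimators p q" and R: "0 \<le> R"
      and risk: "\<And>A. A \<in> {A \<in> carrier_mat p q. spectral_norm A \<le> sv_bound p q}
        \<Longrightarrow> risk p q (schatten_norm s) T A \<le> ennreal R"
    define P where "P = real p * real q"
    have P: "0 < P" using q by (simp add: P_def)
    define b where "b = real q powr (1 / s) * (0.125 * P powr (1 / 4))"
    define K where "K = s * b powr (s - 1)"
    have b: "0 < b" using q P by (simp add: b_def)
    hence K: "0 < K" using s by (simp add: K_def)
    define l where "l = max ((ln (real q)) powr s) 1"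
    have "power_risk_le p q s (\<lambda>Y. (max 0 (min b (T Y))) powr s) (K * R)"
      unfolding b_def K_def P_def
      by (rule norm_risk_imp_power_risk[OF assms(1) refl T R]) (use risk in auto)
    from bound[OF q this] have le: "c * (real q / l) * P powr (s / 4) \<le> K * R" by (simp only: P_def l_def)
    have "b powr (s - 1) = real q powr ((s - 1) / s) * (0.125 powr (s - 1) * P powr ((s - 1) / 4))"
      unfolding b_def by (simp only: powr_mult powr_powr) (simp add: field_simps)
    hence "K * (c' * (real q powr (1 / s) / l) * P powr (1 / 4))
       = c / l * (real q powr (1 / s) * real q powr ((s - 1) / s)) * (P powr (1 / 4) * P powr ((s - 1) / 4))"
      using s by (simp add: K_def c'_def)
    also have "real q powr (1 / s) * real q powr ((s - 1) / s) = real q"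
      using s q by (simp add: powr_add[symmetric] add_divide_distrib[symmetric])
    also have "P powr (1 / 4) * P powr ((s - 1) / 4) = P powr (s / 4)"
      by (simp add: powr_add[symmetric] add_divide_distrib[symmetric])
    also have "c / l * real q * P powr (s / 4) = c * (real q / l) * P powr (s / 4)" by simp
    also note le
    finally have "K * (c' * (real q powr (1 / s) / l) * P powr (1 / 4)) \<le> K * R" .
    hence "c' * (real q powr (1 / s) / l) * P powr (1 / 4) \<le> R" using K by (simp only: mult_le_cancel_left_pos)
    thus "c' * (real q powr (1 / s) / max ((ln (real q)) powr s) 1) * (real p * real q) powr (1 / 4) \<le> R"
      by (simp only: l_def P_def)
  qed
  show ?thesis using c c' power norm by blast
qed

end
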